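(* Let $h>0$, let $\phi:\mathbb{R}\to[0,\infty)$ be locally Lipschitz, and let $L>0$. Consider the nonlinear SDE $$U_t=U_0-\sum_{o \in \{-1,+1\}}\int_0^t \int_0^{\infty} U_{s-}\mathbf{1}\{z \leq \phi(oU_{s-})\}\mathbf{N}^o(ds,dz)+h\sum_{o\in \{-1,+1\}}o \int_0^t \mathbb{E}[\phi(oU_{s})]ds,$$ where $\mathbf{N}^{+1},\mathbf{N}^{-1}$ are independent Poisson random measures on $\mathbb{R}^+\times\mathbb{R}^+$ with intensity $ds\,dz$, independent of $U_0$. Then: 1. Path-wise uniqueness holds for this SDE in the class of processes $(U_t)_{t\ge0}$ whose initial condition satisfies $|U_0|\le L$ almost surely. 2. For every initial condition $U_0$ with $\mathbb{P}(|U_0|\le L)=1$ there exists a unique strong solution $(U_t)_{t\ge 0}$ of this SDE.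
   Context: A solution is a càdlàg adapted process satisfying the equation for all $t\ge0$ almost surely; the drift involves the expectation of $\phi(\pm U_s)$ under the law of the solution itself. *)

theory Defs
  imports "HOL-Probability.Probability"
begin

text \<open>Random measures are modelled as maps from the sample space to measures on
  the Borel sets of the plane (time, mark).\<close>

definition quadrant :: "(real \<times> real) set" where
  "quadrant = {p. 0 \<le> fst p \<and> 0 \<le> snd p}"

definition poisson_random_measure :: "'a measure \<Rightarrow> ('a \<Rightarrow> (real \<times> real) measure) \<Rightarrow> bool" where
  "poisson_random_measure M N \<longleftrightarrow>
     (\<forall>\<omega>\<in>space M. sets (N \<omega>) = sets borel \<and> emeasure (N \<omega>) (UNIV - quadrant) = 0) \<and>
     (\<forall>A\<in>sets borel. (\<lambda>\<omega>. emeasure (N \<omega>) A) \<in> borel_measurable M) \<and>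
     (\<forall>A\<in>sets borel. A \<subseteq> quadrant \<longrightarrow> emeasure lborel A < \<infinity> \<longrightarrow>
        (\<forall>k::nat. measure M {\<omega>\<in>space M. emeasure (N \<omega>) A = of_nat k}
            = exp (- measure lborel A) * measure lborel A ^ k / fact k)) \<and>
     (\<forall>(I::nat set) A. finite I \<longrightarrow> (\<forall>i\<in>I. A i \<in> sets borel) \<longrightarrow> disjoint_family_on A I \<longrightarrow>
        prob_space.indep_vars M (\<lambda>_. borel) (\<lambda>i \<omega>. emeasure (N \<omega>) (A i)) I)"

definition count_events :: "'a measure \<Rightarrow> ('a \<Rightarrow> (real \<times> real) measure) \<Rightarrow> (real \<times> real) set set \<Rightarrow> 'a set set" where
  "count_events M N S = {(\<lambda>\<omega>. emeasure (N \<omega>) A) -` B \<inter> space M | A B. A \<in> S \<and> B \<in> sets (borel :: ennreal measure)}"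

definition rv_events :: "'a measure \<Rightarrow> ('a \<Rightarrow> real) \<Rightarrow> 'a set set" where
  "rv_events M X = {X -` B \<inter> space M | B. B \<in> sets (borel :: real measure)}"

definition past_sets :: "real \<Rightarrow> (real \<times> real) set set" where
  "past_sets t = {A \<in> sets borel. A \<subseteq> {..t} \<times> UNIV}"

definition future_sets :: "real \<Rightarrow> (real \<times> real) set set" where
  "future_sets t = {A \<in> sets borel. A \<subseteq> {t<..} \<times> UNIV}"

definition indep_data :: "'a measure \<Rightarrow> ('a \<Rightarrow> (real \<times> real) measure) \<Rightarrow> ('a \<Rightarrow> (real \<times> real) measure) \<Rightarrow> ('a \<Rightarrow> real) \<Rightarrow> bool" where
  "indep_data M N1 N2 U0 \<longleftrightarrow>
     prob_space.indep_sets M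
       (\<lambda>i::nat. if i = 0 then sigma_sets (space M) (rv_events M U0)
                 else if i = 1 then sigma_sets (space M) (count_events M N1 (sets borel))
                 else sigma_sets (space M) (count_events M N2 (sets borel))) {0, 1, 2}"

definition compatible_filtration :: "'a measure \<Rightarrow> ('a \<Rightarrow> (real \<times> real) measure) \<Rightarrow> ('a \<Rightarrow> (real \<times> real) measure) \<Rightarrow> ('a \<Rightarrow> real) \<Rightarrow> (real \<Rightarrow> 'a set set) \<Rightarrow> bool" where
  "compatible_filtration M N1 N2 U0 F \<longleftrightarrow>
     (\<forall>t\<ge>0. sigma_algebra (space M) (F t) \<and> F t \<subseteq> sets M) \<and>
     (\<forall>s t. 0 \<le> s \<longrightarrow> s \<le> t \<longrightarrow> F s \<subseteq> F t) \<and>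
     rv_events M U0 \<subseteq> F 0 \<and>
     (\<forall>t\<ge>0. count_events M N1 (past_sets t) \<subseteq> F t \<and> count_events M N2 (past_sets t) \<subseteq> F t) \<and>
     (\<forall>t\<ge>0. prob_space.indep_sets M
        (\<lambda>b::bool. if b then F t
           else sigma_sets (space M) (count_events M N1 (future_sets t) \<union> count_events M N2 (future_sets t)))
        UNIV)"

definition natural_filtration :: "'a measure \<Rightarrow> ('a \<Rightarrow> (real \<times> real) measure) \<Rightarrow> ('a \<Rightarrow> (real \<times> real) measure) \<Rightarrow> ('a \<Rightarrow> real) \<Rightarrow> real \<Rightarrow> 'a set set" where
  "natural_filtration M N1 N2 U0 t = sigma_sets (space M)
     (rv_events M U0 \<union> count_events M N1 (past_sets t) \<union> count_events M N2 (past_sets t)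
      \<union> {A \<in> sets M. measure M A = 0})"

definition locally_lipschitz :: "(real \<Rightarrow> real) \<Rightarrow> bool" where
  "locally_lipschitz f \<longleftrightarrow> (\<forall>x. \<exists>e>0. \<exists>K. K-lipschitz_on (cball x e) f)"

definition cadlag_process :: "'a measure \<Rightarrow> (real \<Rightarrow> 'a \<Rightarrow> real) \<Rightarrow> bool" where
  "cadlag_process M U \<longleftrightarrow> (\<forall>\<omega>\<in>space M. \<forall>t\<ge>0.
      continuous (at_right t) (\<lambda>r. U r \<omega>) \<and> (t > 0 \<longrightarrow> (\<exists>l. ((\<lambda>r. U r \<omega>) \<longlongrightarrow> l) (at_left t))))"

definition adapted_process :: "'a measure \<Rightarrow> (real \<Rightarrow> 'a set set) \<Rightarrow> (real \<Rightarrow> 'a \<Rightarrow> real) \<Rightarrow> bool" where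
  "adapted_process M F U \<longleftrightarrow> (\<forall>t\<ge>0. rv_events M (U t) \<subseteq> F t)"

definition left_lim :: "(real \<Rightarrow> 'a \<Rightarrow> real) \<Rightarrow> 'a \<Rightarrow> real \<Rightarrow> real" where
  "left_lim U \<omega> s = (if s \<le> 0 then U 0 \<omega> else Lim (at_left s) (\<lambda>r. U r \<omega>))"

definition jump_integral :: "('a \<Rightarrow> (real \<times> real) measure) \<Rightarrow> (real \<Rightarrow> 'a \<Rightarrow> real) \<Rightarrow> (real \<Rightarrow> real) \<Rightarrow> real \<Rightarrow> 'a \<Rightarrow> real \<Rightarrow> real" where
  "jump_integral N U \<phi> c \<omega> t = (\<integral>p. (if 0 < fst p \<and> fst p \<le> t \<and> snd p \<le> \<phi> (c * left_lim U \<omega> (fst p))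
        then left_lim U \<omega> (fst p) else 0) \<partial>(N \<omega>))"

definition drift_integral :: "'a measure \<Rightarrow> (real \<Rightarrow> 'a \<Rightarrow> real) \<Rightarrow> (real \<Rightarrow> real) \<Rightarrow> real \<Rightarrow> real \<Rightarrow> real" where
  "drift_integral M U \<phi> c t = (LBINT s=0..t. (\<integral>\<omega>. \<phi> (c * U s \<omega>) \<partial>M))"

definition is_solution :: "'a measure \<Rightarrow> ('a \<Rightarrow> (real \<times> real) measure) \<Rightarrow> ('a \<Rightarrow> (real \<times> real) measure) \<Rightarrow> ('a \<Rightarrow> real)
    \<Rightarrow> real \<Rightarrow> (real \<Rightarrow> real) \<Rightarrow> (real \<Rightarrow> 'a set set) \<Rightarrow> (real \<Rightarrow> 'a \<Rightarrow> real) \<Rightarrow> bool" where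
  "is_solution M N1 N2 U0 h \<phi> F U \<longleftrightarrow>
     (\<forall>t\<ge>0. U t \<in> borel_measurable M) \<and>
     adapted_process M F U \<and> cadlag_process M U \<and>
     (\<forall>t\<ge>0. \<forall>c\<in>{-1, 1}. integrable M (\<lambda>\<omega>. \<phi> (c * U t \<omega>))) \<and>
     (\<forall>t\<ge>0. \<forall>c\<in>{-1, 1}. set_integrable lborel {0..t} (\<lambda>s. \<integral>\<omega>. \<phi> (c * U s \<omega>) \<partial>M)) \<and>
     (AE \<omega> in M. \<forall>t\<ge>0. U t \<omega> = U0 \<omega>
        - (jump_integral N1 U \<phi> 1 \<omega> t + jump_integral N2 U \<phi> (-1) \<omega> t)
        + h * (1 * drift_integral M U \<phi> 1 t + (-1) * drift_integral M U \<phi> (-1) t))"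

end

theory Submission
  imports Defs
begin

text \<open>Between jumps a solution follows the deterministic drift, and a jump resets it to \<open>0\<close>.
  As the two Poisson measures almost surely have simple atoms at distinct times, a pathwise argument
  gives \<open>\<bar>U\<^sub>t\<bar> + (sum of the jump sizes) \<le> \<bar>U\<^sub>0\<bar> + h \<integral> E[\<phi>(U\<^sub>s) + \<phi>(-U\<^sub>s)] ds\<close>, so every solution
  is locally bounded by a deterministic function and \<open>\<phi>\<close> may be replaced by a bounded Lipschitz
  function. By the compensation formula the equation is then a Lipschitz fixed point
  problem in \<open>L\<^sup>1\<close>: Gronwall's lemma gives uniqueness and Picard iteration gives existence for every
  truncation level. Taking expectations in the pathwise inequality bounds the drift of the
  truncated solution linearly in time, independently of the truncation level, since jumps from
  heights above \<open>2h\<close> lose more than the drift gains; hence a level growing fast enough in time is never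
  reached, and the truncated solution solves the original equation.\<close>

section \<open>Real functions and jump paths\<close>

text \<open>The law of the solution enters the drift only as a function of time, so the pathwise
  inequality gives a deterministic bound from integrability of the rates alone. The L1 setting is
  dictated by the threshold: a jump is discontinuous in the state and becomes Lipschitz only after
  the mark is integrated out. The linear bound comes from two inequalities. Let R be the sum of the
  two integrated mean rates up to t, J the mean total jump size, and D a bound of \<phi> on
  [-2h, 2h]. The path inequality gives J \<le> L + h R, and comparing heights with 2h gives 2 h R
  \<le> J + 4 h D t; hence h R \<le> L + 4 h D t. Any threshold above h would leave a positive
  multiple of h R; 2h leaves exactly one. Since the drift sees the values and the compensator sees
  the left limits, the second inequality also needs the mean rates of both to have the same time
  integral. The random measures are given through the laws of their counts only. Simple atoms at
  distinct times have to be extracted from integer counts on countably many rectangles and from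
  grids with at most one point per cell.\<close>

lemma locally_lipschitz_on_Icc:
  assumes "locally_lipschitz f"
  obtains C where "C \<ge> 0" "\<And>x y. \<bar>x\<bar> \<le> K \<Longrightarrow> \<bar>y\<bar> \<le> K \<Longrightarrow> \<bar>f x - f y\<bar> \<le> C * \<bar>x - y\<bar>"
proof -
  \<comment> \<open>The library notion is for families indexed by time; a one-point time set turns
    it into a statement on one function, and compactness of [-K, K] then gives a single
    constant.\<close>
  have "local_lipschitz {0::real} {-K..K} (\<lambda>_. f)"
    unfolding local_lipschitz_def
  proof (intro ballI)
    fix x t :: real
    obtain e C where "e > 0" "C-lipschitz_on (cball x e) f"
      using assms unfolding locally_lipschitz_def by blast
    then show "\<exists>u>0. \<exists>L. \<forall>t\<in>cball t u \<inter> {0}. L-lipschitz_on (cball x u \<inter> {-K..K}) f"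
      by (meson Int_lower1 lipschitz_on_subset)
  qed
  from local_lipschitz_compact_implies_lipschitz[OF this]
  obtain C where C: "C-lipschitz_on {-K..K} f" by auto
  show thesis
  proof (rule that)
    show "C \<ge> 0" using C by (rule lipschitz_on_nonneg)
    show "\<bar>f x - f y\<bar> \<le> C * \<bar>x - y\<bar>" if "\<bar>x\<bar> \<le> K" "\<bar>y\<bar> \<le> K" for x y
      using lipschitz_onD[OF C, of x y] that by (simp add: dist_real_def abs_le_iff)
  qed
qed

lemma locally_lipschitz_continuous:
  assumes "locally_lipschitz f" shows "continuous_on UNIV f"
proof -
  have "isCont f x" for x
  proof -
    obtain e C where e: "e > 0" "C-lipschitz_on (cball x e) f"
      using assms unfolding locally_lipschitz_def by blast
    then have "continuous_on (cball x e) f" by (blast intro: lipschitz_on_continuous_on)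
    then have "continuous_on (ball x e) f" by (rule continuous_on_subset) auto
    then show ?thesis using e by (simp add: continuous_on_eq_continuous_at)
  qed
  then show ?thesis by (simp add: continuous_at_imp_continuous_on)
qed

lemma cadlag_bounded:
  fixes u :: "real \<Rightarrow> real"
  assumes R: "\<And>t. t \<ge> 0 \<Longrightarrow> continuous (at_right t) u"
    and L: "\<And>t. t > 0 \<Longrightarrow> \<exists>l. (u \<longlongrightarrow> l) (at_left t)"
  obtains B where "\<And>s. 0 \<le> s \<Longrightarrow> s \<le> T \<Longrightarrow> \<bar>u s\<bar> \<le> B"
proof (cases "T \<ge> 0")
  case True
  \<comment> \<open>The local step of the bisection ranges over all short intervals around a point
    of [0, T]. These may reach below 0, where nothing is known of \<open>u\<close>; hence the
    intersection with \<open>{0..}\<close>.\<close>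
  define P where "P a b \<longleftrightarrow> (\<exists>B. \<forall>s\<in>{a..b} \<inter> {0..}. \<bar>u s\<bar> \<le> B)" for a b
  have bd: "\<exists>B. eventually (\<lambda>s. \<bar>u s\<bar> \<le> B) F" if "(u \<longlongrightarrow> l) F" for l and F :: "real filter"
  proof -
    have "eventually (\<lambda>s. dist (u s) l < 1) F" using that by (rule tendstoD) simp
    then have "eventually (\<lambda>s. \<bar>u s\<bar> \<le> \<bar>l\<bar> + 1) F"
      by eventually_elim (auto simp: dist_real_def)
    then show ?thesis ..
  qed
  have "P 0 T"
    using True
  proof (induction rule: Bolzano)
    case (trans a b c)
    then obtain B1 B2 where "\<forall>s\<in>{a..b} \<inter> {0..}. \<bar>u s\<bar> \<le> B1" "\<forall>s\<in>{b..c} \<inter> {0..}. \<bar>u s\<bar> \<le> B2"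
      unfolding P_def by blast
    then have "\<forall>s\<in>{a..c} \<inter> {0..}. \<bar>u s\<bar> \<le> max B1 B2"
      by (metis IntE IntI atLeastAtMost_iff le_cases max.coboundedI1 max.coboundedI2)
    then show ?case unfolding P_def ..
  next
    case (local x)
    have "(u \<longlongrightarrow> u x) (at_right x)" using R[of x] local by (simp add: continuous_within)
    then obtain B1 where "eventually (\<lambda>s. \<bar>u s\<bar> \<le> B1) (at_right x)" using bd by blast
    then obtain d1 where d1: "d1 > x" "\<And>y. y > x \<Longrightarrow> y < d1 \<Longrightarrow> \<bar>u y\<bar> \<le> B1"
      by (auto simp: eventually_at_right[OF less_add_one])
    have "\<exists>B2 d2. d2 < x \<and> (\<forall>y. y < x \<longrightarrow> d2 < y \<longrightarrow> 0 \<le> y \<longrightarrow> \<bar>u y\<bar> \<le> B2)"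
    proof (cases "x > 0")
      case True
      then obtain B2 where "eventually (\<lambda>s. \<bar>u s\<bar> \<le> B2) (at_left x)" using bd L by blast
      then show ?thesis
        by (metis eventually_at_left[OF True])
    next
      case False
      then have "x = 0" using local by simp
      then show ?thesis by (intro exI[of _ 0] exI[of _ "-1"]) auto
    qed
    then obtain B2 d2 where d2: "d2 < x" "\<And>y. y < x \<Longrightarrow> d2 < y \<Longrightarrow> 0 \<le> y \<Longrightarrow> \<bar>u y\<bar> \<le> B2" by blast
    show ?case
    proof (intro exI[of _ "min (d1 - x) (x - d2)"] conjI allI impI)
      show "0 < min (d1 - x) (x - d2)" using d1 d2 by simp
      fix a b assume ab: "a \<le> x \<and> x \<le> b \<and> b - a < min (d1 - x) (x - d2)"
      show "P a b" unfolding P_def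
      proof (intro exI ballI)
        fix s assume s: "s \<in> {a..b} \<inter> {0..}"
        consider "s < x" | "s = x" | "s > x" by linarith
        then show "\<bar>u s\<bar> \<le> max (max B1 B2) \<bar>u x\<bar>"
        proof cases
          case 1 then show ?thesis using s ab d2(2)[of s] by simp
        next
          case 2 then show ?thesis by simp
        next
          case 3 then show ?thesis using s ab d1(2)[of s] by simp
        qed
      qed
    qed
  qed
  then obtain B where "\<forall>s\<in>{0..T} \<inter> {0..}. \<bar>u s\<bar> \<le> B" unfolding P_def ..
  then show ?thesis by (intro that[of B]) auto
next
  case False
  then show ?thesis using that[of 0] by auto
qed

text \<open>For z \<le> p the difference is at most |x - y|, plus |y| if z exceeds q; for z above p
  it is |y| up to q and 0 afterwards. So [0, p] costs |x - y| and the gap between p and q costs |y|.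
  This is how a discontinuous threshold becomes Lipschitz.\<close>

lemma nn_integral_threshold_diff:
  fixes x y p q :: real
  assumes "p \<ge> 0" "q \<ge> 0"
  shows "(\<integral>\<^sup>+z. ennreal \<bar>(if z \<le> p then x else 0) - (if z \<le> q then y else 0)\<bar> * indicator {0..} z \<partial>lborel)
    \<le> ennreal (\<bar>x - y\<bar> * p + \<bar>y\<bar> * \<bar>p - q\<bar>)"
proof -
  have "(\<integral>\<^sup>+z. ennreal \<bar>(if z \<le> p then x else 0) - (if z \<le> q then y else 0)\<bar> * indicator {0..} z \<partial>lborel)
    \<le> (\<integral>\<^sup>+z. ennreal \<bar>x - y\<bar> * indicator {0..p} z + ennreal \<bar>y\<bar> * indicator {min p q..max p q} z \<partial>lborel)"
    by (intro nn_integral_mono) 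
      (auto simp: indicator_def min_def max_def simp flip: ennreal_plus intro!: ennreal_leI)
  also have "\<dots> = ennreal \<bar>x - y\<bar> * ennreal p + ennreal \<bar>y\<bar> * ennreal \<bar>p - q\<bar>"
    using assms by (subst nn_integral_add) (auto simp: nn_integral_cmult max_def min_def)
  also have "\<dots> = ennreal (\<bar>x - y\<bar> * p + \<bar>y\<bar> * \<bar>p - q\<bar>)"
    using assms by (simp add: ennreal_mult ennreal_plus)
  finally show ?thesis .
qed

text \<open>Strong induction on the number of jump times up to t, splitting at the last one, s.
  Before s the induction hypothesis applies; the jump at s replaces v by v - \<theta> b and so
  lowers the modulus by \<theta> |b|; otherwise |u| grows no faster than A. In the application
  \<theta> is the number of accepted points at time s, and \<theta> \<le> 1 expresses that jumps do
  not coincide.\<close>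

lemma finite_jumps_bound:
  fixes u v b \<theta> a A :: "real \<Rightarrow> real"
  assumes "finite S" and S: "S \<subseteq> {0<..T}"
    and \<theta>: "\<And>s. s \<in> S \<Longrightarrow> 0 \<le> \<theta> s \<and> \<theta> s \<le> 1"
    and b: "\<And>s r. s \<in> S \<Longrightarrow> 0 \<le> r \<Longrightarrow> r \<le> 1 \<Longrightarrow> \<bar>v s - r * b s\<bar> \<le> \<bar>v s\<bar> - r * \<bar>b s\<bar>"
    and left: "\<And>s. s \<in> S \<Longrightarrow> (u \<longlongrightarrow> v s) (at_left s)"
    and u: "\<And>t. 0 \<le> t \<Longrightarrow> t \<le> T \<Longrightarrow> u t = u0 - (\<Sum>s\<in>S \<inter> {..t}. b s * \<theta> s) + a t"
    and a0: "a 0 = 0" "A 0 = 0"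
    and aA: "\<And>r t. 0 \<le> r \<Longrightarrow> r \<le> t \<Longrightarrow> t \<le> T \<Longrightarrow> \<bar>a t - a r\<bar> \<le> A t - A r"
    and "0 \<le> t" "t \<le> T"
  shows "\<bar>u t\<bar> + (\<Sum>s\<in>S \<inter> {..t}. \<bar>b s\<bar> * \<theta> s) \<le> \<bar>u0\<bar> + A t"
  using \<open>0 \<le> t\<close> \<open>t \<le> T\<close>
proof (induction "card (S \<inter> {..t})" arbitrary: t rule: less_induct)
  case less
  show ?case
  proof (cases "S \<inter> {..t} = {}")
    case True
    then show ?thesis using u[OF less.prems] aA[of 0 t] a0 less.prems by auto
  next
    case False
    define s where "s = Max (S \<inter> {..t})"
    have fin: "finite (S \<inter> {..t})" using \<open>finite S\<close> by simp
    have s: "s \<in> S" "s \<le> t" "0 < s" using Max_in[OF fin False] S unfolding s_def by auto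
    have smax: "x \<le> s" if "x \<in> S" "x \<le> t" for x using Max_ge[OF fin] that unfolding s_def by auto
    \<comment> \<open>The induction hypothesis is available at r < s, while the jump starts from the
      left limit v s. Passing from u r to v s costs the error twice, once in the modulus before the
      jump and once in the jump itself. It vanishes as r tends to s.\<close>
    have est: "\<bar>u t\<bar> + (\<Sum>s\<in>S \<inter> {..t}. \<bar>b s\<bar> * \<theta> s) \<le> \<bar>u0\<bar> + A t + 2 * \<bar>u r - v s\<bar>"
      if r: "0 \<le> r" "r < s" "\<And>x. x \<in> S \<Longrightarrow> x < s \<Longrightarrow> x \<le> r" for r
    proof -
      have eq: "S \<inter> {..t} = insert s (S \<inter> {..r})" using s smax r by fastforce
      have ns: "s \<notin> S \<inter> {..r}" using r by auto
      have "card (S \<inter> {..r}) < card (S \<inter> {..t})" unfolding eq using ns \<open>finite S\<close> by simp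
      from less.hyps[OF this] r s less.prems
      have IH: "\<bar>u r\<bar> + (\<Sum>s\<in>S \<inter> {..r}. \<bar>b s\<bar> * \<theta> s) \<le> \<bar>u0\<bar> + A r" by simp
      have sum: "(\<Sum>s\<in>S \<inter> {..t}. f s) = f s + (\<Sum>s\<in>S \<inter> {..r}. f s)" for f :: "real \<Rightarrow> real"
        unfolding eq using ns \<open>finite S\<close> by simp
      have "u t = u r - b s * \<theta> s + (a t - a r)"
        using u[OF less.prems] u[of r] r s less.prems by (simp add: sum)
      moreover have "\<bar>a t - a r\<bar> \<le> A t - A r" using r s less.prems by (intro aA) auto
      moreover have "\<bar>v s - \<theta> s * b s\<bar> \<le> \<bar>v s\<bar> - \<theta> s * \<bar>b s\<bar>" using b[of s "\<theta> s"] \<theta> s by auto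
      moreover have "\<bar>v s\<bar> \<le> \<bar>u r\<bar> + \<bar>u r - v s\<bar>" by linarith
      moreover have "\<bar>u r - b s * \<theta> s + (a t - a r)\<bar> \<le> \<bar>u r - v s\<bar> + \<bar>v s - \<theta> s * b s\<bar> + \<bar>a t - a r\<bar>"
        by (simp add: mult.commute)
      ultimately show ?thesis using IH unfolding sum mult.commute[of "\<bar>b s\<bar>" "\<theta> s"] by simp
    qed
    have "finite (S \<inter> {..<s})" using \<open>finite S\<close> by simp
    \<comment> \<open>\<open>r0\<close> is the previous jump time, or 0 if s is the first
      one.\<close>
    then obtain r0 where r0: "r0 < s" "0 \<le> r0" "\<And>x. x \<in> S \<Longrightarrow> x < s \<Longrightarrow> x \<le> r0"
      using s Max_ge[of "insert 0 (S \<inter> {..<s})"] Max_in[of "insert 0 (S \<inter> {..<s})"]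
      by (metis IntI finite_insert insertCI insertE insert_not_empty IntD2 lessThan_iff)
    have ev: "eventually (\<lambda>r. r \<in> {r0<..<s}) (at_left s)"
      using r0 by (simp add: eventually_at_left_field) (metis)
    have "((\<lambda>r. \<bar>u0\<bar> + A t + 2 * \<bar>u r - v s\<bar>) \<longlongrightarrow> \<bar>u0\<bar> + A t + 2 * \<bar>v s - v s\<bar>) (at_left s)"
      by (intro tendsto_intros left s)
    then have "\<bar>u t\<bar> + (\<Sum>s\<in>S \<inter> {..t}. \<bar>b s\<bar> * \<theta> s) \<le> \<bar>u0\<bar> + A t + 2 * \<bar>v s - v s\<bar>"
    proof (rule tendsto_lowerbound)
      show "eventually (\<lambda>r. \<bar>u t\<bar> + (\<Sum>s\<in>S \<inter> {..t}. \<bar>b s\<bar> * \<theta> s) \<le> \<bar>u0\<bar> + A t + 2 * \<bar>u r - v s\<bar>) (at_left s)"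
        using ev
      proof eventually_elim
        case (elim r)
        then show ?case using r0(2,3) by (intro est) force+
      qed
    qed simp
    then show ?thesis by simp
  qed
qed

section \<open>Integer-valued measures on the plane\<close>

text \<open>On the time slab the measure sits on finitely many vertical lines, and the integrand
  depends on the mark only through a threshold of at most m, inside the box. The integral is thus a
  finite sum of slice masses; integrability comes with it and excludes the default value 0 of the
  Bochner integral.\<close>

lemma integral_on_atoms:
  fixes \<nu> :: "(real \<times> real) measure" and b f :: "real \<Rightarrow> real"
  assumes sets: "sets \<nu> = sets borel" and "finite S"
    and conc: "emeasure \<nu> ({0<..T} \<times> {0..m} - S \<times> UNIV) = 0"
    and null: "emeasure \<nu> (- ({0<..} \<times> {0..})) = 0"
    and fin: "emeasure \<nu> ({0<..T} \<times> {0..m}) < \<infinity>"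
    and S: "S \<subseteq> {0<..T}" and f: "\<And>s. 0 < s \<Longrightarrow> s \<le> T \<Longrightarrow> f s \<le> m"
    and "t \<le> T"
    and meas: "(\<lambda>p. if 0 < fst p \<and> fst p \<le> t \<and> snd p \<le> f (fst p) then b (fst p) else 0) \<in> borel_measurable borel"
  shows "integrable \<nu> (\<lambda>p. if 0 < fst p \<and> fst p \<le> t \<and> snd p \<le> f (fst p) then b (fst p) else 0)" (is "integrable \<nu> ?g")
    and "(\<integral>p. (if 0 < fst p \<and> fst p \<le> t \<and> snd p \<le> f (fst p) then b (fst p) else 0) \<partial>\<nu>)
      = (\<Sum>s\<in>S \<inter> {..t}. b s * measure \<nu> ({s} \<times> {0..f s}))"
proof -
  let ?h = "\<lambda>p. \<Sum>s\<in>S \<inter> {..t}. b s * indicator ({s} \<times> {0..f s}) p"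
  have m[measurable]: "{s} \<times> {0..r} \<in> sets \<nu>" for s r :: real
    unfolding sets by (intro borel_closed closed_Times) auto
  have mS: "{0<..T} \<times> {0..m} - S \<times> UNIV \<in> sets borel"
    using finite_imp_closed[OF \<open>finite S\<close>] by (intro sets.Diff borel_Times) auto
  have int: "integrable \<nu> (\<lambda>p. b s * indicator ({s} \<times> {0..f s}) p)" if "s \<in> S" for s
  proof (intro integrable_mult_right integrable_real_indicator m)
    have "emeasure \<nu> ({s} \<times> {0..f s}) \<le> emeasure \<nu> ({0<..T} \<times> {0..m})"
      using that S f[of s] by (intro emeasure_mono) (auto simp: sets borel_Times subset_iff)
    then show "emeasure \<nu> ({s} \<times> {0..f s}) < \<infinity>" using fin by (rule le_less_trans)
  qed
  have "AE p in \<nu>. p \<notin> - ({0<..} \<times> {0..})"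
    by (rule AE_not_in) (use null in \<open>auto simp: null_sets_def sets borel_Times intro!: borel_comp\<close>)
  moreover have "AE p in \<nu>. p \<notin> {0<..T} \<times> {0..m} - S \<times> UNIV"
    by (rule AE_not_in) (use conc mS in \<open>simp add: null_sets_def sets\<close>)
  ultimately have eq: "AE p in \<nu>. ?g p = ?h p"
  proof eventually_elim
    case (elim p)
    have *: "?h p = (\<Sum>s\<in>S \<inter> {..t}. if s = fst p then b s * indicator ({s} \<times> {0..f s}) p else 0)"
      by (intro sum.cong) (auto simp: indicator_def)
    have "?h p = (if fst p \<in> S \<inter> {..t} then b (fst p) * indicator ({fst p} \<times> {0..f (fst p)}) p else 0)"
      unfolding * using \<open>finite S\<close> by (simp add: sum.delta)
    also have "\<dots> = ?g p"
      using elim f[of "fst p"] \<open>t \<le> T\<close> by (cases p) (auto simp: indicator_def)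
    finally show ?case by simp
  qed
  have meas': "?g \<in> borel_measurable \<nu>" using meas measurable_cong_sets[OF sets refl] by blast
  have hint: "integrable \<nu> ?h" using int by (intro Bochner_Integration.integrable_sum) auto
  show "integrable \<nu> ?g"
    using hint integrable_cong_AE[OF meas' borel_measurable_integrable[OF hint] eq] by simp
  show "integral\<^sup>L \<nu> ?g = (\<Sum>s\<in>S \<inter> {..t}. b s * measure \<nu> ({s} \<times> {0..f s}))"
    unfolding integral_cong_AE[OF meas' borel_measurable_integrable[OF hint] eq]
    using int by (subst Bochner_Integration.integral_sum) auto
qed

text \<open>The atom time is the infimum of the rational q for which the counts up to q are not both
  zero. Strips ending before it are null; after any such q at least one point is used up, so a total
  of at most 1 leaves nothing. Rational end points are used because an almost sure statement covers
  only countably many rectangles at once.\<close>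

lemma single_atom_of_integer_valued:
  fixes \<mu> \<nu> :: "(real \<times> real) measure" and I :: "real set"
  assumes sets: "sets \<mu> = sets borel" "sets \<nu> = sets borel" "I \<in> sets borel"
    and int: "\<And>q. q \<in> \<rat> \<Longrightarrow> emeasure \<mu> ({a<..q} \<times> I) \<in> range of_nat"
      "\<And>q. q \<in> \<rat> \<Longrightarrow> emeasure \<nu> ({a<..q} \<times> I) \<in> range of_nat"
    and le: "emeasure \<mu> ({a<..b} \<times> I) + emeasure \<nu> ({a<..b} \<times> I) \<le> 1"
    and ab: "a \<in> \<rat>" "b \<in> \<rat>" "a < b"
  obtains s where "s \<in> {a<..b}"
    "emeasure \<mu> ({a<..b} \<times> I - {s} \<times> UNIV) = 0" "emeasure \<nu> ({a<..b} \<times> I - {s} \<times> UNIV) = 0"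
proof -
  have [measurable]: "{x<..y} \<times> I \<in> sets \<mu>" "{x<..y} \<times> I \<in> sets \<nu>" for x y
    using sets by (auto intro!: borel_Times)
  define R where "R = {q \<in> \<rat>. a < q \<and> q \<le> b \<and> emeasure \<mu> ({a<..q} \<times> I) + emeasure \<nu> ({a<..q} \<times> I) \<noteq> 0}"
  define Z where "Z = null_sets \<mu> \<inter> null_sets \<nu>"
  have ZI: "A \<in> Z" if "A \<in> sets borel" "emeasure \<mu> A + emeasure \<nu> A = 0" for A
    using that sets by (auto simp: Z_def null_sets_def)
  have ZU: "(\<Union>x\<in>X. A x) \<in> Z" if "countable X" "\<And>x. x \<in> X \<Longrightarrow> A x \<in> Z" for X :: "real set" and A
    using that unfolding Z_def by (auto intro!: null_sets_UN')
  have low: "{a<..<s} \<times> I \<in> Z" if "\<And>q. q \<in> \<rat> \<Longrightarrow> a < q \<Longrightarrow> q < s \<Longrightarrow> q \<notin> R" "s \<le> b" for s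
  proof -
    have "{a<..<s} \<times> I = (\<Union>q\<in>\<rat> \<inter> {a<..<s}. {a<..q} \<times> I)"
    proof (intro equalityI subsetI)
      fix p assume p: "p \<in> {a<..<s} \<times> I"
      then obtain q where "q \<in> \<rat>" "fst p < q" "q < s" using Rats_dense_in_real[of "fst p" s] by auto
      then show "p \<in> (\<Union>q\<in>\<rat> \<inter> {a<..<s}. {a<..q} \<times> I)" using p by (auto intro!: bexI[of _ q])
    qed auto
    also have "\<dots> \<in> Z"
      using that by (intro ZU ZI) (auto simp: R_def sets intro!: countable_Int1 countable_rat borel_Times)
    finally show ?thesis .
  qed
  have Zsub: "emeasure \<mu> B = 0 \<and> emeasure \<nu> B = 0" if "A \<in> Z" "B \<subseteq> A" for A B
    using that unfolding Z_def by (auto intro: emeasure_eq_0)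
  show thesis
  proof (cases "b \<in> R")
    case False
    then have "{a<..b} \<times> I \<in> Z" using ab sets by (intro ZI) (auto simp: R_def borel_Times)
    then have "emeasure \<mu> ({a<..b} \<times> I - {b} \<times> UNIV) = 0" "emeasure \<nu> ({a<..b} \<times> I - {b} \<times> UNIV) = 0"
      using Zsub by (metis Diff_subset)+
    then show thesis using ab by (intro that[of b]) auto
  next
    case True
    have bdd: "bdd_below R" by (intro bdd_belowI[of _ a]) (auto simp: R_def)
    have high: "{r<..b} \<times> I \<in> Z" if "r \<in> R" for r
    proof (rule ZI)
      show "{r<..b} \<times> I \<in> sets borel" using sets by (intro borel_Times) auto
      have r: "a < r" "r \<le> b" "r \<in> \<rat>" using that by (auto simp: R_def)
      have split: "{a<..b} \<times> I = ({a<..r} \<times> I) \<union> ({r<..b} \<times> I)" using r by auto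
      have "emeasure \<mu> ({a<..b} \<times> I) = emeasure \<mu> ({a<..r} \<times> I) + emeasure \<mu> ({r<..b} \<times> I)"
        "emeasure \<nu> ({a<..b} \<times> I) = emeasure \<nu> ({a<..r} \<times> I) + emeasure \<nu> ({r<..b} \<times> I)"
        unfolding split by (auto intro!: plus_emeasure[symmetric])
      moreover obtain i j where ij: "emeasure \<mu> ({a<..r} \<times> I) = of_nat i" "emeasure \<nu> ({a<..r} \<times> I) = of_nat j"
        using int r by blast
      ultimately have le1: "of_nat (i + j) + (emeasure \<mu> ({r<..b} \<times> I) + emeasure \<nu> ({r<..b} \<times> I)) \<le> (1::ennreal)"
        using le by (simp add: ac_simps)
      have "i + j \<noteq> 0" using that ij by (auto simp: R_def)
      then have "(1::ennreal) \<le> of_nat (i + j)"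
        by (metis One_nat_def Suc_leI neq0_conv of_nat_1 of_nat_mono)
      then have "1 + (emeasure \<mu> ({r<..b} \<times> I) + emeasure \<nu> ({r<..b} \<times> I))
          \<le> of_nat (i + j) + (emeasure \<mu> ({r<..b} \<times> I) + emeasure \<nu> ({r<..b} \<times> I))"
        by (rule add_right_mono)
      also note le1
      finally have "1 + (emeasure \<mu> ({r<..b} \<times> I) + emeasure \<nu> ({r<..b} \<times> I)) \<le> (1::ennreal) + 0"
        by simp
      then show "emeasure \<mu> ({r<..b} \<times> I) + emeasure \<nu> ({r<..b} \<times> I) = 0"
        unfolding ennreal_add_left_cancel_le by simp
    qed
    define s where "s = Inf R"
    have s: "a \<le> s" "s \<le> b" unfolding s_def using True bdd
      by (auto intro!: cInf_greatest cInf_lower simp: R_def)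
    have L: "{a<..<s} \<times> I \<in> Z"
      using s cInf_lower[OF _ bdd] by (intro low) (force simp: s_def)+
    have "{s<..b} \<times> I \<subseteq> (\<Union>r\<in>R. {r<..b} \<times> I)"
    proof
      fix p assume p: "p \<in> {s<..b} \<times> I"
      then have "Inf R < fst p" by (auto simp: s_def)
      then obtain r where "r \<in> R" "r < fst p" using cInf_lessD[of R "fst p"] True by auto
      then show "p \<in> (\<Union>r\<in>R. {r<..b} \<times> I)" using p by auto
    qed
    moreover have "(\<Union>r\<in>R. {r<..b} \<times> I) \<in> Z"
      by (intro ZU high) (auto simp: R_def intro: countable_subset[OF _ countable_rat])
    moreover have H: "({a<..<s} \<times> I) \<union> (\<Union>r\<in>R. {r<..b} \<times> I) \<in> Z"
      using L calculation(2) unfolding Z_def by auto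
    ultimately have sub: "{a<..b} \<times> I - {s} \<times> UNIV \<subseteq> ({a<..<s} \<times> I) \<union> (\<Union>r\<in>R. {r<..b} \<times> I)"
      by force
    \<comment> \<open>The time has to lie in the half-open interval. If the infimum is a, the
      excluded line misses the strip, the whole strip is null, and b serves as well.\<close>
    show thesis
    proof (cases "s = a")
      case True
      have "{a<..b} \<times> I \<subseteq> ({a<..<s} \<times> I) \<union> (\<Union>r\<in>R. {r<..b} \<times> I)"
        using sub True by auto
      then have "{a<..b} \<times> I - {b} \<times> UNIV \<subseteq> ({a<..<s} \<times> I) \<union> (\<Union>r\<in>R. {r<..b} \<times> I)" by blast
      from Zsub[OF H this] show thesis using ab by (intro that[of b]) auto
    next
      case False
      then show thesis using Zsub[OF H sub] s by (intro that[of s]) auto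
    qed
  qed
qed

text \<open>One time is chosen in each cell of a grid so fine that a cell carries at most one point
  of both measures together. Off these finitely many lines there is no mass, and no line carries
  more than one point.\<close>

lemma finite_atoms_of_integer_valued:
  fixes \<mu> \<nu> :: "(real \<times> real) measure" and T m n :: nat
  defines "cell \<equiv> \<lambda>i. {real T * real i / real n<..real T * real (Suc i) / real n}"
  assumes sets: "sets \<mu> = sets borel" "sets \<nu> = sets borel" 
    and int: "\<And>p q. p \<in> \<rat> \<Longrightarrow> q \<in> \<rat> \<Longrightarrow> 0 \<le> p \<Longrightarrow> emeasure \<mu> ({p<..q} \<times> {0..real m}) \<in> range of_nat"
      "\<And>p q. p \<in> \<rat> \<Longrightarrow> q \<in> \<rat> \<Longrightarrow> 0 \<le> p \<Longrightarrow> emeasure \<nu> ({p<..q} \<times> {0..real m}) \<in> range of_nat"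
    and n: "n > 0"
    and le: "\<And>i. i < n \<Longrightarrow> emeasure \<mu> (cell i \<times> {0..real m}) + emeasure \<nu> (cell i \<times> {0..real m}) \<le> 1"
  obtains S where "finite S" "S \<subseteq> {0<..real T}"
    "emeasure \<mu> ({0<..real T} \<times> {0..real m} - S \<times> UNIV) = 0"
    "emeasure \<nu> ({0<..real T} \<times> {0..real m} - S \<times> UNIV) = 0"
    "\<And>s. s \<in> S \<Longrightarrow> emeasure \<mu> ({s} \<times> {0..real m}) + emeasure \<nu> ({s} \<times> {0..real m}) \<le> 1"
proof (cases "T = 0")
  case True
  then show ?thesis by (intro that[of "{}"]) auto
next
  case False
  have cellsub: "cell i \<subseteq> {0<..real T}" if "i < n" for i
  proof -
    have "real T * real (Suc i) / real n \<le> real T * real n / real n"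
      using that by (intro divide_right_mono mult_left_mono) auto
    moreover have "0 \<le> real T * real i / real n" by simp
    ultimately show ?thesis using n unfolding cell_def
      by (intro subsetI) (smt (verit) greaterThanAtMost_iff nonzero_mult_div_cancel_right of_nat_0_less_iff)
  qed
  have "\<exists>s. s \<in> cell i \<and> emeasure \<mu> (cell i \<times> {0..real m} - {s} \<times> UNIV) = 0
      \<and> emeasure \<nu> (cell i \<times> {0..real m} - {s} \<times> UNIV) = 0" if "i < n" for i
    unfolding cell_def
    by (rule single_atom_of_integer_valued[OF sets, of "{0..real m}" "real T * real i / real n" "real T * real (Suc i) / real n"])
      (use int le[OF that] False n in \<open>auto simp: cell_def divide_strict_right_mono\<close>)
  then obtain s where s: "\<And>i. i < n \<Longrightarrow> s i \<in> cell i"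
    "\<And>i. i < n \<Longrightarrow> emeasure \<mu> (cell i \<times> {0..real m} - {s i} \<times> UNIV) = 0"
    "\<And>i. i < n \<Longrightarrow> emeasure \<nu> (cell i \<times> {0..real m} - {s i} \<times> UNIV) = 0" by metis
  have cover: "{0<..real T} \<subseteq> (\<Union>i<n. cell i)"
  proof
    fix t assume t: "t \<in> {0<..real T}"
    \<comment> \<open>Cells are open on the left, so the cell of t is found with a ceiling minus
      one, not with a floor.\<close>
    define j where "j = nat (\<lceil>t * real n / real T\<rceil> - 1)"
    have pos: "0 < t * real n / real T" using t n by simp
    have "t * real n / real T \<le> real n" using t n False by (simp add: field_simps)
    then have jn: "j < n" using pos unfolding j_def by linarith
    have "real j < t * real n / real T" "t * real n / real T \<le> real (Suc j)"
      using pos unfolding j_def by linarith+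
    then have "t \<in> cell j" using n False t by (simp add: cell_def field_simps)
    then show "t \<in> (\<Union>i<n. cell i)" using jn by auto
  qed
  have meas: "cell i \<times> {0..real m} - {s i} \<times> UNIV \<in> sets borel" for i
    unfolding cell_def by (intro sets.Diff borel_Times) auto
  have sub: "{0<..real T} \<times> {0..real m} - s ` {..<n} \<times> UNIV \<subseteq> (\<Union>i<n. cell i \<times> {0..real m} - {s i} \<times> UNIV)"
    using cover by fastforce
  have slice: "emeasure \<mu> ({s i} \<times> {0..real m}) + emeasure \<nu> ({s i} \<times> {0..real m}) \<le> 1" if "i < n" for i
  proof -
    have "{s i} \<times> {0..real m} \<subseteq> cell i \<times> {0..real m}" using s(1)[OF that] by auto
    then have "emeasure \<mu> ({s i} \<times> {0..real m}) \<le> emeasure \<mu> (cell i \<times> {0..real m})"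
      "emeasure \<nu> ({s i} \<times> {0..real m}) \<le> emeasure \<nu> (cell i \<times> {0..real m})"
      using sets by (auto intro!: emeasure_mono borel_Times simp: cell_def)
    then show ?thesis using le[OF that] by (meson add_mono order_trans)
  qed
  show ?thesis
  proof (rule that[of "s ` {..<n}"])
    show "s ` {..<n} \<subseteq> {0<..real T}" using s(1) cellsub by blast
    show "emeasure \<mu> ({0<..real T} \<times> {0..real m} - s ` {..<n} \<times> UNIV) = 0"
      by (rule emeasure_eq_0[OF _ _ sub])
        (use s(2) meas sets in \<open>auto intro!: null_setsD1 null_sets_UN' simp: null_sets_def sets.countable_UN\<close>)
    show "emeasure \<nu> ({0<..real T} \<times> {0..real m} - s ` {..<n} \<times> UNIV) = 0"
      by (rule emeasure_eq_0[OF _ _ sub])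
        (use s(3) meas sets in \<open>auto intro!: null_setsD1 null_sets_UN' simp: null_sets_def sets.countable_UN\<close>)
  qed (use slice in auto)
qed

section \<open>Poisson counts: integrality and means\<close>

lemma (in prob_space) AE_nat_of_poisson:
  fixes X :: "'a \<Rightarrow> ennreal"
  assumes [measurable]: "X \<in> borel_measurable M"
    and X: "\<And>k. prob {\<omega>\<in>space M. X \<omega> = of_nat k} = exp (- l) * l ^ k / fact k"
  shows "AE \<omega> in M. X \<omega> \<in> range of_nat"
proof -
  let ?E = "\<lambda>k::nat. {\<omega>\<in>space M. X \<omega> = of_nat k}"
  have E: "?E k \<in> events" for k by measurable
  have "disjoint_family ?E" by (auto simp: disjoint_family_on_def)
  then have "(\<lambda>k. prob (?E k)) sums prob (\<Union>k. ?E k)" using E by (intro finite_measure_UNION) auto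
  moreover have "(\<lambda>k. exp (- l) * (l ^ k /\<^sub>R fact k)) sums (exp (- l) * exp l)"
    by (intro sums_mult exp_converges)
  ultimately have "prob (\<Union>k. ?E k) = 1" using X
    by (simp add: exp_minus field_simps sums_unique2)
  then have "AE \<omega> in M. \<omega> \<in> (\<Union>k. ?E k)" using E by (subst (asm) prob_eq_1) auto
  then show ?thesis by eventually_elim auto
qed

text \<open>The count is almost surely an integer, so its mean over A is the series of k times the
  probability of A together with count = k. Independence takes out the probability of A and leaves
  the mean of the Poisson law.\<close>

lemma (in prob_space) nn_integral_poisson_indep:
  fixes X :: "'a \<Rightarrow> ennreal"
  assumes [measurable]: "X \<in> borel_measurable M" "A \<in> events" and "l \<ge> 0"
    and X: "\<And>k. prob {\<omega>\<in>space M. X \<omega> = of_nat k} = exp (- l) * l ^ k / fact k"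
    and indep: "\<And>k::nat. prob (A \<inter> {\<omega>\<in>space M. X \<omega> = of_nat k}) = prob A * prob {\<omega>\<in>space M. X \<omega> = of_nat k}"
  shows "(\<integral>\<^sup>+\<omega>. indicator A \<omega> * X \<omega> \<partial>M) = emeasure M A * ennreal l"
proof -
  let ?E = "\<lambda>k::nat. {\<omega>\<in>space M. X \<omega> = of_nat k}"
  have E[measurable]: "?E k \<in> events" for k by measurable
  have "(\<integral>\<^sup>+\<omega>. indicator A \<omega> * X \<omega> \<partial>M) = (\<integral>\<^sup>+\<omega>. (\<Sum>k. of_nat k * indicator (A \<inter> ?E k) \<omega>) \<partial>M)"
  proof (rule nn_integral_cong_AE)
    show "AE \<omega> in M. indicator A \<omega> * X \<omega> = (\<Sum>k. of_nat k * indicator (A \<inter> ?E k) \<omega>)"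
      using AE_nat_of_poisson[OF assms(1) X] AE_space
    proof eventually_elim
      case (elim \<omega>)
      then obtain k where k: "X \<omega> = of_nat k" by auto
      have "(\<Sum>j. of_nat j * indicator (A \<inter> ?E j) \<omega>) = (\<Sum>j\<in>{k}. of_nat j * indicator (A \<inter> ?E j) \<omega> :: ennreal)"
        by (rule suminf_finite) (auto simp: k indicator_def)
      then show ?case using elim k by (auto simp: indicator_def)
    qed
  qed
  also have "\<dots> = (\<Sum>k. of_nat k * emeasure M (A \<inter> ?E k))"
    by (subst nn_integral_suminf) (auto simp: nn_integral_cmult)
  also have "\<dots> = (\<Sum>k. ennreal (prob A * (real k * (exp (- l) * l ^ k / fact k))))"
  proof (intro suminf_cong)
    fix k
    have p: "emeasure M (A \<inter> ?E k) = ennreal (prob A * (exp (- l) * l ^ k / fact k))"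
      using X[of k] indep[of k] by (simp only: emeasure_eq_measure)
    show "of_nat k * emeasure M (A \<inter> ?E k) = ennreal (prob A * (real k * (exp (- l) * l ^ k / fact k)))"
      unfolding p using \<open>l \<ge> 0\<close>
      by (simp add: ennreal_of_nat_eq_real_of_nat ennreal_mult[symmetric] ac_simps)
  qed
  also have "\<dots> = ennreal (prob A * l)"
  proof (rule suminf_ennreal_eq)
    show "0 \<le> prob A * (real k * (exp (- l) * l ^ k / fact k))" for k using \<open>l \<ge> 0\<close> by simp
    \<comment> \<open>Mean of the Poisson law: the factor k cancels against the factorial, which
      shifts the exponential series by one; the term at 0 vanishes.\<close>
    have "(\<lambda>k. exp (- l) * l * (l ^ k /\<^sub>R fact k)) sums (exp (- l) * l * exp l)"
      by (intro sums_mult exp_converges)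
    moreover have "exp (- l) * l * (l ^ k /\<^sub>R fact k) = real (Suc k) * (exp (- l) * l ^ Suc k / fact (Suc k))" for k
    proof -
      have "real (Suc k) * (x / fact (Suc k)) = x / fact k" for x :: real
        by (simp add: fact_Suc del: of_nat_Suc)
      from this[of "exp (- l) * l ^ Suc k"] show ?thesis
        by (auto simp: divide_inverse mult_ac simp del: of_nat_Suc fact_Suc)
    qed
    moreover have "exp (- l) * l * exp l = l" by (simp add: exp_minus field_simps)
    ultimately have "(\<lambda>k. real (Suc k) * (exp (- l) * l ^ Suc k / fact (Suc k))) sums l" by simp
    then have "(\<lambda>k. real k * (exp (- l) * l ^ k / fact k)) sums l" by (subst (asm) sums_Suc_iff) simp
    then show "(\<lambda>k. prob A * (real k * (exp (- l) * l ^ k / fact k))) sums (prob A * l)" by (rule sums_mult)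
  qed
  also have "\<dots> = emeasure M A * ennreal l" using \<open>l \<ge> 0\<close> by (simp add: emeasure_eq_measure ennreal_mult)
  finally show ?thesis .
qed

section \<open>Predictable integrands and the compensation formula\<close>

text \<open>Time 0 is left out, as the equation counts only points with positive time, while the
  mark 0 is kept. The boxes have finite mass under Lebesgue measure and under the noise, which the
  complement steps of the inductions rely on.\<close>

definition jump_box :: "nat \<Rightarrow> (real \<times> real) set" where
  "jump_box n = {0<..real n} \<times> {0..real n}"

definition jump_region :: "(real \<times> real) set" where
  "jump_region = {0<..} \<times> {0..}"

lemma jump_box_borel[measurable]: "jump_box n \<in> sets borel"
  unfolding jump_box_def by (intro borel_Times) auto

lemma jump_region_borel[measurable]: "jump_region \<in> sets borel"
  unfolding jump_region_def by (intro borel_Times) auto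

lemma jump_box_mono: "m \<le> n \<Longrightarrow> jump_box m \<subseteq> jump_box n"
  by (auto simp: jump_box_def)

lemma jump_region_eq_UN: "jump_region = (\<Union>n. jump_box n)"
proof (intro equalityI subsetI)
  fix p assume p: "p \<in> jump_region"
  obtain i where i: "max (fst p) (snd p) \<le> real i" using real_arch_simple by blast
  then have "p \<in> jump_box i"
    using p by (cases p) (auto simp: jump_region_def jump_box_def)
  then show "p \<in> (\<Union>n. jump_box n)" by blast
qed (auto simp: jump_region_def jump_box_def)

lemma emeasure_lborel_jump_box: "emeasure lborel (jump_box n) < \<infinity>"
proof -
  have "emeasure lborel (jump_box n) = emeasure lborel {0<..real n} * emeasure lborel {0..real n}"
    unfolding jump_box_def lborel_prod[symmetric]
    by (subst lborel.emeasure_pair_measure_Times) auto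
  then show ?thesis by (simp add: ennreal_mult_less_top)
qed

text \<open>Two point processes indexed by the sign \<open>c\<close>, regularised so that the pathwise
  properties hold for every sample point; the exceptional null set is removed when the locale is
  interpreted.\<close>

locale jump_noise = prob_space M
  for M :: "'a measure" +
  fixes F :: "real \<Rightarrow> 'a measure" and N :: "real \<Rightarrow> 'a \<Rightarrow> (real \<times> real) measure"
  assumes subalg: "\<And>t. 0 \<le> t \<Longrightarrow> subalgebra M (F t)"
    and F_mono: "\<And>s t. 0 \<le> s \<Longrightarrow> s \<le> t \<Longrightarrow> sets (F s) \<subseteq> sets (F t)"
    and sets_N[simp, measurable_cong]: "\<And>c \<omega>. sets (N c \<omega>) = sets borel"
    and N_null: "\<And>c \<omega>. emeasure (N c \<omega>) (- jump_region) = 0"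
    and N_meas: "\<And>c A. A \<in> sets borel \<Longrightarrow> (\<lambda>\<omega>. emeasure (N c \<omega>) A) \<in> borel_measurable M"
    and N_fin: "\<And>c \<omega> n. \<omega> \<in> space M \<Longrightarrow> emeasure (N c \<omega>) (jump_box n) < \<infinity>"
    and N_comp: "\<And>c s A B n. 0 \<le> s \<Longrightarrow> A \<in> sets (F s) \<Longrightarrow> B \<in> sets borel \<Longrightarrow> B \<subseteq> {s<..} \<times> UNIV \<inter> jump_box n \<Longrightarrow>
      (\<integral>\<^sup>+\<omega>. indicator A \<omega> * emeasure (N c \<omega>) B \<partial>M) = emeasure M A * emeasure lborel B"
    and N_atoms: "\<And>\<omega> n. \<omega> \<in> space M \<Longrightarrow> \<exists>S. finite S \<and> S \<subseteq> {0<..real n} \<and>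
      emeasure (N 1 \<omega>) (jump_box n - S \<times> UNIV) = 0 \<and> emeasure (N (-1) \<omega>) (jump_box n - S \<times> UNIV) = 0 \<and>
      (\<forall>s\<in>S. emeasure (N 1 \<omega>) ({s} \<times> {0..real n}) + emeasure (N (-1) \<omega>) ({s} \<times> {0..real n}) \<le> 1)"
begin

lemma space_F: "0 \<le> t \<Longrightarrow> space (F t) = space M"
  using subalg by (simp add: subalgebra_def)

lemma space_in_F: "0 \<le> t \<Longrightarrow> space M \<in> sets (F t)"
  using sets.top[of "F t"] by (simp add: space_F)

lemma sets_F: "0 \<le> t \<Longrightarrow> A \<in> sets (F t) \<Longrightarrow> A \<in> sets M"
  using subalg by (auto simp: subalgebra_def)

lemma measurable_F: "0 \<le> t \<Longrightarrow> f \<in> measurable (F t) X \<Longrightarrow> f \<in> measurable M X"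
  by (rule measurable_from_subalg[OF subalg])

lemma measurable_F_mono: "0 \<le> s \<Longrightarrow> s \<le> t \<Longrightarrow> f \<in> measurable (F s) X \<Longrightarrow> f \<in> measurable (F t) X"
  using F_mono[of s t] by (simp add: measurable_def space_F subset_iff)

lemma space_N[simp]: "space (N c \<omega>) = UNIV"
  using sets_eq_imp_space_eq[OF sets_N] by simp

lemma AE_N_jump_region: "AE p in N c \<omega>. p \<in> jump_region"
  using AE_not_in[of "- jump_region" "N c \<omega>"] N_null[of c \<omega>]
  by (auto simp: null_sets_def elim!: eventually_mono)

lemma emeasure_N_eq_SUP:
  assumes "A \<in> sets borel"
  shows "emeasure (N c \<omega>) A = (SUP n. emeasure (N c \<omega>) (A \<inter> jump_box n))"
proof -
  have "emeasure (N c \<omega>) A = emeasure (N c \<omega>) (A \<inter> jump_region)"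
    using assms AE_N_jump_region[of c \<omega>] by (intro emeasure_eq_AE) (auto elim!: eventually_mono)
  also have "A \<inter> jump_region = (\<Union>n. A \<inter> jump_box n)" by (auto simp: jump_region_eq_UN)
  also have "emeasure (N c \<omega>) \<dots> = (SUP n. emeasure (N c \<omega>) (A \<inter> jump_box n))"
    using assms jump_box_mono
    by (intro SUP_emeasure_incseq[symmetric]) (fastforce simp: incseq_def)+
  finally show ?thesis .
qed

text \<open>Events known at time s paired with points strictly later than s. The strict inequality
  makes left limits predictable and puts the points into the future, where \<open>N_comp\<close>
  applies.\<close>

definition pred_gen :: "('a \<times> real \<times> real) set set" where
  "pred_gen = {A \<times> B | A B s. A \<in> sets (F (max 0 s)) \<and> B \<in> sets borel \<and> B \<subseteq> {s<..} \<times> UNIV}"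

text \<open>For \<open>s < 0\<close> the generators use the information at time \<open>0\<close>, so that nonpositive times need no
  special treatment.\<close>

definition predictable :: "('a \<times> real \<times> real) measure" where
  "predictable = sigma (space M \<times> UNIV) pred_gen"

lemma pred_gen_Pow: "pred_gen \<subseteq> Pow (space M \<times> UNIV)"
proof
  fix X assume "X \<in> pred_gen"
  then obtain A B s where "X = A \<times> B" "A \<in> sets (F (max 0 s))" unfolding pred_gen_def by blast
  then show "X \<in> Pow (space M \<times> UNIV)"
    using sets.sets_into_space[of A "F (max 0 s)"] space_F[of "max 0 s"] by auto
qed

lemma space_predictable[simp]: "space predictable = space M \<times> UNIV"
  unfolding predictable_def using pred_gen_Pow by (rule space_measure_of)

lemma sets_predictable: "sets predictable = sigma_sets (space M \<times> UNIV) pred_gen"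
  unfolding predictable_def using pred_gen_Pow by (rule sets_measure_of)

lemma pred_genI: "A \<in> sets (F (max 0 s)) \<Longrightarrow> B \<in> sets borel \<Longrightarrow> B \<subseteq> {s<..} \<times> UNIV \<Longrightarrow> A \<times> B \<in> pred_gen"
  unfolding pred_gen_def by blast

lemma pred_gen_predictable: "A \<in> sets (F (max 0 s)) \<Longrightarrow> B \<in> sets borel \<Longrightarrow> B \<subseteq> {s<..} \<times> UNIV \<Longrightarrow> A \<times> B \<in> sets predictable"
  unfolding sets_predictable by (rule sigma_sets.Basic, rule pred_genI)

lemma Int_stable_pred_gen: "Int_stable pred_gen"
proof (rule Int_stableI)
  fix X Y assume "X \<in> pred_gen" "Y \<in> pred_gen"
  then obtain A B s A' B' s' where *: "X = A \<times> B" "A \<in> sets (F (max 0 s))" "B \<in> sets borel" "B \<subseteq> {s<..} \<times> UNIV"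
    "Y = A' \<times> B'" "A' \<in> sets (F (max 0 s'))" "B' \<in> sets borel" "B' \<subseteq> {s'<..} \<times> UNIV"
    unfolding pred_gen_def by blast
  have "A \<inter> A' \<in> sets (F (max 0 (max s s')))"
    using * F_mono[of "max 0 s" "max 0 (max s s')"] F_mono[of "max 0 s'" "max 0 (max s s')"]
    by (intro sets.Int) (auto simp: max.coboundedI1 max.coboundedI2)
  moreover have "B \<inter> B' \<subseteq> {max s s'<..} \<times> UNIV" using * by fastforce
  ultimately have "(A \<inter> A') \<times> (B \<inter> B') \<in> pred_gen" using * by (intro pred_genI) auto
  then show "X \<inter> Y \<in> pred_gen" using * by (simp add: Times_Int_Times)
qed

lemma sets_predictable_le: "sets predictable \<subseteq> sets (M \<Otimes>\<^sub>M borel)"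
  unfolding sets_predictable
proof (rule sets.sigma_sets_subset')
  show "pred_gen \<subseteq> sets (M \<Otimes>\<^sub>M borel)"
    unfolding pred_gen_def by (auto intro!: pair_measureI sets_F[OF max.cobounded1])
  show "space M \<times> UNIV \<in> sets (M \<Otimes>\<^sub>M (borel::(real\<times>real) measure))"
    using sets.top[of "M \<Otimes>\<^sub>M (borel::(real\<times>real) measure)"] by (simp add: space_pair_measure)
qed

lemma predictable_measurable_pair:
  "f \<in> measurable predictable X \<Longrightarrow> f \<in> measurable (M \<Otimes>\<^sub>M borel) X"
  using sets_predictable_le by (simp add: measurable_def space_pair_measure subset_iff)

lemma predictable_section:
  assumes "f \<in> measurable predictable X" "\<omega> \<in> space M"
  shows "(\<lambda>p. f (\<omega>, p)) \<in> measurable borel X"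
  by (rule measurable_Pair2[OF predictable_measurable_pair[OF assms(1)] assms(2)])

lemma predictable_set_section:
  assumes "A \<in> sets predictable"
  shows "Pair \<omega> -` A \<in> sets borel"
proof -
  have "A \<in> sets (M \<Otimes>\<^sub>M borel)" using sets_predictable_le assms by blast
  then show ?thesis by (rule sets_Pair1)
qed

lemma predictable_snd[measurable]: "(\<lambda>x. snd x) \<in> measurable predictable borel"
proof (rule measurableI)
  fix B :: "(real \<times> real) set" assume B: "B \<in> sets borel"
  \<comment> \<open>Generators need a lower bound for their times, so \<open>B\<close> is exhausted
    by its parts later than -n.\<close>
  have "space M \<times> (B \<inter> {- real n<..} \<times> UNIV) \<in> sets predictable" for n
  proof (rule pred_gen_predictable[of _ "- real n"])
    show "space M \<in> sets (F (max 0 (- real n)))" by (rule space_in_F) simp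
    have "{- real n<..} \<times> (UNIV :: real set) \<in> sets borel" by (intro borel_Times) auto
    then show "B \<inter> {- real n<..} \<times> UNIV \<in> sets borel" using B by blast
  qed blast
  moreover have "snd -` B \<inter> space predictable = (\<Union>n. space M \<times> (B \<inter> {- real n<..} \<times> UNIV))"
  proof (intro equalityI subsetI)
    fix x assume x: "x \<in> snd -` B \<inter> space predictable"
    obtain n where "- fst (snd x) < real n" using reals_Archimedean2 by blast
    then show "x \<in> (\<Union>n. space M \<times> (B \<inter> {- real n<..} \<times> UNIV))" using x
      by (cases x) (auto intro!: exI[of _ n])
  qed auto
  ultimately show "snd -` B \<inter> space predictable \<in> sets predictable" by auto
qed simp

lemma predictable_time[measurable]: "(\<lambda>x. fst (snd x)) \<in> borel_measurable predictable"
  by (rule measurable_compose[OF predictable_snd]) (simp add: borel_prod[symmetric])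

lemma predictable_mark[measurable]: "(\<lambda>x. snd (snd x)) \<in> borel_measurable predictable"
  by (rule measurable_compose[OF predictable_snd]) (simp add: borel_prod[symmetric])

text \<open>Induction over the intersection-stable generators. Inside a box all masses are finite,
  so complements can be subtracted. Measurability of the N-mass of a section is carried through the
  same induction, as it is not known beforehand.\<close>

lemma compensator_box:
  assumes "X \<in> sets predictable"
  shows "(\<lambda>\<omega>. emeasure (N c \<omega>) (Pair \<omega> -` X \<inter> jump_box n)) \<in> borel_measurable M \<and>
    (\<integral>\<^sup>+\<omega>. emeasure (N c \<omega>) (Pair \<omega> -` X \<inter> jump_box n) \<partial>M) =
    (\<integral>\<^sup>+\<omega>. emeasure lborel (Pair \<omega> -` X \<inter> jump_box n) \<partial>M)"
proof -
  let ?N = "\<lambda>X \<omega>. emeasure (N c \<omega>) (Pair \<omega> -` X \<inter> jump_box n)"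
  let ?l = "\<lambda>X \<omega>. emeasure lborel (Pair \<omega> -` X \<inter> jump_box n)"
  have l: "?l X \<in> borel_measurable M" if "X \<in> sets predictable" for X
  proof -
    have "X \<inter> space M \<times> jump_box n \<in> sets (M \<Otimes>\<^sub>M lborel)"
      using that sets_predictable_le by (auto intro!: sets.Int pair_measureI)
    then have "(\<lambda>\<omega>. emeasure lborel (Pair \<omega> -` (X \<inter> space M \<times> jump_box n))) \<in> borel_measurable M"
      by (rule lborel.measurable_emeasure_Pair)
    then show ?thesis
      by (rule measurable_cong[THEN iffD1, rotated]) (auto intro!: arg_cong[where f="emeasure lborel"])
  qed
  have sec: "Pair \<omega> -` X \<inter> jump_box n \<in> sets borel" if "X \<in> sets predictable" for X \<omega>
    using predictable_set_section[OF that] by auto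
  have N_less: "emeasure (N c \<omega>) (Y \<inter> jump_box n) < \<infinity>" if "\<omega> \<in> space M" "Y \<in> sets borel" for Y \<omega>
    using that by (intro le_less_trans[OF emeasure_mono N_fin]) auto
  have l_less: "emeasure lborel (Y \<inter> jump_box n) < \<infinity>" if "Y \<in> sets borel" for Y
    using that by (intro le_less_trans[OF emeasure_mono emeasure_lborel_jump_box[of n]]) auto
  \<comment> \<open>The complement case needs the equality for the full space, which is
    \<open>N_comp\<close> at time 0 with the sure event.\<close>
  have total: "(\<integral>\<^sup>+\<omega>. emeasure (N c \<omega>) (jump_box n) \<partial>M) = emeasure lborel (jump_box n)"
  proof -
    have "(\<integral>\<^sup>+\<omega>. emeasure (N c \<omega>) (jump_box n) \<partial>M) = (\<integral>\<^sup>+\<omega>. indicator (space M) \<omega> * emeasure (N c \<omega>) (jump_box n) \<partial>M)"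
      by (intro nn_integral_cong) auto
    also have "\<dots> = emeasure M (space M) * emeasure lborel (jump_box n)"
      by (intro N_comp[of 0 _ _ n] space_in_F jump_box_borel) (auto simp: jump_box_def)
    finally show ?thesis by (simp add: emeasure_space_1)
  qed
  from Int_stable_pred_gen pred_gen_Pow assms[unfolded sets_predictable]
  show ?thesis
  proof (induction rule: sigma_sets_induct_disjoint)
    case (basic X)
    then obtain A B s where X: "X = A \<times> B" "A \<in> sets (F (max 0 s))" "B \<in> sets borel" "B \<subseteq> {s<..} \<times> UNIV"
      unfolding pred_gen_def by blast
    have A[measurable]: "A \<in> sets M" using X sets_F[of "max 0 s" A] by auto
    have [measurable]: "(\<lambda>\<omega>. emeasure (N c \<omega>) (B \<inter> jump_box n)) \<in> borel_measurable M"
      using X by (intro N_meas) auto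
    have eq: "emeasure \<mu> (Pair \<omega> -` X \<inter> jump_box n) = indicator A \<omega> * emeasure \<mu> (B \<inter> jump_box n)" for \<omega> and \<mu> :: "(real\<times>real) measure"
      by (auto simp: X indicator_def)
    have "(\<integral>\<^sup>+\<omega>. indicator A \<omega> * emeasure (N c \<omega>) (B \<inter> jump_box n) \<partial>M) = emeasure M A * emeasure lborel (B \<inter> jump_box n)"
    proof (rule N_comp)
      show "B \<inter> jump_box n \<in> sets borel" using X by auto
      show "B \<inter> jump_box n \<subseteq> {max 0 s<..} \<times> UNIV \<inter> jump_box n" using X by (auto simp: jump_box_def)
    qed (use X in auto)
    moreover have "(\<integral>\<^sup>+\<omega>. indicator A \<omega> * emeasure lborel (B \<inter> jump_box n) \<partial>M) = emeasure M A * emeasure lborel (B \<inter> jump_box n)"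
      using A by (simp add: nn_integral_multc)
    moreover have "(\<lambda>\<omega>. indicator A \<omega> * emeasure (N c \<omega>) (B \<inter> jump_box n)) \<in> borel_measurable M" by measurable
    ultimately show ?case unfolding eq by simp
  next
    case empty
    then show ?case by simp
  next
    case (compl X)
    then have X: "X \<in> sets predictable" by (simp add: sets_predictable)
    have eq: "emeasure \<mu> (Pair \<omega> -` (space M \<times> UNIV - X) \<inter> jump_box n) =
      emeasure \<mu> (jump_box n) - emeasure \<mu> (Pair \<omega> -` X \<inter> jump_box n)"
      if "\<omega> \<in> space M" "sets \<mu> = sets borel" "emeasure \<mu> (Pair \<omega> -` X \<inter> jump_box n) < \<infinity>"
      for \<omega> and \<mu> :: "(real\<times>real) measure"
    proof -
      have "Pair \<omega> -` (space M \<times> UNIV - X) \<inter> jump_box n = jump_box n - (Pair \<omega> -` X \<inter> jump_box n)" using that by auto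
      then show ?thesis using that sec[OF X] by (simp add: emeasure_Diff)
    qed
    have [measurable]: "?N X \<in> borel_measurable M" using compl by auto
    have [measurable]: "(\<lambda>\<omega>. emeasure (N c \<omega>) (jump_box n)) \<in> borel_measurable M" by (intro N_meas) auto
    have Nle: "?N X \<omega> \<le> emeasure (N c \<omega>) (jump_box n)" for \<omega> by (intro emeasure_mono) auto
    have lle: "?l X \<omega> \<le> emeasure lborel (jump_box n)" for \<omega> by (intro emeasure_mono) auto
    have [measurable]: "?l X \<in> borel_measurable M" by (rule l[OF X])
    have fin: "(\<integral>\<^sup>+\<omega>. ?l X \<omega> \<partial>M) \<noteq> \<infinity>"
    proof -
      have "(\<integral>\<^sup>+\<omega>. ?l X \<omega> \<partial>M) \<le> (\<integral>\<^sup>+\<omega>. emeasure lborel (jump_box n) \<partial>M)" by (intro nn_integral_mono lle)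
      then show ?thesis using emeasure_lborel_jump_box[of n] by (auto simp: emeasure_space_1 top_unique)
    qed
    have 1: "(\<integral>\<^sup>+\<omega>. ?N (space M \<times> UNIV - X) \<omega> \<partial>M) = (\<integral>\<^sup>+\<omega>. emeasure (N c \<omega>) (jump_box n) - ?N X \<omega> \<partial>M)"
      using predictable_set_section[OF X] by (intro nn_integral_cong eq N_less) auto
    have 2: "(\<integral>\<^sup>+\<omega>. ?l (space M \<times> UNIV - X) \<omega> \<partial>M) = (\<integral>\<^sup>+\<omega>. emeasure lborel (jump_box n) - ?l X \<omega> \<partial>M)"
      using predictable_set_section[OF X] by (intro nn_integral_cong eq l_less) auto
    have "(\<integral>\<^sup>+\<omega>. ?N (space M \<times> UNIV - X) \<omega> \<partial>M) = (\<integral>\<^sup>+\<omega>. ?l (space M \<times> UNIV - X) \<omega> \<partial>M)"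
      unfolding 1 2 using compl fin Nle lle total
      by (subst (1 2) nn_integral_diff) (auto simp: emeasure_space_1)
    moreover have "?N (space M \<times> UNIV - X) \<in> borel_measurable M"
    proof (rule measurable_cong[THEN iffD2])
      show "?N (space M \<times> UNIV - X) \<omega> = emeasure (N c \<omega>) (jump_box n) - ?N X \<omega>" if "\<omega> \<in> space M" for \<omega>
        using predictable_set_section[OF X] that by (intro eq N_less) auto
    qed measurable
    ultimately show ?case by simp
  next
    case (union X)
    then have X: "X i \<in> sets predictable" for i by (auto simp: sets_predictable)
    have eq: "emeasure \<mu> (Pair \<omega> -` (\<Union>i. X i) \<inter> jump_box n) = (\<Sum>i. emeasure \<mu> (Pair \<omega> -` X i \<inter> jump_box n))"
      if "sets \<mu> = sets borel" for \<omega> and \<mu> :: "(real\<times>real) measure"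
    proof -
      have "(\<Sum>i. emeasure \<mu> (Pair \<omega> -` X i \<inter> jump_box n)) = emeasure \<mu> (\<Union>i. Pair \<omega> -` X i \<inter> jump_box n)"
      proof (rule suminf_emeasure)
        show "disjoint_family (\<lambda>i. Pair \<omega> -` X i \<inter> jump_box n)"
          using union(1) unfolding disjoint_family_on_def by blast
      qed (use sec[OF X] that in auto)
      also have "(\<Union>i. Pair \<omega> -` X i \<inter> jump_box n) = Pair \<omega> -` (\<Union>i. X i) \<inter> jump_box n" by auto
      finally show ?thesis by simp
    qed
    have [measurable]: "?N (X i) \<in> borel_measurable M" for i using union(3) by blast
    show ?case
      using union(3) l[OF X] by (simp add: eq nn_integral_suminf)
  qed
qed

text \<open>Monotone limit over the boxes. The region appears on the Lebesgue side only, because N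
  gives no mass to its complement.\<close>

lemma compensator_set:
  assumes "X \<in> sets predictable"
  shows "(\<lambda>\<omega>. emeasure (N c \<omega>) (Pair \<omega> -` X)) \<in> borel_measurable M"
    and "(\<integral>\<^sup>+\<omega>. emeasure (N c \<omega>) (Pair \<omega> -` X) \<partial>M) =
    (\<integral>\<^sup>+\<omega>. emeasure lborel (Pair \<omega> -` X \<inter> jump_region) \<partial>M)"
proof -
  have sec: "Pair \<omega> -` X \<in> sets borel" for \<omega> by (rule predictable_set_section[OF assms])
  have N: "emeasure (N c \<omega>) (Pair \<omega> -` X) = (SUP n. emeasure (N c \<omega>) (Pair \<omega> -` X \<inter> jump_box n))" for \<omega>
    using sec by (rule emeasure_N_eq_SUP)
  have l: "emeasure lborel (Pair \<omega> -` X \<inter> jump_region) = (SUP n. emeasure lborel (Pair \<omega> -` X \<inter> jump_box n))" for \<omega>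
  proof -
    have "(SUP n. emeasure lborel (Pair \<omega> -` X \<inter> jump_box n)) = emeasure lborel (\<Union>n. Pair \<omega> -` X \<inter> jump_box n)"
      using sec jump_box_mono by (intro SUP_emeasure_incseq) (fastforce simp: incseq_def)+
    also have "(\<Union>n. Pair \<omega> -` X \<inter> jump_box n) = Pair \<omega> -` X \<inter> jump_region" by (auto simp: jump_region_eq_UN)
    finally show ?thesis by simp
  qed
  have lm: "(\<lambda>\<omega>. emeasure lborel (Pair \<omega> -` X \<inter> jump_box n)) \<in> borel_measurable M" for n
  proof -
    have "X \<inter> space M \<times> jump_box n \<in> sets (M \<Otimes>\<^sub>M lborel)"
      using assms sets_predictable_le by (auto intro!: sets.Int pair_measureI)
    then have "(\<lambda>\<omega>. emeasure lborel (Pair \<omega> -` (X \<inter> space M \<times> jump_box n))) \<in> borel_measurable M"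
      by (rule lborel.measurable_emeasure_Pair)
    then show ?thesis
      by (rule measurable_cong[THEN iffD1, rotated]) (auto intro!: arg_cong[where f="emeasure lborel"])
  qed
  have incN: "incseq (\<lambda>n \<omega>. emeasure (N c \<omega>) (Pair \<omega> -` X \<inter> jump_box n))"
    using sec jump_box_mono by (auto simp: incseq_def le_fun_def intro!: emeasure_mono)
  have incl: "incseq (\<lambda>n \<omega>. emeasure lborel (Pair \<omega> -` X \<inter> jump_box n))"
    using sec jump_box_mono by (auto simp: incseq_def le_fun_def intro!: emeasure_mono)
  show "(\<lambda>\<omega>. emeasure (N c \<omega>) (Pair \<omega> -` X)) \<in> borel_measurable M"
    unfolding N using compensator_box[OF assms] by (intro borel_measurable_SUP) auto
  show "(\<integral>\<^sup>+\<omega>. emeasure (N c \<omega>) (Pair \<omega> -` X) \<partial>M) =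
    (\<integral>\<^sup>+\<omega>. emeasure lborel (Pair \<omega> -` X \<inter> jump_region) \<partial>M)"
    unfolding N l using compensator_box[OF assms] lm incN incl
    by (simp add: nn_integral_monotone_convergence_SUP)
qed

lemma borel_measurable_nn_integral_lborel:
  assumes "H \<in> borel_measurable predictable"
  shows "(\<lambda>\<omega>. \<integral>\<^sup>+p. H (\<omega>, p) * indicator jump_region p \<partial>lborel) \<in> borel_measurable M"
proof -
  have [measurable]: "H \<in> borel_measurable (M \<Otimes>\<^sub>M lborel)"
    using predictable_measurable_pair[OF assms]
    by (subst measurable_cong_sets[OF sets_pair_measure_cong[OF refl sets_lborel] refl])
  show ?thesis by measurable
qed

text \<open>The compensation formula: in the mean, the point process may be replaced by Lebesgue
  measure on the region as long as the integrand is predictable. Measurability and equality share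
  one induction, since additivity and monotone limits of the outer integral need the inner integral
  to be measurable.\<close>

lemma
  assumes "H \<in> borel_measurable predictable"
  shows borel_measurable_nn_integral_N: "(\<lambda>\<omega>. \<integral>\<^sup>+p. H (\<omega>, p) \<partial>N c \<omega>) \<in> borel_measurable M"
    and compensator: "(\<integral>\<^sup>+\<omega>. \<integral>\<^sup>+p. H (\<omega>, p) \<partial>N c \<omega> \<partial>M) =
      (\<integral>\<^sup>+\<omega>. \<integral>\<^sup>+p. H (\<omega>, p) * indicator jump_region p \<partial>lborel \<partial>M)"
proof -
  have "(\<lambda>\<omega>. \<integral>\<^sup>+p. H (\<omega>, p) \<partial>N c \<omega>) \<in> borel_measurable M \<and>
    (\<integral>\<^sup>+\<omega>. \<integral>\<^sup>+p. H (\<omega>, p) \<partial>N c \<omega> \<partial>M) = (\<integral>\<^sup>+\<omega>. \<integral>\<^sup>+p. H (\<omega>, p) * indicator jump_region p \<partial>lborel \<partial>M)"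
    using assms
  proof (induction rule: borel_measurable_induct)
    case (cong f g)
    have *: "(\<integral>\<^sup>+p. f (\<omega>, p) \<partial>N c \<omega>) = (\<integral>\<^sup>+p. g (\<omega>, p) \<partial>N c \<omega>)"
      "(\<integral>\<^sup>+p. f (\<omega>, p) * indicator jump_region p \<partial>lborel) = (\<integral>\<^sup>+p. g (\<omega>, p) * indicator jump_region p \<partial>lborel)"
      if "\<omega> \<in> space M" for \<omega>
      using cong(3) that by (auto intro!: nn_integral_cong)
    then show ?case using cong(4)
      by (simp cong: nn_integral_cong measurable_cong)
  next
    case (set A)
    have ind: "indicator A (\<omega>, p) = indicator (Pair \<omega> -` A) p" for \<omega> p by (simp add: indicator_def)
    have s: "Pair \<omega> -` A \<in> sets borel" for \<omega> by (rule predictable_set_section[OF set])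
    have 1: "(\<integral>\<^sup>+p. indicator A (\<omega>, p) \<partial>N c \<omega>) = emeasure (N c \<omega>) (Pair \<omega> -` A)" for \<omega>
      unfolding ind using s by simp
    have 2: "(\<integral>\<^sup>+p. indicator A (\<omega>, p) * indicator jump_region p \<partial>lborel) = emeasure lborel (Pair \<omega> -` A \<inter> jump_region)" for \<omega>
      unfolding ind using s by (simp flip: indicator_inter_arith)
    show ?case unfolding 1 2 using compensator_set[OF set] by simp
  next
    case (mult u a)
    have m: "(\<lambda>p. u (\<omega>, p)) \<in> borel_measurable borel" if "\<omega> \<in> space M" for \<omega> 
      using predictable_section[OF mult(2) that] .
    note mm = borel_measurable_nn_integral_lborel[OF mult(2)]
    have "(\<integral>\<^sup>+p. a * u (\<omega>, p) \<partial>N c \<omega>) = a * (\<integral>\<^sup>+p. u (\<omega>, p) \<partial>N c \<omega>)"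
      "(\<integral>\<^sup>+p. a * u (\<omega>, p) * indicator jump_region p \<partial>lborel) = a * (\<integral>\<^sup>+p. u (\<omega>, p) * indicator jump_region p \<partial>lborel)"
      if "\<omega> \<in> space M" for \<omega>
      using m[OF that] by (auto simp: nn_integral_cmult mult.assoc)
    moreover have [measurable]: "(\<lambda>\<omega>. \<integral>\<^sup>+p. u (\<omega>, p) \<partial>N c \<omega>) \<in> borel_measurable M" using mult by simp
    moreover have "(\<lambda>\<omega>. a * (\<integral>\<^sup>+p. u (\<omega>, p) \<partial>N c \<omega>)) \<in> borel_measurable M" by measurable
    ultimately show ?case using mult mm
      by (simp cong: nn_integral_cong measurable_cong add: nn_integral_cmult)
  next
    case (add u v)
    have m: "(\<lambda>p. u (\<omega>, p)) \<in> borel_measurable borel" "(\<lambda>p. v (\<omega>, p)) \<in> borel_measurable borel" if "\<omega> \<in> space M" for \<omega> 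
      using predictable_section[OF add(1) that] predictable_section[OF add(3) that] by auto
    note mm = borel_measurable_nn_integral_lborel[OF add(1)] borel_measurable_nn_integral_lborel[OF add(3)]
    have "(\<integral>\<^sup>+p. v (\<omega>, p) + u (\<omega>, p) \<partial>N c \<omega>) = (\<integral>\<^sup>+p. v (\<omega>, p) \<partial>N c \<omega>) + (\<integral>\<^sup>+p. u (\<omega>, p) \<partial>N c \<omega>)"
      "(\<integral>\<^sup>+p. (v (\<omega>, p) + u (\<omega>, p)) * indicator jump_region p \<partial>lborel)
        = (\<integral>\<^sup>+p. v (\<omega>, p) * indicator jump_region p \<partial>lborel) + (\<integral>\<^sup>+p. u (\<omega>, p) * indicator jump_region p \<partial>lborel)"
      if "\<omega> \<in> space M" for \<omega>
      using m[OF that] by (simp_all add: nn_integral_add distrib_right)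
    moreover have [measurable]: "(\<lambda>\<omega>. \<integral>\<^sup>+p. u (\<omega>, p) \<partial>N c \<omega>) \<in> borel_measurable M" "(\<lambda>\<omega>. \<integral>\<^sup>+p. v (\<omega>, p) \<partial>N c \<omega>) \<in> borel_measurable M"
      using add by auto
    moreover have "(\<lambda>\<omega>. (\<integral>\<^sup>+p. v (\<omega>, p) \<partial>N c \<omega>) + (\<integral>\<^sup>+p. u (\<omega>, p) \<partial>N c \<omega>)) \<in> borel_measurable M" by measurable
    ultimately show ?case using add mm
      by (simp cong: nn_integral_cong measurable_cong add: nn_integral_add)
  next
    case (seq U)
    have m: "(\<lambda>p. U i (\<omega>, p)) \<in> borel_measurable borel" if "\<omega> \<in> space M" for \<omega> i
      using predictable_section[OF seq(1) that] .
    note mm = borel_measurable_nn_integral_lborel[OF seq(1)]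
    have inc: "incseq (\<lambda>i p. U i (\<omega>, p))" "incseq (\<lambda>i p. U i (\<omega>, p) * indicator jump_region p)" for \<omega>
      using seq(3) by (auto simp: incseq_def le_fun_def intro!: mult_right_mono)
    have *: "(\<integral>\<^sup>+p. (SUP i. U i (\<omega>, p)) \<partial>N c \<omega>) = (SUP i. \<integral>\<^sup>+p. U i (\<omega>, p) \<partial>N c \<omega>)"
      "(\<integral>\<^sup>+p. (SUP i. U i (\<omega>, p)) * indicator jump_region p \<partial>lborel) = (SUP i. \<integral>\<^sup>+p. U i (\<omega>, p) * indicator jump_region p \<partial>lborel)"
      if "\<omega> \<in> space M" for \<omega>
      using m[OF that] inc[of \<omega>]
      by (auto simp: nn_integral_monotone_convergence_SUP[symmetric] SUP_apply SUP_mult_right_ennreal image_comp)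
    have inc2: "incseq (\<lambda>i \<omega>. \<integral>\<^sup>+p. U i (\<omega>, p) \<partial>N c \<omega>)" "incseq (\<lambda>i \<omega>. \<integral>\<^sup>+p. U i (\<omega>, p) * indicator jump_region p \<partial>lborel)"
      using inc by (auto simp: incseq_def le_fun_def intro!: nn_integral_mono)
    have [measurable]: "(\<lambda>\<omega>. \<integral>\<^sup>+p. U i (\<omega>, p) \<partial>N c \<omega>) \<in> borel_measurable M" for i using seq by auto
    have "(\<lambda>\<omega>. SUP i. \<integral>\<^sup>+p. U i (\<omega>, p) \<partial>N c \<omega>) \<in> borel_measurable M" by measurable
    moreover have "(SUP i. U i) x = (SUP i. U i x)" for x by (simp add: image_comp)
    ultimately show ?case using seq mm inc2
      by (simp cong: nn_integral_cong measurable_cong add: * nn_integral_monotone_convergence_SUP del: SUP_apply Sup_apply)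
  qed
  then show "(\<lambda>\<omega>. \<integral>\<^sup>+p. H (\<omega>, p) \<partial>N c \<omega>) \<in> borel_measurable M"
    "(\<integral>\<^sup>+\<omega>. \<integral>\<^sup>+p. H (\<omega>, p) \<partial>N c \<omega> \<partial>M) = (\<integral>\<^sup>+\<omega>. \<integral>\<^sup>+p. H (\<omega>, p) * indicator jump_region p \<partial>lborel \<partial>M)"
    by auto
qed

end

section \<open>Left limits of adapted processes\<close>

lemma left_lim_tendsto:
  assumes "cadlag_process M U" "\<omega> \<in> space M" "s > 0"
  shows "((\<lambda>r. U r \<omega>) \<longlongrightarrow> left_lim U \<omega> s) (at_left s)"
proof -
  obtain l where l: "((\<lambda>r. U r \<omega>) \<longlongrightarrow> l) (at_left s)"
    using assms unfolding cadlag_process_def by (meson less_imp_le)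
  then have "Lim (at_left s) (\<lambda>r. U r \<omega>) = l" by (intro tendsto_Lim) auto
  then show ?thesis using l \<open>s > 0\<close> by (simp add: left_lim_def)
qed

lemma cadlag_right_tendsto:
  assumes "cadlag_process M U" "\<omega> \<in> space M" "s \<ge> 0"
  shows "((\<lambda>r. U r \<omega>) \<longlongrightarrow> U s \<omega>) (at_right s)"
  using assms unfolding cadlag_process_def by (auto simp: continuous_within)

lemma cadlag_process_bounded:
  assumes "cadlag_process M U" "\<omega> \<in> space M"
  obtains B where "\<And>s. 0 \<le> s \<Longrightarrow> s \<le> T \<Longrightarrow> \<bar>U s \<omega>\<bar> \<le> B"
proof (rule cadlag_bounded[of "\<lambda>r. U r \<omega>" T])
  show "continuous (at_right t) (\<lambda>r. U r \<omega>)" if "t \<ge> 0" for t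
    using assms that unfolding cadlag_process_def by blast
  show "\<exists>l. ((\<lambda>r. U r \<omega>) \<longlongrightarrow> l) (at_left t)" if "t > 0" for t
    using assms that unfolding cadlag_process_def by (meson less_imp_le)
qed blast

lemma left_lim_bounded:
  assumes "cadlag_process M U" "\<omega> \<in> space M" "0 < s"
    and "\<And>r. 0 \<le> r \<Longrightarrow> r < s \<Longrightarrow> \<bar>U r \<omega>\<bar> \<le> B"
  shows "\<bar>left_lim U \<omega> s\<bar> \<le> B"
proof -
  have "((\<lambda>r. \<bar>U r \<omega>\<bar>) \<longlongrightarrow> \<bar>left_lim U \<omega> s\<bar>) (at_left s)"
    by (intro tendsto_intros left_lim_tendsto[OF assms(1-3)])
  moreover have "eventually (\<lambda>r. \<bar>U r \<omega>\<bar> \<le> B) (at_left s)"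
    unfolding eventually_at_left[OF \<open>0 < s\<close>] using assms(3,4) by (auto intro!: exI[of _ 0])
  ultimately show ?thesis by (intro tendsto_upperbound) auto
qed

lemma left_lim_diff_bounded:
  assumes "cadlag_process M U" "cadlag_process M V" "\<omega> \<in> space M" "0 < s"
    and "\<And>r. 0 \<le> r \<Longrightarrow> r < s \<Longrightarrow> \<bar>U r \<omega> - V r \<omega>\<bar> \<le> B"
  shows "\<bar>left_lim U \<omega> s - left_lim V \<omega> s\<bar> \<le> B"
proof -
  have "((\<lambda>r. \<bar>U r \<omega> - V r \<omega>\<bar>) \<longlongrightarrow> \<bar>left_lim U \<omega> s - left_lim V \<omega> s\<bar>) (at_left s)"
    by (intro tendsto_intros left_lim_tendsto[of M] assms(1-4))
  moreover have "eventually (\<lambda>r. \<bar>U r \<omega> - V r \<omega>\<bar> \<le> B) (at_left s)"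
    unfolding eventually_at_left[OF \<open>0 < s\<close>] using assms(4,5) by (auto intro!: exI[of _ 0])
  ultimately show ?thesis by (intro tendsto_upperbound) auto
qed

text \<open>By right continuity U is the limit of its values at grid points strictly to the right.
  There are countably many grid indices, so each approximation is jointly measurable;
  \<open>max 0\<close> removes negative times, about which nothing is known.\<close>

lemma cadlag_joint_measurable:
  fixes M :: "'a measure" and U :: "real \<Rightarrow> 'a \<Rightarrow> real"
  assumes U: "\<And>t. 0 \<le> t \<Longrightarrow> U t \<in> borel_measurable M" and "cadlag_process M U"
  shows "(\<lambda>x. U (max 0 (fst x)) (snd x)) \<in> borel_measurable ((borel :: real measure) \<Otimes>\<^sub>M M)"
proof (rule borel_measurable_LIMSEQ_metric)
  \<comment> \<open>Adding 1 to the floor keeps the grid point strictly above the time, also when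
    the time lies on the grid, as convergence along \<open>at_right\<close> requires.\<close>
  let ?j = "\<lambda>n (x :: real \<times> 'a). nat \<lfloor>real (Suc n) * max 0 (fst x)\<rfloor> + 1"
  let ?X = "\<lambda>n x. U (real (?j n x) / real (Suc n)) (snd x)"
  show "?X n \<in> borel_measurable ((borel :: real measure) \<Otimes>\<^sub>M M)" for n
  proof (rule measurable_compose_countable[where f="\<lambda>j x. U (real j / real (Suc n)) (snd x)"])
    show "(\<lambda>x. U (real j / real (Suc n)) (snd x)) \<in> borel_measurable ((borel :: real measure) \<Otimes>\<^sub>M M)" for j
      by (rule measurable_compose[OF measurable_snd]) (simp add: U)
    show "?j n \<in> (borel :: real measure) \<Otimes>\<^sub>M M \<rightarrow>\<^sub>M count_space UNIV" by measurable
  qed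
  fix x assume x: "x \<in> space ((borel :: real measure) \<Otimes>\<^sub>M M)"
  define s where "s = max 0 (fst x)"
  have s: "s \<ge> 0" by (simp add: s_def)
  have \<omega>: "snd x \<in> space M" using x by (auto simp: space_pair_measure)
  have gt: "s < real (?j n x) / real (Suc n)" for n
  proof -
    have "real (Suc n) * s < real (?j n x)" using s unfolding s_def[symmetric] by linarith
    then show ?thesis by (simp add: field_simps)
  qed
  have le: "real (?j n x) / real (Suc n) \<le> s + 1 / real (Suc n)" for n
  proof -
    have "real (?j n x) \<le> real (Suc n) * s + 1"
      using s unfolding s_def[symmetric] by (simp add: of_nat_nat)
    then have "real (?j n x) / real (Suc n) \<le> (real (Suc n) * s + 1) / real (Suc n)"
      by (intro divide_right_mono) auto
    also have "\<dots> = s + 1 / real (Suc n)" by (simp add: add_divide_distrib del: of_nat_Suc)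
    finally show ?thesis .
  qed
  have "(\<lambda>n. real (?j n x) / real (Suc n)) \<longlonglongrightarrow> s"
  proof (rule tendsto_sandwich[of "\<lambda>n. s" _ _ "\<lambda>n. s + 1 / real (Suc n)"])
    show "(\<lambda>n. s + 1 / real (Suc n)) \<longlonglongrightarrow> s"
      using tendsto_add[OF tendsto_const[of s] lim_inverse_n'[THEN LIMSEQ_Suc]] by simp
    show "(\<lambda>n. s) \<longlonglongrightarrow> s" by simp
  qed (use less_imp_le[OF gt] le in auto)
  then have "filterlim (\<lambda>n. real (?j n x) / real (Suc n)) (at_right s) sequentially"
    using gt by (intro filterlim_at_withinI) auto
  from filterlim_compose[OF cadlag_right_tendsto[OF assms(2) \<omega> s] this]
  show "(\<lambda>n. ?X n x) \<longlonglongrightarrow> U (max 0 (fst x)) (snd x)" by (simp add: s_def)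
qed

context jump_noise
begin

definition cadlag_adapted :: "(real \<Rightarrow> 'a \<Rightarrow> real) \<Rightarrow> bool" where
  "cadlag_adapted U \<longleftrightarrow> (\<forall>t\<ge>0. U t \<in> borel_measurable (F t)) \<and> cadlag_process M U"

lemma cadlag_adapted_measurable: "cadlag_adapted U \<Longrightarrow> 0 \<le> t \<Longrightarrow> U t \<in> borel_measurable M"
  using measurable_F[of t "U t"] by (simp add: cadlag_adapted_def)

lemma cadlag_adaptedD: "cadlag_adapted U \<Longrightarrow> cadlag_process M U"
  by (simp add: cadlag_adapted_def)

text \<open>The elementary predictable process: a value known at time r is read at times strictly
  after r only.\<close>

lemma predictable_step:
  assumes V: "V \<in> borel_measurable (F (max 0 r))" and T: "T \<in> sets borel" "T \<subseteq> {r<..}"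
  shows "(\<lambda>x. if fst (snd x) \<in> T then V (fst x) else (0::real)) \<in> borel_measurable predictable"
proof (rule measurableI)
  fix B :: "real set" assume B: "B \<in> sets borel"
  define A where "A = V -` B \<inter> space M"
  have A: "A \<in> sets (F (max 0 r))"
    using measurable_sets[OF V B] by (simp add: A_def space_F)
  have "T \<times> (UNIV :: real set) \<in> sets borel" using T(1) by (intro borel_Times) auto
  then have 1: "A \<times> (T \<times> UNIV) \<in> sets predictable"
    using T(2) by (intro pred_gen_predictable[OF A]) auto
  have 2: "{x \<in> space predictable. fst (snd x) \<notin> T} \<in> sets predictable"
    using T(1) by measurable
  have "(\<lambda>x. if fst (snd x) \<in> T then V (fst x) else 0) -` B \<inter> space predictable
    = A \<times> (T \<times> UNIV) \<union> (if 0 \<in> B then {x \<in> space predictable. fst (snd x) \<notin> T} else {})"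
    by (auto simp: A_def split: if_splits)
  then show "(\<lambda>x. if fst (snd x) \<in> T then V (fst x) else 0) -` B \<inter> space predictable \<in> sets predictable"
    using 1 2 by auto
qed simp

text \<open>On each grid cell, open on the left, the process is frozen at the left end point. These
  step processes are predictable, and they converge to the left limit because the chosen grid point
  is strictly below the time.\<close>

lemma left_lim_predictable:
  assumes U: "cadlag_adapted U"
  shows "(\<lambda>x. left_lim U (fst x) (fst (snd x))) \<in> borel_measurable predictable"
proof (rule borel_measurable_LIMSEQ_metric)
  let ?c = "\<lambda>n j. {real j / real (Suc n)<..real (Suc j) / real (Suc n)}"
  \<comment> \<open>The first summand reproduces the convention that the left limit at s \<le> 0 is
    the value at 0. The (n + 1)^2 cells of width 1/(n + 1) cover the times up to n + 1, hence
    eventually every positive time.\<close>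
  let ?X = "\<lambda>n x. (if fst (snd x) \<in> {- real n<..0} then U 0 (fst x) else 0) +
    (\<Sum>j<Suc n * Suc n. if fst (snd x) \<in> ?c n j then U (real j / real (Suc n)) (fst x) else 0)"
  have Um: "U t \<in> borel_measurable (F (max 0 t))" if "t \<ge> 0" for t
    using U that by (simp add: cadlag_adapted_def max_def)
  show "?X n \<in> borel_measurable predictable" for n
  proof (intro borel_measurable_add borel_measurable_sum)
    show "(\<lambda>x. if fst (snd x) \<in> {- real n<..0} then U 0 (fst x) else 0) \<in> borel_measurable predictable"
      using Um[of 0] by (intro predictable_step[of _ "- real n"]) auto
    show "(\<lambda>x. if fst (snd x) \<in> ?c n j then U (real j / real (Suc n)) (fst x) else 0) \<in> borel_measurable predictable" for j
      using Um[of "real j / real (Suc n)"] by (intro predictable_step) auto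
  qed
  fix x assume x: "x \<in> space predictable"
  define \<omega> s where "\<omega> = fst x" and "s = fst (snd x)"
  have \<omega>: "\<omega> \<in> space M" using x by (auto simp: \<omega>_def)
  show "(\<lambda>n. ?X n x) \<longlonglongrightarrow> left_lim U (fst x) (fst (snd x))"
  proof (cases "s \<le> 0")
    case True
    have notc: "s \<notin> ?c n j" for n j
    proof -
      have "s \<le> real j / real (Suc n)" using True by (rule order_trans) simp
      then show ?thesis by auto
    qed
    have "eventually (\<lambda>n. - real n < s) sequentially"
      using eventually_gt_at_top[of "nat \<lceil>- s\<rceil>"] by eventually_elim linarith
    then have "eventually (\<lambda>n. ?X n x = U 0 \<omega>) sequentially"
      unfolding \<omega>_def[symmetric] s_def[symmetric]
    proof eventually_elim
      case (elim n)
      then have "s \<in> {- real n<..0}" using True by simp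
      moreover have "(\<Sum>j<Suc n * Suc n. if s \<in> ?c n j then U (real j / real (Suc n)) \<omega> else 0) = 0"
        using notc by (intro sum.neutral ballI if_not_P) blast
      ultimately show ?case by (simp only: if_True add.right_neutral)
    qed
    then show ?thesis
      using True unfolding \<omega>_def[symmetric] s_def[symmetric] 
      by (simp add: left_lim_def tendsto_eventually)
  next
    case False
    then have s: "s > 0" by simp
    let ?j = "\<lambda>n. nat (\<lceil>real (Suc n) * s\<rceil> - 1)"
    have pos: "0 < real (Suc n) * s" for n using s by (intro mult_pos_pos) auto
    have j: "real (?j n) < real (Suc n) * s" "real (Suc n) * s \<le> real (Suc (?j n))" for n
      using pos[of n] by linarith+
    have lt: "real (?j n) / real (Suc n) < s" for n using j(1)[of n] by (simp add: field_simps)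
    have ge: "s - 1 / real (Suc n) \<le> real (?j n) / real (Suc n)" for n
    proof -
      have "real (Suc n) * s - 1 \<le> real (?j n)" using j(2)[of n] by simp
      then have "(real (Suc n) * s - 1) / real (Suc n) \<le> real (?j n) / real (Suc n)"
        by (intro divide_right_mono) auto
      moreover have "(real (Suc n) * s - 1) / real (Suc n) = s - 1 / real (Suc n)"
        by (simp add: diff_divide_distrib del: of_nat_Suc)
      ultimately show ?thesis by simp
    qed
    have mem: "s \<in> ?c n i \<longleftrightarrow> i = ?j n" for n i
    proof
      assume "s \<in> ?c n i"
      then have "real i < real (Suc n) * s" "real (Suc n) * s \<le> real (Suc i)" by (auto simp: field_simps)
      with j[of n] show "i = ?j n" by linarith
    qed (use j[of n] in \<open>auto simp: field_simps\<close>)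
    have "eventually (\<lambda>n. s < real n) sequentially"
      using eventually_gt_at_top[of "nat \<lceil>s\<rceil>"] by eventually_elim linarith
    then have ev: "eventually (\<lambda>n. ?X n x = U (real (?j n) / real (Suc n)) \<omega>) sequentially"
    proof eventually_elim
      case (elim n)
      have "real (Suc n) * s \<le> real (Suc n) * real (Suc n)" using elim by (intro mult_left_mono) auto
      then have "?j n < Suc n * Suc n" using j(1)[of n] by (metis less_le_trans of_nat_less_iff of_nat_mult)
      then show ?case using s unfolding \<omega>_def[symmetric] s_def[symmetric] mem by (simp add: sum.delta del: of_nat_Suc)
    qed
    have "(\<lambda>n. real (?j n) / real (Suc n)) \<longlonglongrightarrow> s"
    proof (rule tendsto_sandwich)
      show "(\<lambda>n. s - 1 / real (Suc n)) \<longlonglongrightarrow> s"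
        using tendsto_diff[OF tendsto_const[of s] lim_inverse_n'[THEN LIMSEQ_Suc]] by simp
      show "(\<lambda>n. s) \<longlonglongrightarrow> s" by simp
    qed (use less_imp_le[OF lt] ge in auto)
    then have "filterlim (\<lambda>n. real (?j n) / real (Suc n)) (at_left s) sequentially"
      using lt by (intro filterlim_at_withinI) auto
    from filterlim_compose[OF left_lim_tendsto[OF cadlag_adaptedD[OF U] \<omega> s] this]
    have "(\<lambda>n. ?X n x) \<longlonglongrightarrow> left_lim U \<omega> s"
      by (rule tendsto_cong[OF ev, THEN iffD2])
    then show ?thesis by (simp only: \<omega>_def s_def)
  qed
qed

lemma left_lim_measurable_path:
  assumes "cadlag_adapted U" "\<omega> \<in> space M"
  shows "(\<lambda>p. left_lim U \<omega> (fst p)) \<in> borel_measurable (borel :: (real \<times> real) measure)"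
  using predictable_section[OF left_lim_predictable[OF assms(1)] assms(2)] by simp

lemma left_lim_measurable_joint:
  assumes "cadlag_adapted U"
  shows "(\<lambda>x. left_lim U (fst x) (snd x)) \<in> borel_measurable (M \<Otimes>\<^sub>M (borel :: real measure))"
proof -
  have "(\<lambda>x. (fst x, (snd x, 0::real))) \<in> M \<Otimes>\<^sub>M borel \<rightarrow>\<^sub>M M \<Otimes>\<^sub>M (borel :: (real \<times> real) measure)"
    unfolding borel_prod[symmetric] by measurable
  from measurable_compose[OF this predictable_measurable_pair[OF left_lim_predictable[OF assms]]]
  show ?thesis by simp
qed

lemma left_lim_measurable:
  assumes "cadlag_adapted U"
  shows "(\<lambda>\<omega>. left_lim U \<omega> s) \<in> borel_measurable M"
  using measurable_compose[OF measurable_Pair2'[of s borel M] left_lim_measurable_joint[OF assms]] by simp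

end

section \<open>The truncated equation\<close>

text \<open>The level is a function of time because the a priori bounds grow with time. It is
  monotone so that a bound at time s also covers all earlier times, in particular the values that
  form the left limit at s.\<close>

locale truncated_sde = jump_noise M F N
  for M :: "'a measure" and F :: "real \<Rightarrow> 'a measure" and N :: "real \<Rightarrow> 'a \<Rightarrow> (real \<times> real) measure" +
  fixes \<phi> \<kappa> :: "real \<Rightarrow> real" and h :: real and U0 :: "'a \<Rightarrow> real"
  assumes \<phi>_lipschitz: "locally_lipschitz \<phi>" and \<phi>_nonneg: "\<And>x. 0 \<le> \<phi> x"
    and h_nonneg: "0 \<le> h"
    and \<kappa>_mono: "mono \<kappa>" and \<kappa>_nonneg: "\<And>s. 0 \<le> \<kappa> s"
    and U0_measurable: "U0 \<in> borel_measurable M"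
begin

definition clamp :: "real \<Rightarrow> real \<Rightarrow> real" where
  "clamp s x = max (- \<kappa> s) (min (\<kappa> s) x)"

text \<open>The amount removed is clamped together with the threshold. Above the level a jump
  therefore does not reset the path to 0, it only moves it towards 0
  (\<open>clamp_contract\<close>); below the level it is the original jump.\<close>

definition jump :: "real \<Rightarrow> real \<Rightarrow> real \<Rightarrow> real \<Rightarrow> real" where
  "jump c s x z = (if z \<le> \<phi> (c * clamp s x) then clamp s x else 0)"

definition jumps :: "(real \<Rightarrow> 'a \<Rightarrow> real) \<Rightarrow> real \<Rightarrow> real \<Rightarrow> 'a \<Rightarrow> real" where
  "jumps U c t \<omega> = (\<integral>p. (if 0 < fst p \<and> fst p \<le> t
      then jump c (fst p) (left_lim U \<omega> (fst p)) (snd p) else 0) \<partial>N c \<omega>)"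

definition rate :: "(real \<Rightarrow> 'a \<Rightarrow> real) \<Rightarrow> real \<Rightarrow> real \<Rightarrow> real" where
  "rate U c s = (\<integral>\<omega>. \<phi> (c * clamp s (U s \<omega>)) \<partial>M)"

definition drift :: "(real \<Rightarrow> 'a \<Rightarrow> real) \<Rightarrow> real \<Rightarrow> real" where
  "drift U t = h * ((LINT s:{0..t}|lborel. rate U 1 s) - (LINT s:{0..t}|lborel. rate U (-1) s))"

definition \<Phi> :: "(real \<Rightarrow> 'a \<Rightarrow> real) \<Rightarrow> real \<Rightarrow> 'a \<Rightarrow> real" where
  "\<Phi> U t \<omega> = U0 \<omega> - (jumps U 1 t \<omega> + jumps U (-1) t \<omega>) + drift U t"

definition jump_dist :: "(real \<Rightarrow> 'a \<Rightarrow> real) \<Rightarrow> (real \<Rightarrow> 'a \<Rightarrow> real) \<Rightarrow> real \<Rightarrow> real \<Rightarrow> 'a \<Rightarrow> ennreal" where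
  "jump_dist U V c t \<omega> = (\<integral>\<^sup>+p. ennreal \<bar>jump c (fst p) (left_lim U \<omega> (fst p)) (snd p)
      - jump c (fst p) (left_lim V \<omega> (fst p)) (snd p)\<bar> * indicator {0<..t} (fst p) \<partial>N c \<omega>)"

definition rate_dist :: "(real \<Rightarrow> 'a \<Rightarrow> real) \<Rightarrow> (real \<Rightarrow> 'a \<Rightarrow> real) \<Rightarrow> real \<Rightarrow> real \<Rightarrow> ennreal" where
  "rate_dist U V c t = (\<integral>\<^sup>+s. ennreal \<bar>rate U c s - rate V c s\<bar> * indicator {0..t} s \<partial>lborel)"

text \<open>A nondecreasing process that dominates \<open>\<bar>\<Phi> U - \<Phi> V\<bar>\<close> uniformly on \<open>{0..t}\<close>; it replaces
  the supremum of the difference, whose measurability would need a separate argument.\<close>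

definition dominator :: "(real \<Rightarrow> 'a \<Rightarrow> real) \<Rightarrow> (real \<Rightarrow> 'a \<Rightarrow> real) \<Rightarrow> real \<Rightarrow> 'a \<Rightarrow> ennreal" where
  "dominator U V t \<omega> = (jump_dist U V 1 t \<omega> + jump_dist U V (-1) t \<omega>)
      + ennreal h * (rate_dist U V 1 t + rate_dist U V (-1) t)"

section \<open>Bounds and Lipschitz estimates for the truncated coefficients\<close>

lemma \<phi>_continuous: "continuous_on UNIV \<phi>"
  by (rule locally_lipschitz_continuous[OF \<phi>_lipschitz])

lemma \<phi>_measurable[measurable]: "\<phi> \<in> borel_measurable borel"
  by (rule borel_measurable_continuous_onI[OF \<phi>_continuous])

lemma \<kappa>_measurable[measurable]: "\<kappa> \<in> borel_measurable borel"
  by (rule borel_measurable_mono[OF \<kappa>_mono])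

lemma \<kappa>_le: "s \<le> t \<Longrightarrow> \<kappa> s \<le> \<kappa> t"
  using \<kappa>_mono by (rule monoD)

lemma clamp_le: "\<bar>clamp s x\<bar> \<le> \<kappa> s"
  using \<kappa>_nonneg[of s] by (auto simp: clamp_def)

lemma clamp_le': "s \<le> t \<Longrightarrow> \<bar>clamp s x\<bar> \<le> \<kappa> t"
  using clamp_le \<kappa>_le order_trans by blast

lemma clamp_eq: "\<bar>x\<bar> \<le> \<kappa> s \<Longrightarrow> clamp s x = x"
  by (auto simp: clamp_def)

lemma clamp_diff: "\<bar>clamp s x - clamp s y\<bar> \<le> \<bar>x - y\<bar>"
  using \<kappa>_nonneg[of s] unfolding clamp_def max_def min_def by (smt (verit))

text \<open>\<open>clamp s x\<close> has the sign of x and at most its modulus, so removing a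
  fraction of it cannot overshoot 0.\<close>

lemma clamp_contract:
  assumes "0 \<le> r" "r \<le> 1"
  shows "\<bar>x - r * clamp s x\<bar> \<le> \<bar>x\<bar> - r * \<bar>clamp s x\<bar>"
proof -
  have le: "r * \<bar>clamp s x\<bar> \<le> 1 * \<bar>clamp s x\<bar>" using assms by (intro mult_right_mono) auto
  have "\<bar>clamp s x\<bar> \<le> \<bar>x\<bar>" "x \<ge> 0 \<longrightarrow> clamp s x \<ge> 0" "x \<le> 0 \<longrightarrow> clamp s x \<le> 0"
    using \<kappa>_nonneg[of s] by (auto simp: clamp_def)
  moreover have "x \<ge> 0 \<longrightarrow> r * clamp s x \<ge> 0" "x \<le> 0 \<longrightarrow> r * clamp s x \<le> 0"
    using calculation assms by (auto simp: mult_nonneg_nonpos)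
  ultimately show ?thesis using le assms by (cases "x \<ge> 0") auto
qed

lemma clamp_measurable[measurable (raw)]:
  assumes [measurable]: "f \<in> borel_measurable X" "g \<in> borel_measurable X"
  shows "(\<lambda>x. clamp (f x) (g x)) \<in> borel_measurable X"
  unfolding clamp_def by measurable

lemma jump_measurable[measurable (raw)]:
  assumes [measurable]: "f \<in> borel_measurable X" "g \<in> borel_measurable X" "k \<in> borel_measurable X"
  shows "(\<lambda>x. jump c (f x) (g x) (k x)) \<in> borel_measurable X"
  unfolding jump_def by measurable

text \<open>All clamped states up to time T lie in [-\<kappa> T, \<kappa> T], where \<phi> has one
  Lipschitz constant; the bound follows by comparison with \<phi> 0.\<close>

lemma \<phi>_clamp_bounds:
  obtains B C where "0 \<le> B" "0 \<le> C"
    "\<And>c s x. \<bar>c\<bar> = 1 \<Longrightarrow> s \<le> T \<Longrightarrow> \<phi> (c * clamp s x) \<le> B"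
    "\<And>c s x y. \<bar>c\<bar> = 1 \<Longrightarrow> s \<le> T \<Longrightarrow>
      \<bar>\<phi> (c * clamp s x) - \<phi> (c * clamp s y)\<bar> \<le> C * \<bar>clamp s x - clamp s y\<bar>"
proof -
  obtain C where C: "C \<ge> 0" "\<And>x y. \<bar>x\<bar> \<le> \<kappa> T \<Longrightarrow> \<bar>y\<bar> \<le> \<kappa> T \<Longrightarrow> \<bar>\<phi> x - \<phi> y\<bar> \<le> C * \<bar>x - y\<bar>"
    using locally_lipschitz_on_Icc[OF \<phi>_lipschitz] by blast
  have c: "\<bar>c * clamp s x\<bar> \<le> \<kappa> T" if "\<bar>c\<bar> = 1" "s \<le> T" for c s x
    using clamp_le'[OF that(2)] that by (simp add: abs_mult)
  show thesis
  proof (rule that[of "\<phi> 0 + C * \<kappa> T" C])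
    show "0 \<le> \<phi> 0 + C * \<kappa> T" using \<phi>_nonneg[of 0] \<kappa>_nonneg[of T] C by simp
    show "\<phi> (c * clamp s x) \<le> \<phi> 0 + C * \<kappa> T" if "\<bar>c\<bar> = 1" "s \<le> T" for c s x
    proof -
      have "\<bar>\<phi> (c * clamp s x) - \<phi> 0\<bar> \<le> C * \<bar>c * clamp s x - 0\<bar>"
        using c[OF that] \<kappa>_nonneg by (intro C(2)) auto
      also have "\<dots> \<le> C * \<kappa> T" using c[OF that] C by (intro mult_left_mono) auto
      finally show ?thesis by linarith
    qed
    show "\<bar>\<phi> (c * clamp s x) - \<phi> (c * clamp s y)\<bar> \<le> C * \<bar>clamp s x - clamp s y\<bar>" if "\<bar>c\<bar> = 1" "s \<le> T" for c s x y
    proof -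
      have "\<bar>\<phi> (c * clamp s x) - \<phi> (c * clamp s y)\<bar> \<le> C * \<bar>c * clamp s x - c * clamp s y\<bar>"
        using c[OF that] by (intro C(2)) auto
      also have "\<bar>c * clamp s x - c * clamp s y\<bar> = \<bar>clamp s x - clamp s y\<bar>"
        using that by (simp add: abs_mult flip: right_diff_distrib)
      finally show ?thesis .
    qed
  qed (use C in auto)
qed

lemma jump_predictable:
  assumes "cadlag_adapted U"
  shows "(\<lambda>x. jump c (fst (snd x)) (left_lim U (fst x) (fst (snd x))) (snd (snd x))) \<in> borel_measurable predictable"
  using left_lim_predictable[OF assms] by measurable

lemma jump_path_measurable:
  assumes "cadlag_adapted U" "\<omega> \<in> space M"
  shows "(\<lambda>p. jump c (fst p) (left_lim U \<omega> (fst p)) (snd p)) \<in> borel_measurable (borel :: (real \<times> real) measure)"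
  using predictable_section[OF jump_predictable[OF assms(1)] assms(2)] by simp

lemma jump_le: "\<bar>jump c s x z\<bar> \<le> \<kappa> s"
  using clamp_le[of s x] \<kappa>_nonneg[of s] by (auto simp: jump_def)

lemma jump_le': "s \<le> t \<Longrightarrow> \<bar>jump c s x z\<bar> \<le> \<kappa> t"
  using jump_le \<kappa>_le order_trans by blast

text \<open>Thresholds up to time T are bounded, so points with larger marks never act and the jump
  integrals live on a single box of finite mass.\<close>

lemma jump_support:
  assumes "\<bar>c\<bar> = 1"
  obtains n where "\<And>s x z. s \<le> T \<Longrightarrow> 0 < s \<Longrightarrow> 0 \<le> z \<Longrightarrow> (s, z) \<notin> jump_box n \<Longrightarrow> jump c s x z = 0" "T \<le> real n"
proof -
  obtain B C where B: "\<And>c s x. \<bar>c\<bar> = 1 \<Longrightarrow> s \<le> T \<Longrightarrow> \<phi> (c * clamp s x) \<le> B"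
    using \<phi>_clamp_bounds[of T] by metis
  obtain n where n: "max B T \<le> real n" using real_arch_simple by blast
  show thesis
  proof (rule that)
    show "jump c s x z = 0" if "s \<le> T" "0 < s" "0 \<le> z" "(s, z) \<notin> jump_box n" for s x z
      using B[OF assms that(1), of x] n that by (auto simp: jump_def jump_box_def)
  qed (use n in auto)
qed

lemma jumps_integrable:
  assumes U: "cadlag_adapted U" and \<omega>: "\<omega> \<in> space M" and c: "\<bar>c\<bar> = 1"
  shows "integrable (N c \<omega>) (\<lambda>p. if 0 < fst p \<and> fst p \<le> t
      then jump c (fst p) (left_lim U \<omega> (fst p)) (snd p) else 0)"
proof -
  obtain n where n: "\<And>s x z. s \<le> t \<Longrightarrow> 0 < s \<Longrightarrow> 0 \<le> z \<Longrightarrow> (s, z) \<notin> jump_box n \<Longrightarrow> jump c s x z = 0"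
    using jump_support[OF c, of t] by metis
  have [measurable]: "(\<lambda>p. jump c (fst p) (left_lim U \<omega> (fst p)) (snd p)) \<in> borel_measurable (N c \<omega>)"
    using jump_path_measurable[OF U \<omega>] by (simp cong: measurable_cong_sets)
  have [measurable]: "fst \<in> borel_measurable (N c \<omega>)"
    by (subst measurable_cong_sets[OF sets_N refl]) (simp add: borel_prod[symmetric])
  show ?thesis
  proof (rule integrableI_bounded_set[where A="jump_box n" and B="\<kappa> t"])
    show "emeasure (N c \<omega>) (jump_box n) < \<infinity>" by (rule N_fin[OF \<omega>])
    show "AE p in N c \<omega>. p \<in> jump_box n \<longrightarrow> norm (if 0 < fst p \<and> fst p \<le> t
      then jump c (fst p) (left_lim U \<omega> (fst p)) (snd p) else 0) \<le> \<kappa> t"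
      using jump_le' \<kappa>_nonneg[of t] by (intro AE_I2) auto
    show "AE p in N c \<omega>. p \<notin> jump_box n \<longrightarrow> (if 0 < fst p \<and> fst p \<le> t
      then jump c (fst p) (left_lim U \<omega> (fst p)) (snd p) else 0) = 0"
      using AE_N_jump_region[of c \<omega>]
      by eventually_elim (use n in \<open>auto simp: jump_region_def\<close>)
  qed measurable
qed

text \<open>At negative times U is arbitrary. Joint measurability is available after s is replaced
  by \<open>max 0 s\<close>, which gives the claim on the half-line.\<close>

lemma rate_measurable:
  assumes U: "cadlag_adapted U"
  shows "rate U c \<in> borel_measurable (restrict_space borel {0..})"
proof -
  have [measurable]: "(\<lambda>x. U (max 0 (fst x)) (snd x)) \<in> borel_measurable ((borel :: real measure) \<Otimes>\<^sub>M M)"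
    using cadlag_joint_measurable[OF cadlag_adapted_measurable[OF U] cadlag_adaptedD[OF U]] .
  have "(\<lambda>s. \<integral>\<omega>. \<phi> (c * clamp s (U (max 0 s) \<omega>)) \<partial>M) \<in> borel_measurable borel"
    by measurable
  then have "(\<lambda>s. \<integral>\<omega>. \<phi> (c * clamp s (U (max 0 s) \<omega>)) \<partial>M) \<in> borel_measurable (restrict_space borel {0..})"
    by (rule measurable_restrict_space1)
  then show ?thesis
    by (rule measurable_cong[THEN iffD1, rotated]) (auto simp: rate_def space_restrict_space)
qed

lemma rate_indicator_measurable:
  assumes U: "cadlag_adapted U"
  shows "(\<lambda>s. rate U c s * indicator {0..t} s) \<in> borel_measurable borel"
proof -
  have "(\<lambda>s. indicator {0..} s *\<^sub>R rate U c s) \<in> borel_measurable borel"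
    using rate_measurable[OF U, of c] by (subst (asm) borel_measurable_restrict_space_iff) auto
  then have "(\<lambda>s. (indicator {0..} s *\<^sub>R rate U c s) * indicator {0..t} s) \<in> borel_measurable borel"
    by measurable
  also have "(\<lambda>s. (indicator {0..} s *\<^sub>R rate U c s) * indicator {0..t} s) = (\<lambda>s. rate U c s * indicator {0..t} s)"
    by (auto simp: indicator_def)
  finally show ?thesis .
qed

lemma \<phi>_clamp_integrable:
  assumes U: "X \<in> borel_measurable M" and c: "\<bar>c\<bar> = 1"
  shows "integrable M (\<lambda>\<omega>. \<phi> (c * clamp s (X \<omega>)))"
proof -
  obtain B C where B: "\<And>c s' x. \<bar>c\<bar> = 1 \<Longrightarrow> s' \<le> s \<Longrightarrow> \<phi> (c * clamp s' x) \<le> B"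
    using \<phi>_clamp_bounds[of s] by metis
  show ?thesis
    using U B[OF c] \<phi>_nonneg by (intro integrable_const_bound[of _ B]) auto
qed

lemma rate_nonneg: "0 \<le> rate U c s"
  unfolding rate_def by (intro Bochner_Integration.integral_nonneg \<phi>_nonneg)

lemma rate_bounded:
  assumes "cadlag_adapted U" "\<bar>c\<bar> = 1" "0 \<le> s" "s \<le> T"
    and B: "\<And>x. \<phi> (c * clamp s x) \<le> B"
  shows "rate U c s \<le> B"
proof -
  have "rate U c s \<le> (\<integral>\<omega>. B \<partial>M)"
    unfolding rate_def using assms
    by (intro integral_mono \<phi>_clamp_integrable cadlag_adapted_measurable) auto
  then show ?thesis by (simp add: prob_space)
qed

lemma rate_integrable:
  assumes U: "cadlag_adapted U" and c: "\<bar>c\<bar> = 1"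
  shows "set_integrable lborel {0..t} (rate U c)"
proof -
  obtain B C where B: "\<And>c s x. \<bar>c\<bar> = 1 \<Longrightarrow> s \<le> t \<Longrightarrow> \<phi> (c * clamp s x) \<le> B"
    using \<phi>_clamp_bounds[of t] by metis
  have "integrable lborel (\<lambda>s. rate U c s * indicator {0..t} s)"
  proof (rule integrableI_bounded_set[where A="{0..t}" and B=B])
    show "AE s in lborel. s \<in> {0..t} \<longrightarrow> norm (rate U c s * indicator {0..t} s) \<le> B"
      using rate_bounded[OF U c _ _ B[OF c]] rate_nonneg by auto
    show "emeasure lborel {0..t} < \<infinity>" by (simp add: emeasure_lborel_Icc_eq)
    show "(\<lambda>s. rate U c s * indicator {0..t} s) \<in> borel_measurable lborel"
      using rate_indicator_measurable[OF U] by simp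
  qed (auto simp: indicator_def)
  then show ?thesis by (simp add: set_integrable_def mult.commute)
qed

lemma dominator_mono: "s \<le> t \<Longrightarrow> dominator U V s \<omega> \<le> dominator U V t \<omega>"
  unfolding dominator_def jump_dist_def rate_dist_def
  by (intro add_mono mult_left_mono nn_integral_mono) (auto simp: indicator_def)

lemma dominator_measurable:
  assumes U: "cadlag_adapted U" and V: "cadlag_adapted V"
  shows "dominator U V t \<in> borel_measurable M"
proof -
  have "jump_dist U V c t \<in> borel_measurable M" for c
  proof -
    have [measurable]: "(\<lambda>x. jump c (fst (snd x)) (left_lim U (fst x) (fst (snd x))) (snd (snd x))) \<in> borel_measurable predictable"
      "(\<lambda>x. jump c (fst (snd x)) (left_lim V (fst x) (fst (snd x))) (snd (snd x))) \<in> borel_measurable predictable"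
      by (rule jump_predictable[OF U], rule jump_predictable[OF V])
    have "(\<lambda>x. ennreal \<bar>jump c (fst (snd x)) (left_lim U (fst x) (fst (snd x))) (snd (snd x))
      - jump c (fst (snd x)) (left_lim V (fst x) (fst (snd x))) (snd (snd x))\<bar> * indicator {0<..t} (fst (snd x)))
      \<in> borel_measurable predictable"
      by measurable
    from borel_measurable_nn_integral_N[OF this]
    show ?thesis unfolding jump_dist_def[abs_def] by simp
  qed
  then show ?thesis unfolding dominator_def[abs_def] by measurable
qed

lemma dominator:
  assumes U: "cadlag_adapted U" and V: "cadlag_adapted V" and \<omega>: "\<omega> \<in> space M" and rt: "0 \<le> r" "r \<le> t"
  shows "ennreal \<bar>\<Phi> U r \<omega> - \<Phi> V r \<omega>\<bar> \<le> dominator U V t \<omega>"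
proof -
  have J: "ennreal \<bar>jumps U c r \<omega> - jumps V c r \<omega>\<bar> \<le> jump_dist U V c r \<omega>" if c: "\<bar>c\<bar> = 1" for c
  proof -
    let ?f = "\<lambda>U p. if 0 < fst p \<and> fst p \<le> r then jump c (fst p) (left_lim U \<omega> (fst p)) (snd p) else 0"
    have int: "integrable (N c \<omega>) (\<lambda>p. ?f U p - ?f V p)"
      by (intro Bochner_Integration.integrable_diff jumps_integrable U V \<omega> c)
    have "jumps U c r \<omega> - jumps V c r \<omega> = (\<integral>p. ?f U p - ?f V p \<partial>N c \<omega>)"
      unfolding jumps_def by (intro Bochner_Integration.integral_diff[symmetric] jumps_integrable U V \<omega> c)
    then have "ennreal \<bar>jumps U c r \<omega> - jumps V c r \<omega>\<bar> \<le> (\<integral>\<^sup>+p. ennreal (norm (?f U p - ?f V p)) \<partial>N c \<omega>)"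
      using integral_norm_bound_ennreal[OF int] by simp
    also have "\<dots> = jump_dist U V c r \<omega>"
      unfolding jump_dist_def by (intro nn_integral_cong) (auto simp: indicator_def)
    finally show ?thesis .
  qed
  have D: "ennreal \<bar>(LINT s:{0..r}|lborel. rate U c s) - (LINT s:{0..r}|lborel. rate V c s)\<bar> \<le> rate_dist U V c r"
    if c: "\<bar>c\<bar> = 1" for c
  proof -
    have int: "set_integrable lborel {0..r} (\<lambda>s. rate U c s - rate V c s)"
      by (intro set_integral_diff(1) rate_integrable U V c)
    have "(LINT s:{0..r}|lborel. rate U c s) - (LINT s:{0..r}|lborel. rate V c s) = (LINT s:{0..r}|lborel. rate U c s - rate V c s)"
      by (intro set_integral_diff(2)[symmetric] rate_integrable U V c)
    then have "ennreal \<bar>(LINT s:{0..r}|lborel. rate U c s) - (LINT s:{0..r}|lborel. rate V c s)\<bar>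
      \<le> (\<integral>\<^sup>+s. ennreal (norm (indicator {0..r} s *\<^sub>R (rate U c s - rate V c s))) \<partial>lborel)"
      using integral_norm_bound_ennreal[OF int[unfolded set_integrable_def]] by (simp add: set_lebesgue_integral_def)
    also have "\<dots> = rate_dist U V c r"
      unfolding rate_dist_def by (intro nn_integral_cong) (auto simp: indicator_def)
    finally show ?thesis .
  qed
  let ?J = "\<lambda>c. \<bar>jumps U c r \<omega> - jumps V c r \<omega>\<bar>"
  let ?D = "\<lambda>c. \<bar>(LINT s:{0..r}|lborel. rate U c s) - (LINT s:{0..r}|lborel. rate V c s)\<bar>"
  have "\<bar>drift U r - drift V r\<bar> \<le> h * (?D 1 + ?D (-1))"
    unfolding drift_def right_diff_distrib[symmetric] abs_mult using h_nonneg by (intro mult_mono) auto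
  then have "\<bar>\<Phi> U r \<omega> - \<Phi> V r \<omega>\<bar> \<le> (?J 1 + ?J (-1)) + h * (?D 1 + ?D (-1))"
    unfolding \<Phi>_def by linarith
  then have "ennreal \<bar>\<Phi> U r \<omega> - \<Phi> V r \<omega>\<bar> \<le> ennreal ((?J 1 + ?J (-1)) + h * (?D 1 + ?D (-1)))"
    by (rule ennreal_leI)
  also have "\<dots> = (ennreal (?J 1) + ennreal (?J (-1))) + ennreal h * (ennreal (?D 1) + ennreal (?D (-1)))"
    using h_nonneg by (simp add: ennreal_plus ennreal_mult)
  also have "\<dots> \<le> dominator U V r \<omega>"
    unfolding dominator_def by (intro add_mono mult_left_mono J D) auto
  also have "\<dots> \<le> dominator U V t \<omega>" by (rule dominator_mono) fact
  finally show ?thesis .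
qed

text \<open>As a function of the state a jump is discontinuous where the threshold crosses the mark;
  its integral over the marks is Lipschitz, and to the first power only. Hence the L1 distances
  throughout.\<close>

lemma jump_kernel_lipschitz:
  obtains C where "0 \<le> C" "\<And>c s x y. \<bar>c\<bar> = 1 \<Longrightarrow> s \<le> T \<Longrightarrow>
    (\<integral>\<^sup>+z. ennreal \<bar>jump c s x z - jump c s y z\<bar> * indicator {0..} z \<partial>lborel) \<le> ennreal (C * \<bar>clamp s x - clamp s y\<bar>)"
proof -
  obtain B C where BC: "0 \<le> B" "0 \<le> C" "\<And>c s x. \<bar>c\<bar> = 1 \<Longrightarrow> s \<le> T \<Longrightarrow> \<phi> (c * clamp s x) \<le> B"
    "\<And>c s x y. \<bar>c\<bar> = 1 \<Longrightarrow> s \<le> T \<Longrightarrow>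
      \<bar>\<phi> (c * clamp s x) - \<phi> (c * clamp s y)\<bar> \<le> C * \<bar>clamp s x - clamp s y\<bar>"
    using \<phi>_clamp_bounds[of T] by metis
  show thesis
  \<comment> \<open>B weighs the change of the jump size at a given rate, \<kappa> T times C the
    change of the rate at a jump size of at most \<kappa> T.\<close>
  proof (rule that[of "B + \<kappa> T * C"])
    show "0 \<le> B + \<kappa> T * C" using BC \<kappa>_nonneg[of T] by simp
    fix c s x y :: real assume c: "\<bar>c\<bar> = 1" "s \<le> T"
    let ?d = "\<bar>clamp s x - clamp s y\<bar>"
    have "(\<integral>\<^sup>+z. ennreal \<bar>jump c s x z - jump c s y z\<bar> * indicator {0..} z \<partial>lborel)
      \<le> ennreal (?d * \<phi> (c * clamp s x) + \<bar>clamp s y\<bar> * \<bar>\<phi> (c * clamp s x) - \<phi> (c * clamp s y)\<bar>)"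
      unfolding jump_def by (intro nn_integral_threshold_diff \<phi>_nonneg)
    also have "\<dots> \<le> ennreal (?d * B + \<kappa> T * (C * ?d))"
      using c BC \<kappa>_nonneg[of T] clamp_le' \<phi>_nonneg by (intro ennreal_leI add_mono mult_mono) auto
    also have "?d * B + \<kappa> T * (C * ?d) = (B + \<kappa> T * C) * ?d" by (simp add: algebra_simps)
    finally show "(\<integral>\<^sup>+z. ennreal \<bar>jump c s x z - jump c s y z\<bar> * indicator {0..} z \<partial>lborel)
      \<le> ennreal ((B + \<kappa> T * C) * ?d)" .
  qed
qed

text \<open>Compensation replaces the point process by Lebesgue measure. The mark integral, done
  first, is Lipschitz by hypothesis, and Tonelli then brings the expectation inside the time
  integral.\<close>

lemma nn_integral_jump_dist:
  assumes U: "cadlag_adapted U" and V: "cadlag_adapted V" and C: "0 \<le> C" "\<And>s x y. s \<le> t \<Longrightarrow>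
    (\<integral>\<^sup>+z. ennreal \<bar>jump c s x z - jump c s y z\<bar> * indicator {0..} z \<partial>lborel) \<le> ennreal (C * \<bar>clamp s x - clamp s y\<bar>)"
  shows "(\<integral>\<^sup>+\<omega>. jump_dist U V c t \<omega> \<partial>M) \<le> ennreal C *
    (\<integral>\<^sup>+s. (\<integral>\<^sup>+\<omega>. ennreal \<bar>clamp s (left_lim U \<omega> s) - clamp s (left_lim V \<omega> s)\<bar> \<partial>M) * indicator {0<..t} s \<partial>lborel)"
proof -
  interpret P: pair_sigma_finite M "lborel :: real measure" ..
  let ?j = "\<lambda>\<omega> s z. ennreal \<bar>jump c s (left_lim U \<omega> s) z - jump c s (left_lim V \<omega> s) z\<bar>"
  let ?d = "\<lambda>\<omega> s. ennreal \<bar>clamp s (left_lim U \<omega> s) - clamp s (left_lim V \<omega> s)\<bar>"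
  have j: "(\<lambda>x. ?j (fst x) (fst (snd x)) (snd (snd x)) * indicator {0<..t} (fst (snd x))) \<in> borel_measurable predictable"
    using jump_predictable[OF U, of c] jump_predictable[OF V, of c] by measurable
  have [measurable]: "(\<lambda>x. left_lim U (fst x) (snd x)) \<in> borel_measurable (M \<Otimes>\<^sub>M (lborel :: real measure))"
    "(\<lambda>x. left_lim V (fst x) (snd x)) \<in> borel_measurable (M \<Otimes>\<^sub>M (lborel :: real measure))"
    using left_lim_measurable_joint[OF U] left_lim_measurable_joint[OF V]
    by (simp_all add: measurable_cong_sets[OF sets_pair_measure_cong[OF refl sets_lborel] refl])
  have [measurable]: "(\<lambda>x. left_lim U (snd x) (fst x)) \<in> borel_measurable ((borel :: real measure) \<Otimes>\<^sub>M M)"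
    "(\<lambda>x. left_lim V (snd x) (fst x)) \<in> borel_measurable ((borel :: real measure) \<Otimes>\<^sub>M M)"
    using measurable_compose[OF measurable_pair_swap' left_lim_measurable_joint[OF U]]
      measurable_compose[OF measurable_pair_swap' left_lim_measurable_joint[OF V]] by (simp_all add: split_beta')
  have dm: "(\<lambda>s. (\<integral>\<^sup>+\<omega>. ?d \<omega> s \<partial>M) * indicator {0<..t} s) \<in> borel_measurable borel" by measurable
  have "(\<integral>\<^sup>+\<omega>. jump_dist U V c t \<omega> \<partial>M)
    = (\<integral>\<^sup>+\<omega>. \<integral>\<^sup>+p. ?j \<omega> (fst p) (snd p) * indicator {0<..t} (fst p) * indicator jump_region p \<partial>lborel \<partial>M)"
    unfolding jump_dist_def using compensator[OF j, of c] by simp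
  also have "\<dots> = (\<integral>\<^sup>+\<omega>. \<integral>\<^sup>+s. \<integral>\<^sup>+z. ?j \<omega> s z * indicator {0..} z * indicator {0<..t} s \<partial>lborel \<partial>lborel \<partial>M)"
  proof (rule nn_integral_cong)
    fix \<omega> assume \<omega>: "\<omega> \<in> space M"
    have m: "(\<lambda>p. ?j \<omega> (fst p) (snd p) * indicator {0<..t} (fst p) * indicator jump_region p) \<in> borel_measurable (lborel \<Otimes>\<^sub>M lborel)"
    proof -
      have [measurable]: "(\<lambda>p. ?j \<omega> (fst p) (snd p) * indicator {0<..t} (fst p)) \<in> borel_measurable borel"
        using predictable_section[OF j \<omega>] by simp
      have "(\<lambda>p. ?j \<omega> (fst p) (snd p) * indicator {0<..t} (fst p) * indicator jump_region p) \<in> borel_measurable borel"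
        by measurable
      then show ?thesis unfolding lborel_prod by simp
    qed
    have "(\<integral>\<^sup>+p. ?j \<omega> (fst p) (snd p) * indicator {0<..t} (fst p) * indicator jump_region p \<partial>lborel)
      = (\<integral>\<^sup>+s. \<integral>\<^sup>+z. ?j \<omega> s z * indicator {0<..t} s * indicator jump_region (s, z) \<partial>lborel \<partial>lborel)"
      using lborel.nn_integral_fst[OF m] by (simp add: lborel_prod)
    also have "\<dots> = (\<integral>\<^sup>+s. \<integral>\<^sup>+z. ?j \<omega> s z * indicator {0..} z * indicator {0<..t} s \<partial>lborel \<partial>lborel)"
      by (intro nn_integral_cong) (auto simp: indicator_def jump_region_def)
    finally show "(\<integral>\<^sup>+p. ?j \<omega> (fst p) (snd p) * indicator {0<..t} (fst p) * indicator jump_region p \<partial>lborel)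
      = (\<integral>\<^sup>+s. \<integral>\<^sup>+z. ?j \<omega> s z * indicator {0..} z * indicator {0<..t} s \<partial>lborel \<partial>lborel)" .
  qed
  also have "\<dots> \<le> (\<integral>\<^sup>+\<omega>. \<integral>\<^sup>+s. ennreal C * ?d \<omega> s * indicator {0<..t} s \<partial>lborel \<partial>M)"
  proof (intro nn_integral_mono)
    fix \<omega> s
    show "(\<integral>\<^sup>+z. ?j \<omega> s z * indicator {0..} z * indicator {0<..t} s \<partial>lborel) \<le> ennreal C * ?d \<omega> s * indicator {0<..t} s"
      using C by (cases "s \<in> {0<..t}") (auto simp: ennreal_mult'')
  qed
  also have "\<dots> = (\<integral>\<^sup>+s. \<integral>\<^sup>+\<omega>. ennreal C * ?d \<omega> s * indicator {0<..t} s \<partial>M \<partial>lborel)"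
    by (rule P.Fubini'[symmetric]) measurable
  also have "\<dots> = ennreal C * (\<integral>\<^sup>+s. (\<integral>\<^sup>+\<omega>. ?d \<omega> s \<partial>M) * indicator {0<..t} s \<partial>lborel)"
    using left_lim_measurable[OF U] left_lim_measurable[OF V] dm
    by (subst nn_integral_cmult[symmetric])
      (auto simp: nn_integral_cmult mult.assoc nn_integral_multc intro!: nn_integral_cong)
  finally show ?thesis .
qed

lemma rate_diff_le:
  assumes U: "cadlag_adapted U" and V: "cadlag_adapted V" and c: "\<bar>c\<bar> = 1" and s: "0 \<le> s"
    and C: "0 \<le> C" "\<And>x y. \<bar>\<phi> (c * clamp s x) - \<phi> (c * clamp s y)\<bar> \<le> C * \<bar>clamp s x - clamp s y\<bar>"
  shows "ennreal \<bar>rate U c s - rate V c s\<bar> \<le> ennreal C * (\<integral>\<^sup>+\<omega>. ennreal \<bar>clamp s (U s \<omega>) - clamp s (V s \<omega>)\<bar> \<partial>M)"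
proof -
  have [measurable]: "U s \<in> borel_measurable M" "V s \<in> borel_measurable M"
    using U V s by (auto intro: cadlag_adapted_measurable)
  have int: "integrable M (\<lambda>\<omega>. \<phi> (c * clamp s (U s \<omega>)) - \<phi> (c * clamp s (V s \<omega>)))"
    by (intro Bochner_Integration.integrable_diff \<phi>_clamp_integrable c) measurable
  have "rate U c s - rate V c s = (\<integral>\<omega>. \<phi> (c * clamp s (U s \<omega>)) - \<phi> (c * clamp s (V s \<omega>)) \<partial>M)"
    unfolding rate_def by (intro Bochner_Integration.integral_diff[symmetric] \<phi>_clamp_integrable c) measurable
  then have "ennreal \<bar>rate U c s - rate V c s\<bar> \<le> (\<integral>\<^sup>+\<omega>. ennreal \<bar>\<phi> (c * clamp s (U s \<omega>)) - \<phi> (c * clamp s (V s \<omega>))\<bar> \<partial>M)"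
    using integral_norm_bound_ennreal[OF int] by simp
  also have "\<dots> \<le> (\<integral>\<^sup>+\<omega>. ennreal C * ennreal \<bar>clamp s (U s \<omega>) - clamp s (V s \<omega>)\<bar> \<partial>M)"
    using C by (intro nn_integral_mono) (simp add: ennreal_leI flip: ennreal_mult)
  also have "\<dots> = ennreal C * (\<integral>\<^sup>+\<omega>. ennreal \<bar>clamp s (U s \<omega>) - clamp s (V s \<omega>)\<bar> \<partial>M)"
    by (intro nn_integral_cmult) measurable
  finally show ?thesis .
qed

text \<open>Rates involve the values of the processes, compensated jumps their left limits. Asking
  the same profile d for both avoids comparing the laws of the two; measuring clamped states keeps
  everything finite.\<close>

definition close :: "(real \<Rightarrow> 'a \<Rightarrow> real) \<Rightarrow> (real \<Rightarrow> 'a \<Rightarrow> real) \<Rightarrow> real \<Rightarrow> (real \<Rightarrow> ennreal) \<Rightarrow> bool" where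
  "close U V T d \<longleftrightarrow>
    (\<forall>s\<in>{0..T}. (\<integral>\<^sup>+\<omega>. ennreal \<bar>clamp s (U s \<omega>) - clamp s (V s \<omega>)\<bar> \<partial>M) \<le> d s) \<and>
    (\<forall>s\<in>{0<..T}. (\<integral>\<^sup>+\<omega>. ennreal \<bar>clamp s (left_lim U \<omega> s) - clamp s (left_lim V \<omega> s)\<bar> \<partial>M) \<le> d s)"

text \<open>The constant depends on T but not on the processes or the profile, so it stays fixed
  while the estimate is iterated.\<close>

lemma nn_integral_dominator:
  obtains C where "0 \<le> C" "\<And>U V d t. cadlag_adapted U \<Longrightarrow> cadlag_adapted V \<Longrightarrow> close U V T d \<Longrightarrow>
    d \<in> borel_measurable borel \<Longrightarrow> 0 \<le> t \<Longrightarrow> t \<le> T \<Longrightarrow>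
    (\<integral>\<^sup>+\<omega>. dominator U V t \<omega> \<partial>M) \<le> ennreal C * (\<integral>\<^sup>+s. d s * indicator {0..t} s \<partial>lborel)"
proof -
  obtain C1 where C1: "0 \<le> C1" "\<And>c s x y. \<bar>c\<bar> = 1 \<Longrightarrow> s \<le> T \<Longrightarrow>
    (\<integral>\<^sup>+z. ennreal \<bar>jump c s x z - jump c s y z\<bar> * indicator {0..} z \<partial>lborel) \<le> ennreal (C1 * \<bar>clamp s x - clamp s y\<bar>)"
    using jump_kernel_lipschitz[of T] by blast
  obtain B C2 where C2: "0 \<le> C2" "\<And>c s x y. \<bar>c\<bar> = 1 \<Longrightarrow> s \<le> T \<Longrightarrow>
      \<bar>\<phi> (c * clamp s x) - \<phi> (c * clamp s y)\<bar> \<le> C2 * \<bar>clamp s x - clamp s y\<bar>"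
    using \<phi>_clamp_bounds[of T] by metis
  show thesis
  \<comment> \<open>One C1 for the jumps of each sign and one h times C2 for the rate of each
    sign.\<close>
  proof (rule that[of "2 * C1 + 2 * h * C2"])
    show "0 \<le> 2 * C1 + 2 * h * C2" using C1 C2 h_nonneg by simp
    fix U V d t assume U: "cadlag_adapted U" and V: "cadlag_adapted V" and d: "close U V T d"
      and [measurable]: "d \<in> borel_measurable borel" and t: "0 \<le> t" "t \<le> T"
    let ?I = "\<integral>\<^sup>+s. d s * indicator {0..t} s \<partial>lborel"
    have J: "(\<integral>\<^sup>+\<omega>. jump_dist U V c t \<omega> \<partial>M) \<le> ennreal C1 * ?I" if c: "\<bar>c\<bar> = 1" for c
    proof -
      have "(\<integral>\<^sup>+\<omega>. jump_dist U V c t \<omega> \<partial>M) \<le> ennreal C1 *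
        (\<integral>\<^sup>+s. (\<integral>\<^sup>+\<omega>. ennreal \<bar>clamp s (left_lim U \<omega> s) - clamp s (left_lim V \<omega> s)\<bar> \<partial>M) * indicator {0<..t} s \<partial>lborel)"
        using C1 t c by (intro nn_integral_jump_dist U V) auto
      also have "\<dots> \<le> ennreal C1 * ?I"
        using d t unfolding close_def by (intro mult_left_mono nn_integral_mono) (auto simp: indicator_def)
      finally show ?thesis .
    qed
    have D: "rate_dist U V c t \<le> ennreal C2 * ?I" if c: "\<bar>c\<bar> = 1" for c
    proof -
      have "rate_dist U V c t \<le> (\<integral>\<^sup>+s. ennreal C2 * (d s * indicator {0..t} s) \<partial>lborel)"
        unfolding rate_dist_def
      proof (rule nn_integral_mono)
        fix s :: real
        show "ennreal \<bar>rate U c s - rate V c s\<bar> * indicator {0..t} s \<le> ennreal C2 * (d s * indicator {0..t} s)"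
        proof (cases "s \<in> {0..t}")
          case True
          have "ennreal \<bar>rate U c s - rate V c s\<bar> \<le> ennreal C2 * (\<integral>\<^sup>+\<omega>. ennreal \<bar>clamp s (U s \<omega>) - clamp s (V s \<omega>)\<bar> \<partial>M)"
            using True t C2 c by (intro rate_diff_le U V) auto
          also have "\<dots> \<le> ennreal C2 * d s" using d True t by (intro mult_left_mono) (auto simp: close_def)
          finally show ?thesis using True by simp
        qed simp
      qed
      also have "\<dots> = ennreal C2 * ?I" by (intro nn_integral_cmult) measurable
      finally show ?thesis .
    qed
    have m: "jump_dist U V c t \<in> borel_measurable M" for c
    proof -
      have "(\<lambda>x. ennreal \<bar>jump c (fst (snd x)) (left_lim U (fst x) (fst (snd x))) (snd (snd x))
        - jump c (fst (snd x)) (left_lim V (fst x) (fst (snd x))) (snd (snd x))\<bar> * indicator {0<..t} (fst (snd x)))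
        \<in> borel_measurable predictable"
        using jump_predictable[OF U, of c] jump_predictable[OF V, of c] by measurable
      from borel_measurable_nn_integral_N[OF this]
      show ?thesis unfolding jump_dist_def[abs_def] by simp
    qed
    have "(\<integral>\<^sup>+\<omega>. dominator U V t \<omega> \<partial>M) = ((\<integral>\<^sup>+\<omega>. jump_dist U V 1 t \<omega> \<partial>M) + (\<integral>\<^sup>+\<omega>. jump_dist U V (-1) t \<omega> \<partial>M))
      + ennreal h * (rate_dist U V 1 t + rate_dist U V (-1) t)"
      unfolding dominator_def using m by (simp add: nn_integral_add emeasure_space_1)
    also have "\<dots> \<le> (ennreal C1 * ?I + ennreal C1 * ?I) + ennreal h * (ennreal C2 * ?I + ennreal C2 * ?I)"
      by (intro add_mono mult_left_mono J D) auto
    also have "\<dots> = ((ennreal C1 + ennreal C1) + ennreal h * (ennreal C2 + ennreal C2)) * ?I"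
      by (simp only: distrib_right distrib_left mult.assoc)
    also have "(ennreal C1 + ennreal C1) + ennreal h * (ennreal C2 + ennreal C2) = ennreal ((C1 + C1) + h * (C2 + C2))"
      using C1(1) C2(1) h_nonneg by (simp only: ennreal_plus ennreal_mult add_nonneg_nonneg mult_nonneg_nonneg)
    also have "(C1 + C1) + h * (C2 + C2) = 2 * C1 + 2 * h * C2" by simp
    finally show "(\<integral>\<^sup>+\<omega>. dominator U V t \<omega> \<partial>M) \<le> ennreal (2 * C1 + 2 * h * C2) * ?I" .
  qed
qed

end

section \<open>Uniqueness for the truncated equation\<close>

lemma suminf_tail_tendsto_0:
  fixes f :: "nat \<Rightarrow> real"
  assumes "summable f"
  shows "(\<lambda>k. \<Sum>i. f (i + k)) \<longlonglongrightarrow> 0"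
proof -
  have "(\<lambda>k. suminf f - (\<Sum>i<k. f i)) \<longlonglongrightarrow> suminf f - suminf f"
    by (intro tendsto_intros summable_LIMSEQ assms)
  then show ?thesis using suminf_minus_initial_segment[OF assms] by simp
qed

lemma limit_of_summable_increments:
  fixes x \<delta> :: "nat \<Rightarrow> real"
  assumes \<delta>: "summable \<delta>" and x: "\<And>k. \<bar>x (Suc k) - x k\<bar> \<le> \<delta> k"
  shows "convergent x" and "\<bar>lim x - x k\<bar> \<le> (\<Sum>i. \<delta> (i + k))"
proof -
  let ?d = "\<lambda>k. x (Suc k) - x k"
  have abs: "summable (\<lambda>k. \<bar>?d k\<bar>)"
    using x by (intro summable_comparison_test'[OF \<delta>, of 0]) auto
  then have d: "summable ?d" by (rule summable_rabs_cancel)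
  have "(\<lambda>n. x 0 + (\<Sum>k<n. ?d k)) \<longlonglongrightarrow> x 0 + suminf ?d"
    by (intro tendsto_intros summable_LIMSEQ d)
  moreover have "x 0 + (\<Sum>k<n. ?d k) = x n" for n by (simp add: sum_lessThan_telescope)
  ultimately have lim: "x \<longlonglongrightarrow> x 0 + suminf ?d" by simp
  then show "convergent x" by (auto simp: convergent_def)
  have "lim x - x k = (\<Sum>i. ?d (i + k))"
    using suminf_minus_initial_segment[OF d, of k] limI[OF lim] by (simp add: sum_lessThan_telescope)
  also have "\<bar>\<dots>\<bar> \<le> (\<Sum>i. \<bar>?d (i + k)\<bar>)"
    by (intro summable_rabs summable_ignore_initial_segment abs)
  also have "\<dots> \<le> (\<Sum>i. \<delta> (i + k))"
    by (intro suminf_le x summable_ignore_initial_segment abs \<delta>)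
  finally show "\<bar>lim x - x k\<bar> \<le> (\<Sum>i. \<delta> (i + k))" .
qed

text \<open>Exchange of limits under uniform convergence. On the right the limits of the
  approximants are their values, which converge to u t. On the left the convergence of the one-sided
  limits has to be shown first; they inherit the uniform Cauchy property.\<close>

lemma cadlag_uniform_limit:
  fixes p :: "nat \<Rightarrow> real \<Rightarrow> real"
  assumes R: "\<And>n t. 0 \<le> t \<Longrightarrow> (p n \<longlongrightarrow> p n t) (at_right t)"
    and L: "\<And>n t. 0 < t \<Longrightarrow> \<exists>l. (p n \<longlongrightarrow> l) (at_left t)"
    and unif: "\<And>T. uniform_limit {0..T} p u sequentially"
  shows "0 \<le> t \<Longrightarrow> (u \<longlongrightarrow> u t) (at_right t)" and "0 < t \<Longrightarrow> \<exists>l. (u \<longlongrightarrow> l) (at_left t)"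
proof -
  assume t: "0 \<le> t"
  show "(u \<longlongrightarrow> u t) (at_right t)"
  proof (rule swap_uniform_limit'[OF _ _ unif[of "t + 1"]])
    show "\<forall>\<^sub>F n in sequentially. (p n \<longlongrightarrow> p n t) (at_right t)" using R[OF t] by simp
    show "(\<lambda>n. p n t) \<longlonglongrightarrow> u t" using t by (intro tendsto_uniform_limitI[OF unif[of t]]) auto
    show "\<forall>\<^sub>F x in at_right t. x \<in> {0..t + 1}"
      using t by (auto simp: eventually_at_right[OF less_add_one[of t]] intro!: exI[of _ "t + 1"])
  qed simp
next
  assume t: "0 < t"
  obtain g where g: "\<And>n. (p n \<longlongrightarrow> g n) (at_left t)" using L[OF t] by metis
  have ev: "\<forall>\<^sub>F x in at_left t. x \<in> {0..t}"
    using t by (auto simp: eventually_at_left[OF t] intro!: exI[of _ 0])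
  have "Cauchy g"
  proof (rule metric_CauchyI)
    fix e :: real assume e: "e > 0"
    have "uniformly_Cauchy_on {0..t} p"
      using unif by (auto simp: uniformly_convergent_eq_Cauchy[symmetric] uniformly_convergent_on_def)
    then obtain k where k: "\<And>x m n. x \<in> {0..t} \<Longrightarrow> m \<ge> k \<Longrightarrow> n \<ge> k \<Longrightarrow> dist (p m x) (p n x) < e / 2"
      using e unfolding uniformly_Cauchy_on_def by (metis half_gt_zero)
    have "dist (g m) (g n) \<le> e / 2" if "m \<ge> k" "n \<ge> k" for m n
    proof (rule tendsto_upperbound)
      show "((\<lambda>x. dist (p m x) (p n x)) \<longlongrightarrow> dist (g m) (g n)) (at_left t)"
        by (intro tendsto_dist g)
      show "\<forall>\<^sub>F x in at_left t. dist (p m x) (p n x) \<le> e / 2"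
        using ev by eventually_elim (use k that in \<open>auto intro: less_imp_le\<close>)
    qed simp
    then show "\<exists>k. \<forall>m\<ge>k. \<forall>n\<ge>k. dist (g m) (g n) < e"
      using e by (intro exI[of _ k]) (smt (verit) field_sum_of_halves)
  qed
  then obtain l where "g \<longlonglongrightarrow> l" by (auto simp: Cauchy_convergent_iff convergent_def)
  then have "(u \<longlongrightarrow> l) (at_left t)"
    using g ev by (intro swap_uniform_limit'[OF _ _ unif[of t], of g]) auto
  then show "\<exists>l. (u \<longlongrightarrow> l) (at_left t)" by blast
qed

context truncated_sde
begin

text \<open>Start of every iteration: clamped states differ by at most 2 \<kappa> T whatever the
  processes, so no integrability has to be known in advance.\<close>

lemma close_base: "close U V T (\<lambda>_. ennreal (2 * \<kappa> T))"
proof -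
  have *: "\<bar>clamp s x - clamp s y\<bar> \<le> 2 * \<kappa> T" if "s \<le> T" for s x y
    using clamp_le'[OF that, of x] clamp_le'[OF that, of y] by linarith
  have "(\<integral>\<^sup>+\<omega>. ennreal \<bar>clamp s (X \<omega>) - clamp s (Y \<omega>)\<bar> \<partial>M) \<le> ennreal (2 * \<kappa> T)" if "s \<le> T" for s X Y
  proof -
    have "(\<integral>\<^sup>+\<omega>. ennreal \<bar>clamp s (X \<omega>) - clamp s (Y \<omega>)\<bar> \<partial>M) \<le> (\<integral>\<^sup>+\<omega>. ennreal (2 * \<kappa> T) \<partial>M)"
      using *[OF that] by (intro nn_integral_mono ennreal_leI)
    then show ?thesis by (simp add: emeasure_space_1)
  qed
  then show ?thesis by (auto simp: close_def)
qed

text \<open>A quantity of time s that bounds the difference at all r \<le> s also bounds it in the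
  left limit at s. This is why a dominating process must control all earlier times and not just time
  s.\<close>

lemma close_transfer:
  assumes "cadlag_process M U" "cadlag_process M V"
    and le: "AE \<omega> in M. \<forall>r s. 0 \<le> r \<longrightarrow> r \<le> s \<longrightarrow> s \<le> T \<longrightarrow> ennreal \<bar>U r \<omega> - V r \<omega>\<bar> \<le> D s \<omega>"
    and d: "\<And>s. 0 \<le> s \<Longrightarrow> s \<le> T \<Longrightarrow> (\<integral>\<^sup>+\<omega>. D s \<omega> \<partial>M) \<le> d s"
  shows "close U V T d"
  unfolding close_def
proof (intro conjI ballI)
  fix s assume s: "s \<in> {0..T}"
  have "AE \<omega> in M. ennreal \<bar>clamp s (U s \<omega>) - clamp s (V s \<omega>)\<bar> \<le> D s \<omega>"
    using le
  proof eventually_elim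
    case (elim \<omega>)
    have "ennreal \<bar>clamp s (U s \<omega>) - clamp s (V s \<omega>)\<bar> \<le> ennreal \<bar>U s \<omega> - V s \<omega>\<bar>"
      by (intro ennreal_leI clamp_diff)
    also have "\<dots> \<le> D s \<omega>" using elim s by auto
    finally show ?case .
  qed
  then have "(\<integral>\<^sup>+\<omega>. ennreal \<bar>clamp s (U s \<omega>) - clamp s (V s \<omega>)\<bar> \<partial>M) \<le> (\<integral>\<^sup>+\<omega>. D s \<omega> \<partial>M)"
    by (rule nn_integral_mono_AE)
  also have "\<dots> \<le> d s" using d s by auto
  finally show "(\<integral>\<^sup>+\<omega>. ennreal \<bar>clamp s (U s \<omega>) - clamp s (V s \<omega>)\<bar> \<partial>M) \<le> d s" .
next
  fix s assume s: "s \<in> {0<..T}"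
  have "AE \<omega> in M. ennreal \<bar>clamp s (left_lim U \<omega> s) - clamp s (left_lim V \<omega> s)\<bar> \<le> D s \<omega>"
    using le AE_space
  proof eventually_elim
    case (elim \<omega>)
    show ?case
    proof (cases "D s \<omega>")
      case (real x)
      have "\<bar>left_lim U \<omega> s - left_lim V \<omega> s\<bar> \<le> x"
      proof (rule left_lim_diff_bounded[OF assms(1,2)])
        show "\<bar>U r \<omega> - V r \<omega>\<bar> \<le> x" if "0 \<le> r" "r < s" for r
          using elim(1) that s real by (metis ennreal_le_iff greaterThanAtMost_iff less_imp_le)
      qed (use elim s in auto)
      then have "\<bar>clamp s (left_lim U \<omega> s) - clamp s (left_lim V \<omega> s)\<bar> \<le> x"
        using clamp_diff order_trans by blast
      then show ?thesis using real by (simp add: ennreal_leI)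
    qed simp
  qed
  then have "(\<integral>\<^sup>+\<omega>. ennreal \<bar>clamp s (left_lim U \<omega> s) - clamp s (left_lim V \<omega> s)\<bar> \<partial>M) \<le> (\<integral>\<^sup>+\<omega>. D s \<omega> \<partial>M)"
    by (rule nn_integral_mono_AE)
  also have "\<dots> \<le> d s" using d s by auto
  finally show "(\<integral>\<^sup>+\<omega>. ennreal \<bar>clamp s (left_lim U \<omega> s) - clamp s (left_lim V \<omega> s)\<bar> \<partial>M) \<le> d s" .
qed

text \<open>Names the constant of \<open>nn_integral_dominator\<close>, so that one choice serves
  all rounds of an iteration.\<close>

definition dominator_const :: "real \<Rightarrow> real \<Rightarrow> bool" where
  "dominator_const T C \<longleftrightarrow> 0 \<le> C \<and> (\<forall>U V d t. cadlag_adapted U \<longrightarrow> cadlag_adapted V \<longrightarrow> close U V T d \<longrightarrow>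
    d \<in> borel_measurable borel \<longrightarrow> 0 \<le> t \<longrightarrow> t \<le> T \<longrightarrow>
    (\<integral>\<^sup>+\<omega>. dominator U V t \<omega> \<partial>M) \<le> ennreal C * (\<integral>\<^sup>+s. d s * indicator {0..t} s \<partial>lborel))"

lemma dominator_const_ex: "\<exists>C. dominator_const T C"
proof -
  obtain C where "0 \<le> C" "\<And>U V d t. cadlag_adapted U \<Longrightarrow> cadlag_adapted V \<Longrightarrow> close U V T d \<Longrightarrow>
    d \<in> borel_measurable borel \<Longrightarrow> 0 \<le> t \<Longrightarrow> t \<le> T \<Longrightarrow>
    (\<integral>\<^sup>+\<omega>. dominator U V t \<omega> \<partial>M) \<le> ennreal C * (\<integral>\<^sup>+s. d s * indicator {0..t} s \<partial>lborel)"
    using nn_integral_dominator[of T] by blast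
  then show ?thesis unfolding dominator_const_def by blast
qed

lemma dominator_constD:
  assumes "dominator_const T C" "cadlag_adapted U" "cadlag_adapted V" "close U V T d"
    "d \<in> borel_measurable borel" "0 \<le> t" "t \<le> T"
  shows "(\<integral>\<^sup>+\<omega>. dominator U V t \<omega> \<partial>M) \<le> ennreal C * (\<integral>\<^sup>+s. d s * indicator {0..t} s \<partial>lborel)"
  using assms unfolding dominator_const_def by blast

text \<open>The k-fold iterate of the map that sends f to C times its integral over [0, s], applied
  to the constant 2 \<kappa> T of \<open>close_base\<close>.\<close>

definition gronwall_bound :: "real \<Rightarrow> real \<Rightarrow> nat \<Rightarrow> real \<Rightarrow> real" where
  "gronwall_bound T C k s = 2 * \<kappa> T * (C * s) ^ k / fact k"

lemma gronwall_bound_nonneg: "0 \<le> C \<Longrightarrow> 0 \<le> s \<Longrightarrow> 0 \<le> gronwall_bound T C k s"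
  using \<kappa>_nonneg[of T] by (simp add: gronwall_bound_def)

lemma gronwall_bound_summable: "summable (\<lambda>k. gronwall_bound T C k s)"
proof -
  have "gronwall_bound T C k s = 2 * \<kappa> T * (inverse (fact k) * (C * s) ^ k)" for k
    by (simp add: gronwall_bound_def divide_inverse mult_ac)
  then show ?thesis by (simp only: summable_mult summable_exp)
qed

lemma gronwall_bound_step:
  assumes C: "dominator_const T C" and UV: "cadlag_adapted U" "cadlag_adapted V"
    and cl: "close U V T (\<lambda>s. ennreal (gronwall_bound T C k s))" and t: "0 \<le> t" "t \<le> T"
  shows "(\<integral>\<^sup>+\<omega>. dominator U V t \<omega> \<partial>M) \<le> ennreal (gronwall_bound T C (Suc k) t)"
proof -
  let ?F = "\<lambda>s. 2 * \<kappa> T * C ^ k * s ^ Suc k / fact (Suc k)"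
  have C0: "0 \<le> C" using C by (simp add: dominator_const_def)
  have "(\<integral>\<^sup>+s. ennreal (gronwall_bound T C k s) * indicator {0..t} s \<partial>lborel) = ennreal (?F t - ?F 0)"
  proof (rule nn_integral_FTC_Icc)
    fix s :: real assume s: "s \<in> {0..t}"
    have "((\<lambda>s. s ^ Suc k) has_real_derivative real (Suc k) * s ^ k) (at s)"
      using DERIV_pow[of "Suc k" s] by simp
    then have "(?F has_real_derivative 2 * \<kappa> T * C ^ k * (real (Suc k) * s ^ k) / fact (Suc k)) (at s)"
      by (intro DERIV_cdivide DERIV_cmult)
    also have "2 * \<kappa> T * C ^ k * (real (Suc k) * s ^ k) / fact (Suc k) = gronwall_bound T C k s"
      by (simp add: gronwall_bound_def power_mult_distrib fact_Suc del: of_nat_Suc)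
    finally show "(?F has_real_derivative gronwall_bound T C k s) (at s)" .
    show "0 \<le> gronwall_bound T C k s" using s C0 by (intro gronwall_bound_nonneg) auto
  qed (use t in \<open>auto simp: gronwall_bound_def\<close>)
  moreover have "(\<integral>\<^sup>+\<omega>. dominator U V t \<omega> \<partial>M) \<le> ennreal C *
    (\<integral>\<^sup>+s. ennreal (gronwall_bound T C k s) * indicator {0..t} s \<partial>lborel)"
    using t by (intro dominator_constD[OF C UV cl]) (auto simp: gronwall_bound_def)
  moreover have "C * (?F t - ?F 0) = gronwall_bound T C (Suc k) t"
    by (simp add: gronwall_bound_def power_mult_distrib mult_ac del: fact_Suc)
  ultimately show ?thesis using C0 by (metis ennreal_mult')
qed

text \<open>Gronwall's argument by iteration: each round passes from the k-th to the next iterated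
  integral, and these tend to 0. So the mean of the dominator at time n vanishes; where the
  dominator itself vanishes, the processes agree at all times up to n, so that one null set per n
  suffices.\<close>

lemma fixed_point_unique:
  assumes U: "cadlag_adapted U" and V: "cadlag_adapted V"
    and eqU: "AE \<omega> in M. \<forall>t\<ge>0. U t \<omega> = \<Phi> U t \<omega>" and eqV: "AE \<omega> in M. \<forall>t\<ge>0. V t \<omega> = \<Phi> V t \<omega>"
  shows "AE \<omega> in M. \<forall>t\<ge>0. U t \<omega> = V t \<omega>"
proof -
  have le: "AE \<omega> in M. \<forall>r s. 0 \<le> r \<longrightarrow> r \<le> s \<longrightarrow> ennreal \<bar>U r \<omega> - V r \<omega>\<bar> \<le> dominator U V s \<omega>"
    using eqU eqV AE_space by eventually_elim (use dominator[OF U V] in auto)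
  have "AE \<omega> in M. \<forall>t. 0 \<le> t \<longrightarrow> t \<le> real n \<longrightarrow> U t \<omega> = V t \<omega>" for n
  proof -
    obtain C where C: "dominator_const (real n) C" using dominator_const_ex by blast
    have cl: "close U V (real n) (\<lambda>s. ennreal (gronwall_bound (real n) C k s))" for k
    proof (induction k)
      case 0
      show ?case using close_base[of U V "real n"] by (simp add: gronwall_bound_def)
    next
      case (Suc k)
      show ?case
      proof (rule close_transfer[where D="dominator U V"])
        show "AE \<omega> in M. \<forall>r s. 0 \<le> r \<longrightarrow> r \<le> s \<longrightarrow> s \<le> real n \<longrightarrow> ennreal \<bar>U r \<omega> - V r \<omega>\<bar> \<le> dominator U V s \<omega>"
          using le by eventually_elim auto
      qed (use U V gronwall_bound_step[OF C U V Suc] in \<open>auto simp: cadlag_adaptedD\<close>)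
    qed
    have "(\<integral>\<^sup>+\<omega>. dominator U V (real n) \<omega> \<partial>M) \<le> 0"
    proof (rule LIMSEQ_le_const)
      show "(\<lambda>k. ennreal (gronwall_bound (real n) C (Suc k) (real n))) \<longlonglongrightarrow> 0"
        using tendsto_ennrealI[OF LIMSEQ_Suc[OF summable_LIMSEQ_zero[OF gronwall_bound_summable[of "real n" C "real n"]]]] by simp
      show "\<exists>N. \<forall>k\<ge>N. (\<integral>\<^sup>+\<omega>. dominator U V (real n) \<omega> \<partial>M) \<le> ennreal (gronwall_bound (real n) C (Suc k) (real n))"
        using gronwall_bound_step[OF C U V cl] by auto
    qed
    then have "AE \<omega> in M. dominator U V (real n) \<omega> = 0"
      using nn_integral_0_iff_AE[OF dominator_measurable[OF U V]] by simp
    then show ?thesis using le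
      by eventually_elim (metis abs_le_zero_iff ennreal_le_iff ennreal_zero_less_top eq_iff_diff_eq_0 ennreal_0 order_refl)
  qed
  then have "AE \<omega> in M. \<forall>n. \<forall>t. 0 \<le> t \<longrightarrow> t \<le> real n \<longrightarrow> U t \<omega> = V t \<omega>" by (simp add: AE_all_countable)
  then show ?thesis by eventually_elim (meson real_arch_simple)
qed

lemma drift_continuous:
  assumes U: "cadlag_adapted U"
  shows "continuous_on {0..T} (drift U)"
proof -
  have "continuous_on {0..T} (\<lambda>t. LINT s:{0..t}|lborel. rate U c s)" if c: "\<bar>c\<bar> = 1" for c
  proof -
    have "continuous_on {0..T} (\<lambda>t. integral {0..t} (rate U c))"
      by (intro indefinite_integral_continuous_1 set_borel_integral_eq_integral(1) rate_integrable U c)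
    then show ?thesis
      using set_borel_integral_eq_integral(2)[OF rate_integrable[OF U c]] by simp
  qed
  then show ?thesis unfolding drift_def[abs_def] by (intro continuous_intros) auto
qed

text \<open>Dominated convergence with the modulus of the jumps up to T as majorant. The limit set P
  is left open to serve both sides: decreasing times give \<open>{..t}\<close>, increasing ones
  \<open>{..<t}\<close>.\<close>

lemma jumps_tendsto:
  assumes U: "cadlag_adapted U" and \<omega>: "\<omega> \<in> space M" and c: "\<bar>c\<bar> = 1"
    and r: "\<And>n. r n \<le> T" and P: "P \<in> sets borel"
    and lim: "\<And>s. 0 < s \<Longrightarrow> (\<lambda>n. indicator {..r n} s :: real) \<longlonglongrightarrow> indicator P s"
  shows "(\<lambda>n. jumps U c (r n) \<omega>) \<longlonglongrightarrow>
    (\<integral>p. (if 0 < fst p \<and> fst p \<in> P then jump c (fst p) (left_lim U \<omega> (fst p)) (snd p) else 0) \<partial>N c \<omega>)"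
  unfolding jumps_def
proof (rule integral_dominated_convergence[where w="\<lambda>p. \<bar>if 0 < fst p \<and> fst p \<le> T
      then jump c (fst p) (left_lim U \<omega> (fst p)) (snd p) else 0\<bar>"])
  have m1[measurable]: "(\<lambda>p. jump c (fst p) (left_lim U \<omega> (fst p)) (snd p)) \<in> borel_measurable (N c \<omega>)"
    using jump_path_measurable[OF U \<omega>] by (simp cong: measurable_cong_sets)
  have m2[measurable]: "fst \<in> borel_measurable (N c \<omega>)"
    by (subst measurable_cong_sets[OF sets_N refl]) (simp add: borel_prod[symmetric])
  show "(\<lambda>p. if 0 < fst p \<and> fst p \<in> P then jump c (fst p) (left_lim U \<omega> (fst p)) (snd p) else 0) \<in> borel_measurable (N c \<omega>)"
    using P by measurable
  show "(\<lambda>p. if 0 < fst p \<and> fst p \<le> r n then jump c (fst p) (left_lim U \<omega> (fst p)) (snd p) else 0) \<in> borel_measurable (N c \<omega>)" for n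
    by measurable
  show "integrable (N c \<omega>) (\<lambda>p. \<bar>if 0 < fst p \<and> fst p \<le> T then jump c (fst p) (left_lim U \<omega> (fst p)) (snd p) else 0\<bar>)"
    by (intro integrable_abs jumps_integrable U \<omega> c)
  show "AE p in N c \<omega>. (\<lambda>n. if 0 < fst p \<and> fst p \<le> r n then jump c (fst p) (left_lim U \<omega> (fst p)) (snd p) else 0)
    \<longlonglongrightarrow> (if 0 < fst p \<and> fst p \<in> P then jump c (fst p) (left_lim U \<omega> (fst p)) (snd p) else 0)"
  proof (rule AE_I2)
    fix p :: "real \<times> real"
    let ?j = "jump c (fst p) (left_lim U \<omega> (fst p)) (snd p)"
    show "(\<lambda>n. if 0 < fst p \<and> fst p \<le> r n then ?j else 0) \<longlonglongrightarrow> (if 0 < fst p \<and> fst p \<in> P then ?j else 0)"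
    proof (cases "0 < fst p")
      case True
      from tendsto_mult_right[OF lim[OF True], of ?j]
      have "(\<lambda>n. indicator {..r n} (fst p) * ?j) \<longlonglongrightarrow> indicator P (fst p) * ?j" .
      also have "(\<lambda>n. indicator {..r n} (fst p) * ?j) = (\<lambda>n. if 0 < fst p \<and> fst p \<le> r n then ?j else 0)"
        using True by (auto simp: indicator_def)
      finally show ?thesis using True by (cases "fst p \<in> P") simp_all
    qed simp
  qed
  show "AE p in N c \<omega>. norm (if 0 < fst p \<and> fst p \<le> r n then jump c (fst p) (left_lim U \<omega> (fst p)) (snd p) else 0)
    \<le> \<bar>if 0 < fst p \<and> fst p \<le> T then jump c (fst p) (left_lim U \<omega> (fst p)) (snd p) else 0\<bar>" for n
    using r[of n] by (intro AE_I2) auto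
qed

lemma cadlag_\<Phi>:
  assumes U: "cadlag_adapted U"
  shows "cadlag_process M (\<Phi> U)"
  unfolding cadlag_process_def
proof (intro ballI allI impI conjI)
  fix \<omega> t assume \<omega>: "\<omega> \<in> space M" and t: "(0::real) \<le> t"
  have J: "((\<lambda>r. jumps U c r \<omega>) \<longlongrightarrow> jumps U c t \<omega>) (at_right t)" if c: "\<bar>c\<bar> = 1" for c
  proof (rule tendsto_at_right_sequentially[of t "t + 1"])
    fix S assume S: "\<And>n. t < S n" "\<And>n. S n < t + 1" "decseq S" "S \<longlonglongrightarrow> t"
    have "(\<lambda>n. indicator {..S n} s :: real) \<longlonglongrightarrow> indicator {..t} s" if "0 < s" for s
    proof (cases "s \<le> t")
      case True
      then have "s \<le> S n" for n using S(1)[of n] by simp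
      then show ?thesis using True by (simp add: indicator_def)
    next
      case False
      then have "eventually (\<lambda>n. S n < s) sequentially" using order_tendstoD(2)[OF S(4)] by simp
      then have "eventually (\<lambda>n. indicator {..S n} s = (0::real)) sequentially"
        by eventually_elim simp
      then show ?thesis using False by (simp add: tendsto_eventually)
    qed
    from jumps_tendsto[OF U \<omega> c _ _ this, of "t + 1"]
    show "(\<lambda>n. jumps U c (S n) \<omega>) \<longlonglongrightarrow> jumps U c t \<omega>"
      using S(2) by (simp add: jumps_def less_imp_le)
  qed simp
  have D: "(drift U \<longlongrightarrow> drift U t) (at_right t)"
  proof -
    have "continuous_on {t..t + 1} (drift U)"
      using drift_continuous[OF U, of "t + 1"] t by (rule_tac continuous_on_subset) auto
    then have "(drift U \<longlongrightarrow> drift U t) (at t within {t..t + 1})" by (auto simp: continuous_on)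
    then show ?thesis by (simp add: at_within_Icc_at_right)
  qed
  show "continuous (at_right t) (\<lambda>r. \<Phi> U r \<omega>)"
    unfolding continuous_within \<Phi>_def by (intro tendsto_intros J D) auto
next
  fix \<omega> t assume \<omega>: "\<omega> \<in> space M" and t: "(0::real) < t"
  have J: "\<exists>l. ((\<lambda>r. jumps U c r \<omega>) \<longlongrightarrow> l) (at_left t)" if c: "\<bar>c\<bar> = 1" for c
  proof (rule exI, rule tendsto_at_left_sequentially[of 0])
    fix S assume S: "\<And>n. S n < t" "\<And>n. 0 < S n" "incseq S" "S \<longlonglongrightarrow> t"
    have "(\<lambda>n. indicator {..S n} s :: real) \<longlonglongrightarrow> indicator {..<t} s" if "0 < s" for s
    proof (cases "s < t")
      case True
      then have "eventually (\<lambda>n. s < S n) sequentially" using order_tendstoD(1)[OF S(4)] by simp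
      then have "eventually (\<lambda>n. indicator {..S n} s = (1::real)) sequentially"
        by eventually_elim simp
      then show ?thesis using True by (simp add: tendsto_eventually)
    next
      case False
      then have "\<not> s \<le> S n" for n using S(1)[of n] by simp
      then show ?thesis using False by (simp add: indicator_def)
    qed
    from jumps_tendsto[OF U \<omega> c _ _ this, of t]
    show "(\<lambda>n. jumps U c (S n) \<omega>) \<longlonglongrightarrow> (\<integral>p. (if 0 < fst p \<and> fst p \<in> {..<t} then jump c (fst p) (left_lim U \<omega> (fst p)) (snd p) else 0) \<partial>N c \<omega>)"
      using S(1) by (simp add: less_imp_le)
  qed (use t in simp)
  obtain l1 l2 where l: "((\<lambda>r. jumps U 1 r \<omega>) \<longlongrightarrow> l1) (at_left t)" "((\<lambda>r. jumps U (-1) r \<omega>) \<longlongrightarrow> l2) (at_left t)"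
    using J[of 1] J[of "-1"] by auto
  have D: "(drift U \<longlongrightarrow> drift U t) (at_left t)"
  proof -
    have "(drift U \<longlongrightarrow> drift U t) (at t within {0..t})"
      using drift_continuous[OF U, of t] t by (auto simp: continuous_on)
    then show ?thesis using t by (simp add: at_within_Icc_at_left)
  qed
  have "((\<lambda>r. \<Phi> U r \<omega>) \<longlongrightarrow> U0 \<omega> - (l1 + l2) + drift U t) (at_left t)"
    unfolding \<Phi>_def by (intro tendsto_intros l D)
  then show "\<exists>l. ((\<lambda>r. \<Phi> U r \<omega>) \<longlongrightarrow> l) (at_left t)" by blast
qed

end

section \<open>Picard iteration\<close>

text \<open>Existence asks more of the filtration than uniqueness: \<open>\<Phi>\<close> must turn
  adapted processes into adapted ones, and null sets must be known at time 0, so that the limit can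
  be redefined where the iteration fails to converge.\<close>

locale adapted_truncated_sde = truncated_sde M F N \<phi> \<kappa> h U0
  for M :: "'a measure" and F :: "real \<Rightarrow> 'a measure" and N :: "real \<Rightarrow> 'a \<Rightarrow> (real \<times> real) measure"
    and \<phi> \<kappa> :: "real \<Rightarrow> real" and h :: real and U0 :: "'a \<Rightarrow> real" +
  assumes N_adapted: "\<And>c t A. 0 \<le> t \<Longrightarrow> A \<in> sets borel \<Longrightarrow> A \<subseteq> {..t} \<times> UNIV \<Longrightarrow>
      (\<lambda>\<omega>. emeasure (N c \<omega>) A) \<in> borel_measurable (F t)"
    and U0_adapted: "U0 \<in> borel_measurable (F 0)"
    and null_sets_F: "\<And>A. A \<in> null_sets M \<Longrightarrow> A \<in> sets (F 0)"
begin

text \<open>A second induction over the predictable generators, now for adaptedness. A generator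
  starting at s \<le> t contributes an event of \<open>F t\<close> times a past count; one starting
  after t has no points up to t.\<close>

lemma past_emeasure_adapted:
  assumes X: "X \<in> sets predictable" and t: "0 \<le> t"
  shows "(\<lambda>\<omega>. emeasure (N c \<omega>) (Pair \<omega> -` X \<inter> ({..t} \<times> UNIV) \<inter> jump_box n)) \<in> borel_measurable (F t)"
proof -
  let ?Q = "({..t} \<times> UNIV) \<inter> jump_box n :: (real \<times> real) set"
  have Q[measurable]: "?Q \<in> sets borel"
  proof -
    have "{..t} \<times> (UNIV :: real set) \<in> sets borel" by (intro borel_Times) auto
    then show ?thesis by auto
  qed
  have sec: "Pair \<omega> -` X \<inter> ?Q \<in> sets borel" if "X \<in> sets predictable" for X \<omega>
    using predictable_set_section[OF that] Q by blast
  have NQ: "(\<lambda>\<omega>. emeasure (N c \<omega>) ?Q) \<in> borel_measurable (F t)"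
    by (intro N_adapted t Q) auto
  have less: "emeasure (N c \<omega>) (Pair \<omega> -` X \<inter> ?Q) < \<infinity>" if "\<omega> \<in> space M" "X \<in> sets predictable" for X \<omega>
    using that by (intro le_less_trans[OF emeasure_mono N_fin[of \<omega> c n]]) auto
  have "(\<lambda>\<omega>. emeasure (N c \<omega>) (Pair \<omega> -` X \<inter> ?Q)) \<in> borel_measurable (F t)"
    using Int_stable_pred_gen pred_gen_Pow X[unfolded sets_predictable]
  proof (induction rule: sigma_sets_induct_disjoint)
    case (basic X)
    then obtain A B s where X: "X = A \<times> B" "A \<in> sets (F (max 0 s))" "B \<in> sets borel" "B \<subseteq> {s<..} \<times> UNIV"
      unfolding pred_gen_def by blast
    show ?case
    proof (cases "s \<le> t")
      case True
      then have [measurable]: "A \<in> sets (F t)" using X F_mono[of "max 0 s" t] t by auto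
      have [measurable]: "(\<lambda>\<omega>. emeasure (N c \<omega>) (B \<inter> ?Q)) \<in> borel_measurable (F t)"
        using X Q by (intro N_adapted t) auto
      have "emeasure (N c \<omega>) (Pair \<omega> -` X \<inter> ?Q) = indicator A \<omega> * emeasure (N c \<omega>) (B \<inter> ?Q)" for \<omega>
        by (auto simp: X indicator_def)
      then show ?thesis by simp
    next
      case False
      then have "Pair \<omega> -` X \<inter> ?Q = {}" for \<omega> using X by fastforce
      then show ?thesis by simp
    qed
  next
    case empty
    then show ?case by simp
  next
    case (compl X)
    then have X: "X \<in> sets predictable" by (simp add: sets_predictable)
    have [measurable]: "(\<lambda>\<omega>. emeasure (N c \<omega>) (Pair \<omega> -` X \<inter> ?Q)) \<in> borel_measurable (F t)" by fact
    note NQ[measurable]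
    show ?case
    proof (rule measurable_cong[THEN iffD2])
      fix \<omega> assume "\<omega> \<in> space (F t)"
      then have \<omega>: "\<omega> \<in> space M" using space_F[OF t] by simp
      have "Pair \<omega> -` (space M \<times> UNIV - X) \<inter> ?Q = ?Q - (Pair \<omega> -` X \<inter> ?Q)" using \<omega> by auto
      then show "emeasure (N c \<omega>) (Pair \<omega> -` (space M \<times> UNIV - X) \<inter> ?Q)
        = emeasure (N c \<omega>) ?Q - emeasure (N c \<omega>) (Pair \<omega> -` X \<inter> ?Q)"
        using sec[OF X, of \<omega>] Q less[OF \<omega> X] by (simp only:) (rule emeasure_Diff, auto)
    qed measurable
  next
    case (union X)
    then have X: "X i \<in> sets predictable" for i by (auto simp: sets_predictable)
    have [measurable]: "(\<lambda>\<omega>. emeasure (N c \<omega>) (Pair \<omega> -` X i \<inter> ?Q)) \<in> borel_measurable (F t)" for i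
      using union by blast
    have "emeasure (N c \<omega>) (Pair \<omega> -` (\<Union>i. X i) \<inter> ?Q) = (\<Sum>i. emeasure (N c \<omega>) (Pair \<omega> -` X i \<inter> ?Q))" for \<omega>
    proof -
      have "(\<Sum>i. emeasure (N c \<omega>) (Pair \<omega> -` X i \<inter> ?Q)) = emeasure (N c \<omega>) (\<Union>i. Pair \<omega> -` X i \<inter> ?Q)"
      proof (rule suminf_emeasure)
        show "disjoint_family (\<lambda>i. Pair \<omega> -` X i \<inter> ?Q)"
          using union(1) unfolding disjoint_family_on_def by blast
      qed (use sec[OF X] in auto)
      also have "(\<Union>i. Pair \<omega> -` X i \<inter> ?Q) = Pair \<omega> -` (\<Union>i. X i) \<inter> ?Q" by auto
      finally show ?thesis by simp
    qed
    then show ?case by simp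
  qed
  then show ?thesis by (simp add: Int_assoc)
qed

lemma nn_integral_adapted:
  assumes H: "H \<in> borel_measurable predictable" and t: "0 \<le> t"
  shows "(\<lambda>\<omega>. \<integral>\<^sup>+p. H (\<omega>, p) * indicator {..t} (fst p) \<partial>N c \<omega>) \<in> borel_measurable (F t)"
  using H
proof (induction rule: borel_measurable_induct)
  case (cong f g)
  have "(\<integral>\<^sup>+p. f (\<omega>, p) * indicator {..t} (fst p) \<partial>N c \<omega>) = (\<integral>\<^sup>+p. g (\<omega>, p) * indicator {..t} (fst p) \<partial>N c \<omega>)"
    if "\<omega> \<in> space (F t)" for \<omega>
    using cong(3) that t by (auto intro!: nn_integral_cong simp: space_F)
  then show ?case using cong(4) by (simp cong: measurable_cong)
next
  case (set A)
  have P: "{..t} \<times> (UNIV :: real set) \<in> sets borel" by (intro borel_Times) auto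
  have s: "Pair \<omega> -` A \<inter> ({..t} \<times> UNIV) \<in> sets borel" for \<omega>
    using predictable_set_section[OF set, of \<omega>] P by blast
  have "indicator A (\<omega>, p) * indicator {..t} (fst p) = (indicator (Pair \<omega> -` A \<inter> ({..t} \<times> UNIV)) p :: ennreal)" for \<omega> p
    by (cases p) (auto simp: indicator_def)
  then have "(\<integral>\<^sup>+p. indicator A (\<omega>, p) * indicator {..t} (fst p) \<partial>N c \<omega>)
    = (SUP n. emeasure (N c \<omega>) (Pair \<omega> -` A \<inter> ({..t} \<times> UNIV) \<inter> jump_box n))" for \<omega>
    using emeasure_N_eq_SUP[OF s[of \<omega>], of c \<omega>] s[of \<omega>] by simp
  then show ?case using past_emeasure_adapted[OF set t] by simp
next
  case (mult u a)
  have [measurable]: "(\<lambda>\<omega>. \<integral>\<^sup>+p. u (\<omega>, p) * indicator {..t} (fst p) \<partial>N c \<omega>) \<in> borel_measurable (F t)" by fact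
  have [measurable]: "(\<lambda>p. u (\<omega>, p)) \<in> borel_measurable borel" if "\<omega> \<in> space M" for \<omega>
    using predictable_section[OF mult(2) that] .
  have [measurable]: "fst \<in> borel_measurable (borel :: (real \<times> real) measure)" by (simp add: borel_prod[symmetric])
  show ?case
  proof (rule measurable_cong[THEN iffD2])
    fix \<omega> assume "\<omega> \<in> space (F t)"
    then have [simp]: "\<omega> \<in> space M" using t by (simp add: space_F)
    show "(\<integral>\<^sup>+p. a * u (\<omega>, p) * indicator {..t} (fst p) \<partial>N c \<omega>) = a * (\<integral>\<^sup>+p. u (\<omega>, p) * indicator {..t} (fst p) \<partial>N c \<omega>)"
      by (simp add: mult.assoc nn_integral_cmult)
  qed measurable
next
  case (add u v)
  have [measurable]: "(\<lambda>\<omega>. \<integral>\<^sup>+p. u (\<omega>, p) * indicator {..t} (fst p) \<partial>N c \<omega>) \<in> borel_measurable (F t)"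
    "(\<lambda>\<omega>. \<integral>\<^sup>+p. v (\<omega>, p) * indicator {..t} (fst p) \<partial>N c \<omega>) \<in> borel_measurable (F t)" by fact+
  have [measurable]: "(\<lambda>p. u (\<omega>, p)) \<in> borel_measurable borel" "(\<lambda>p. v (\<omega>, p)) \<in> borel_measurable borel" if "\<omega> \<in> space M" for \<omega>
    using predictable_section[OF add(1) that] predictable_section[OF add(3) that] by auto
  have [measurable]: "fst \<in> borel_measurable (borel :: (real \<times> real) measure)" by (simp add: borel_prod[symmetric])
  show ?case
  proof (rule measurable_cong[THEN iffD2])
    fix \<omega> assume "\<omega> \<in> space (F t)"
    then have [simp]: "\<omega> \<in> space M" using t by (simp add: space_F)
    show "(\<integral>\<^sup>+p. (v (\<omega>, p) + u (\<omega>, p)) * indicator {..t} (fst p) \<partial>N c \<omega>)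
      = (\<integral>\<^sup>+p. v (\<omega>, p) * indicator {..t} (fst p) \<partial>N c \<omega>) + (\<integral>\<^sup>+p. u (\<omega>, p) * indicator {..t} (fst p) \<partial>N c \<omega>)"
      by (simp add: distrib_right nn_integral_add)
  qed measurable
next
  case (seq U)
  have [measurable]: "(\<lambda>\<omega>. \<integral>\<^sup>+p. U i (\<omega>, p) * indicator {..t} (fst p) \<partial>N c \<omega>) \<in> borel_measurable (F t)" for i by fact
  have [measurable]: "(\<lambda>p. U i (\<omega>, p)) \<in> borel_measurable borel" if "\<omega> \<in> space M" for i \<omega>
    using predictable_section[OF seq(1) that] .
  have [measurable]: "fst \<in> borel_measurable (borel :: (real \<times> real) measure)" by (simp add: borel_prod[symmetric])
  have ap: "(SUP i. U i) x = (SUP i. U i x)" for x by (simp add: image_comp)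
  show ?case unfolding ap
  proof (rule measurable_cong[THEN iffD2])
    fix \<omega> assume "\<omega> \<in> space (F t)"
    then have [simp]: "\<omega> \<in> space M" using t by (simp add: space_F)
    have inc: "incseq (\<lambda>i p. U i (\<omega>, p) * indicator {..t} (fst p))"
      using seq(3) by (auto simp: incseq_def le_fun_def intro!: mult_right_mono)
    show "(\<integral>\<^sup>+p. (SUP i. U i (\<omega>, p)) * indicator {..t} (fst p) \<partial>N c \<omega>)
      = (SUP i. \<integral>\<^sup>+p. U i (\<omega>, p) * indicator {..t} (fst p) \<partial>N c \<omega>)"
      using inc by (simp add: nn_integral_monotone_convergence_SUP[symmetric] SUP_mult_right_ennreal)
  qed measurable
qed

lemma jumps_adapted:
  assumes U: "cadlag_adapted U" and t: "0 \<le> t" and c: "\<bar>c\<bar> = 1"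
  shows "jumps U c t \<in> borel_measurable (F t)"
proof -
  let ?j = "\<lambda>\<omega> p. jump c (fst p) (left_lim U \<omega> (fst p)) (snd p)"
  \<comment> \<open>Conversion to \<open>ennreal\<close> cuts off negative values, so b = 1 and b =
    -1 give the positive and the negative part of the integrand.\<close>
  have m: "(\<lambda>x. ennreal (b * jump c (fst (snd x)) (left_lim U (fst x) (fst (snd x))) (snd (snd x))) * indicator {0<..} (fst (snd x)))
    \<in> borel_measurable predictable" for b
    using jump_predictable[OF U, of c] by measurable
  have [measurable]: "(\<lambda>\<omega>. \<integral>\<^sup>+p. ennreal (b * ?j \<omega> p) * indicator {0<..} (fst p) * indicator {..t} (fst p) \<partial>N c \<omega>) \<in> borel_measurable (F t)" for b
    using nn_integral_adapted[OF m[of b] t, of c] by simp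
  show ?thesis
  proof (rule measurable_cong[THEN iffD2])
    fix \<omega> assume "\<omega> \<in> space (F t)"
    then have \<omega>: "\<omega> \<in> space M" using t by (simp add: space_F)
    have eq: "ennreal (b * (if 0 < fst p \<and> fst p \<le> t then ?j \<omega> p else 0))
      = ennreal (b * ?j \<omega> p) * indicator {0<..} (fst p) * indicator {..t} (fst p)" for p b
      by (auto simp: indicator_def)
    show "jumps U c t \<omega> = enn2real (\<integral>\<^sup>+p. ennreal (1 * ?j \<omega> p) * indicator {0<..} (fst p) * indicator {..t} (fst p) \<partial>N c \<omega>)
      - enn2real (\<integral>\<^sup>+p. ennreal (-1 * ?j \<omega> p) * indicator {0<..} (fst p) * indicator {..t} (fst p) \<partial>N c \<omega>)"
      unfolding jumps_def real_lebesgue_integral_def[OF jumps_integrable[OF U \<omega> c, of t]] eq[symmetric] by simp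
  qed measurable
qed

lemma cadlag_adapted_\<Phi>:
  assumes U: "cadlag_adapted U"
  shows "cadlag_adapted (\<Phi> U)"
  unfolding cadlag_adapted_def
proof (intro conjI allI impI cadlag_\<Phi>[OF U])
  fix t :: real assume t: "0 \<le> t"
  have [measurable]: "U0 \<in> borel_measurable (F t)"
    by (rule measurable_F_mono[OF _ t U0_adapted]) simp
  have [measurable]: "jumps U 1 t \<in> borel_measurable (F t)" "jumps U (-1) t \<in> borel_measurable (F t)"
    using U t by (auto intro: jumps_adapted)
  show "\<Phi> U t \<in> borel_measurable (F t)" unfolding \<Phi>_def[abs_def] by measurable
qed

primrec picard :: "nat \<Rightarrow> real \<Rightarrow> 'a \<Rightarrow> real" where
  "picard 0 = (\<lambda>t \<omega>. 0)"
| "picard (Suc k) = \<Phi> (picard k)"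

abbreviation "picard_step k \<equiv> dominator (picard (Suc k)) (picard k)"

lemma cadlag_adapted_picard: "cadlag_adapted (picard k)"
proof (induction k)
  case 0
  show ?case by (auto simp: cadlag_adapted_def cadlag_process_def)
qed (simp add: cadlag_adapted_\<Phi>)

lemma picard_diff_le:
  assumes "\<omega> \<in> space M" "0 \<le> r" "r \<le> s"
  shows "ennreal \<bar>picard (Suc (Suc k)) r \<omega> - picard (Suc k) r \<omega>\<bar> \<le> picard_step k s \<omega>"
  using dominator[OF cadlag_adapted_picard[of "Suc k"] cadlag_adapted_picard[of k] assms] by simp

lemma picard_close:
  assumes C: "dominator_const T C"
  shows "close (picard (Suc k)) (picard k) T (\<lambda>s. ennreal (gronwall_bound T C k s))"
proof (induction k)
  case 0
  show ?case using close_base[of _ _ T] by (simp add: gronwall_bound_def)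
next
  case (Suc k)
  show ?case
  proof (rule close_transfer[where D="picard_step k"])
    show "AE \<omega> in M. \<forall>r s. 0 \<le> r \<longrightarrow> r \<le> s \<longrightarrow> s \<le> T \<longrightarrow>
      ennreal \<bar>picard (Suc (Suc k)) r \<omega> - picard (Suc k) r \<omega>\<bar> \<le> picard_step k s \<omega>"
      using AE_space by eventually_elim (use picard_diff_le in blast)
    show "(\<integral>\<^sup>+\<omega>. picard_step k s \<omega> \<partial>M) \<le> ennreal (gronwall_bound T C (Suc k) s)" if "0 \<le> s" "s \<le> T" for s
      by (rule gronwall_bound_step[OF C cadlag_adapted_picard cadlag_adapted_picard Suc that])
  qed (rule cadlag_adaptedD[OF cadlag_adapted_picard])+
qed

text \<open>Dominators are summed instead of differences: one random variable then bounds the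
  distance from \<open>picard (Suc k)\<close> to the limit uniformly on [0, t].\<close>

definition picard_tail :: "nat \<Rightarrow> real \<Rightarrow> 'a \<Rightarrow> ennreal" where
  "picard_tail k t \<omega> = (\<Sum>i. picard_step (i + k) t \<omega>)"

definition good :: "'a set" where
  "good = {\<omega> \<in> space M. \<forall>n. picard_tail 0 (real n) \<omega> < \<infinity>}"

text \<open>The value 0 off \<open>good\<close> keeps every path cadlag. Indices start at 1 because
  \<open>picard_step k\<close> bounds differences of images under \<open>\<Phi>\<close>, that is of
  the iterates k + 2 and k + 1.\<close>

definition sol :: "real \<Rightarrow> 'a \<Rightarrow> real" where
  "sol t \<omega> = (if \<omega> \<in> good then lim (\<lambda>k. picard (Suc k) t \<omega>) else 0)"

lemma picard_step_measurable[measurable]: "picard_step k t \<in> borel_measurable M"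
  by (rule dominator_measurable[OF cadlag_adapted_picard cadlag_adapted_picard])

lemma picard_tail_measurable[measurable]: "picard_tail k t \<in> borel_measurable M"
  unfolding picard_tail_def[abs_def] by measurable

lemma nn_integral_picard_tail:
  assumes C: "dominator_const T C" and "0 \<le> T"
  shows "(\<integral>\<^sup>+\<omega>. picard_tail k T \<omega> \<partial>M) \<le> ennreal (\<Sum>i. gronwall_bound T C (Suc (i + k)) T)"
proof -
  have C0: "0 \<le> C" using C by (simp add: dominator_const_def)
  have sm: "summable (\<lambda>i. gronwall_bound T C (Suc (i + k)) T)"
    using summable_ignore_initial_segment[OF gronwall_bound_summable[of T C T], of "Suc k"] by simp
  have "(\<integral>\<^sup>+\<omega>. picard_tail k T \<omega> \<partial>M) = (\<Sum>i. \<integral>\<^sup>+\<omega>. picard_step (i + k) T \<omega> \<partial>M)"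
    unfolding picard_tail_def by (intro nn_integral_suminf) measurable
  also have "\<dots> \<le> (\<Sum>i. ennreal (gronwall_bound T C (Suc (i + k)) T))"
    using \<open>0 \<le> T\<close>
    by (intro suminf_le gronwall_bound_step[OF C cadlag_adapted_picard cadlag_adapted_picard picard_close[OF C]]) auto
  also have "\<dots> = ennreal (\<Sum>i. gronwall_bound T C (Suc (i + k)) T)"
    using gronwall_bound_nonneg[OF C0 \<open>0 \<le> T\<close>] sm by (intro suminf_ennreal2) auto
  finally show ?thesis .
qed

lemma AE_good: "AE \<omega> in M. \<omega> \<in> good"
proof -
  have "AE \<omega> in M. picard_tail 0 (real n) \<omega> \<noteq> \<infinity>" for n
  proof -
    obtain C where C: "dominator_const (real n) C" using dominator_const_ex by blast
    have "(\<integral>\<^sup>+\<omega>. picard_tail 0 (real n) \<omega> \<partial>M) \<noteq> \<infinity>"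
      using nn_integral_picard_tail[OF C, of 0] by (auto simp: top_unique)
    then show ?thesis by (intro nn_integral_noteq_infinite) measurable
  qed
  then have "AE \<omega> in M. \<forall>n. picard_tail 0 (real n) \<omega> \<noteq> \<infinity>" by (simp add: AE_all_countable)
  then show ?thesis using AE_space
    by eventually_elim (auto simp: good_def less_top)
qed

text \<open>The event concerns all times; it is known at time t because its complement is null and
  the filtration contains the null sets.\<close>

lemma good_sets: "0 \<le> t \<Longrightarrow> good \<in> sets (F t)"
proof -
  assume t: "0 \<le> t"
  have g: "good \<in> sets M" unfolding good_def by measurable
  have "AE \<omega> in M. \<omega> \<notin> space M - good" using AE_good by eventually_elim auto
  then have "space M - good \<in> null_sets M" using g by (subst AE_iff_null_sets) auto
  then have "space M - good \<in> sets (F t)" using null_sets_F F_mono[of 0 t] t by blast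
  then have "space (F t) - (space M - good) \<in> sets (F t)" by (rule sets.compl_sets)
  moreover have "space (F t) - (space M - good) = good" using space_F[OF t] by (auto simp: good_def)
  ultimately show ?thesis by simp
qed

lemma sol_tail:
  assumes \<omega>: "\<omega> \<in> good" and t: "0 \<le> t" "t \<le> real n"
  shows "convergent (\<lambda>k. picard (Suc k) t \<omega>)"
    and "ennreal \<bar>sol t \<omega> - picard (Suc k) t \<omega>\<bar> \<le> picard_tail k (real n) \<omega>"
    and "\<bar>sol t \<omega> - picard (Suc k) t \<omega>\<bar> \<le> (\<Sum>i. enn2real (picard_step (i + k) (real n) \<omega>))"
    and "summable (\<lambda>i. enn2real (picard_step i (real n) \<omega>))"
proof -
  have \<omega>': "\<omega> \<in> space M" and fin: "picard_tail 0 (real n) \<omega> < \<infinity>" using \<omega> by (auto simp: good_def)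
  let ?\<delta> = "\<lambda>i. enn2real (picard_step i (real n) \<omega>)"
  have sfin: "(\<Sum>i. picard_step i (real n) \<omega>) \<noteq> \<infinity>" using fin by (simp add: picard_tail_def)
  have lt: "picard_step i (real n) \<omega> < \<infinity>" for i
    using ennreal_suminf_lessD[of "\<lambda>i. picard_step i (real n) \<omega>" \<infinity> i] fin by (simp add: picard_tail_def)
  have en: "ennreal (?\<delta> i) = picard_step i (real n) \<omega>" for i using lt[of i] by simp
  show sm: "summable ?\<delta>"
    using sfin by (intro summable_suminf_not_top) (auto simp only: en enn2real_nonneg infinity_ennreal_def)
  have inc: "\<bar>picard (Suc (Suc k)) t \<omega> - picard (Suc k) t \<omega>\<bar> \<le> ?\<delta> k" for k
  proof -
    have "ennreal \<bar>picard (Suc (Suc k)) t \<omega> - picard (Suc k) t \<omega>\<bar> \<le> ennreal (?\<delta> k)"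
      unfolding en by (rule picard_diff_le[OF \<omega>' t])
    then show ?thesis by (simp del: picard.simps)
  qed
  show "convergent (\<lambda>k. picard (Suc k) t \<omega>)"
    by (rule limit_of_summable_increments(1)[OF sm inc])
  show le: "\<bar>sol t \<omega> - picard (Suc k) t \<omega>\<bar> \<le> (\<Sum>i. ?\<delta> (i + k))"
    using limit_of_summable_increments(2)[of ?\<delta> "\<lambda>k. picard (Suc k) t \<omega>", OF sm inc, of k] \<omega>
    by (simp add: sol_def del: picard.simps)
  have "ennreal \<bar>sol t \<omega> - picard (Suc k) t \<omega>\<bar> \<le> ennreal (\<Sum>i. ?\<delta> (i + k))"
    using le by (rule ennreal_leI)
  also have "\<dots> = (\<Sum>i. ennreal (?\<delta> (i + k)))"
    by (intro suminf_ennreal2[symmetric] summable_ignore_initial_segment sm) simp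
  also have "\<dots> = picard_tail k (real n) \<omega>" unfolding en picard_tail_def ..
  finally show "ennreal \<bar>sol t \<omega> - picard (Suc k) t \<omega>\<bar> \<le> picard_tail k (real n) \<omega>" .
qed

lemma sol_uniform_limit:
  assumes \<omega>: "\<omega> \<in> good"
  shows "uniform_limit {0..T} (\<lambda>k t. picard (Suc k) t \<omega>) (\<lambda>t. sol t \<omega>) sequentially"
proof -
  obtain n where n: "T \<le> real n" using real_arch_simple by blast
  have "(\<lambda>k. \<Sum>i. enn2real (picard_step (i + k) (real n) \<omega>)) \<longlonglongrightarrow> 0"
    by (rule suminf_tail_tendsto_0[OF sol_tail(4)[OF \<omega>, of "real n" n]]) auto
  show ?thesis
  proof (rule uniform_limitI)
    fix e :: real assume "e > 0"
    then have "eventually (\<lambda>k. (\<Sum>i. enn2real (picard_step (i + k) (real n) \<omega>)) < e) sequentially"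
      by (intro order_tendstoD(2)[OF \<open>_ \<longlonglongrightarrow> 0\<close>])
    then show "\<forall>\<^sub>F k in sequentially. \<forall>t\<in>{0..T}. dist (picard (Suc k) t \<omega>) (sol t \<omega>) < e"
    proof eventually_elim
      case (elim k)
      show ?case
      proof
        fix t assume "t \<in> {0..T}"
        then show "dist (picard (Suc k) t \<omega>) (sol t \<omega>) < e"
          using sol_tail(3)[OF \<omega>, of t n k] elim n by (simp add: dist_real_def abs_minus_commute del: picard.simps)
      qed
    qed
  qed
qed

lemma cadlag_adapted_sol: "cadlag_adapted sol"
  unfolding cadlag_adapted_def
proof (intro conjI allI impI)
  fix t :: real assume t: "0 \<le> t"
  have [measurable]: "picard k t \<in> borel_measurable (F t)" for k
    using cadlag_adapted_picard t by (simp add: cadlag_adapted_def)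
  have [measurable]: "good \<in> sets (F t)" by (rule good_sets[OF t])
  show "sol t \<in> borel_measurable (F t)" unfolding sol_def[abs_def] by measurable
next
  show "cadlag_process M sol"
    unfolding cadlag_process_def continuous_within
  proof (intro ballI allI impI conjI)
    fix \<omega> t assume \<omega>: "\<omega> \<in> space M"
    have pic: "cadlag_process M (picard (Suc k))" for k by (rule cadlag_adaptedD[OF cadlag_adapted_picard])
    have left: "\<exists>l. ((\<lambda>t. picard (Suc k) t \<omega>) \<longlongrightarrow> l) (at_left t)" if "0 < t" for k t
      using left_lim_tendsto[OF pic \<omega> that] by blast
    note lims = cadlag_uniform_limit[where p="\<lambda>k t. picard (Suc k) t \<omega>" and u="\<lambda>t. sol t \<omega>",
        OF cadlag_right_tendsto[OF pic \<omega>] left sol_uniform_limit]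
    show "((\<lambda>r. sol r \<omega>) \<longlongrightarrow> sol t \<omega>) (at_right t)" if "0 \<le> t"
      using lims(1)[OF _ _ _ that] by (cases "\<omega> \<in> good") (auto simp: sol_def)
    show "\<exists>l. ((\<lambda>r. sol r \<omega>) \<longlongrightarrow> l) (at_left t)" if "0 \<le> t" "0 < t"
      using lims(2)[OF _ _ _ that(2)] by (cases "\<omega> \<in> good") (auto simp: sol_def)
  qed
qed

text \<open>The defect at t is at most the distance of \<open>sol\<close> to the iterate k + 2 plus
  the distance of the images of the iterate k + 1 and of \<open>sol\<close> under
  \<open>\<Phi>\<close>. The tail bounds the first, a dominator the second, and both means tend to 0
  with k.\<close>

lemma sol_fixed_point: "AE \<omega> in M. \<forall>t\<ge>0. sol t \<omega> = \<Phi> sol t \<omega>"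
proof -
  have "AE \<omega> in M. \<forall>t. 0 \<le> t \<longrightarrow> t \<le> real n \<longrightarrow> sol t \<omega> = \<Phi> sol t \<omega>" for n
  proof -
    let ?T = "real n"
    obtain C where C: "dominator_const ?T C" using dominator_const_ex by blast
    define \<rho> where "\<rho> k = (\<Sum>i. gronwall_bound ?T C (Suc (i + k)) ?T)" for k
    have \<rho>_lim: "\<rho> \<longlonglongrightarrow> 0"
      unfolding \<rho>_def[abs_def]
      by (rule suminf_tail_tendsto_0[OF summable_Suc_iff[THEN iffD2, OF gronwall_bound_summable]])
    let ?e = "\<lambda>k. dominator (picard (Suc k)) sol ?T"
    let ?Y = "\<lambda>k \<omega>. picard_tail (Suc k) ?T \<omega> + ?e k \<omega>"
    have tail: "AE \<omega> in M. \<forall>r k. 0 \<le> r \<longrightarrow> r \<le> ?T \<longrightarrow> ennreal \<bar>sol r \<omega> - picard (Suc k) r \<omega>\<bar> \<le> picard_tail k ?T \<omega>"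
      using AE_good by eventually_elim (use sol_tail(2) in blast)
    have cl: "close (picard (Suc k)) sol ?T (\<lambda>_. ennreal (\<rho> k))" for k
    proof (rule close_transfer[where D="\<lambda>s. picard_tail k ?T"])
      show "AE \<omega> in M. \<forall>r s. 0 \<le> r \<longrightarrow> r \<le> s \<longrightarrow> s \<le> ?T \<longrightarrow>
        ennreal \<bar>picard (Suc k) r \<omega> - sol r \<omega>\<bar> \<le> picard_tail k ?T \<omega>"
        using tail by eventually_elim (metis abs_minus_commute order_trans)
      show "(\<integral>\<^sup>+\<omega>. picard_tail k ?T \<omega> \<partial>M) \<le> ennreal (\<rho> k)"
        using nn_integral_picard_tail[OF C] by (simp add: \<rho>_def)
    qed (rule cadlag_adaptedD[OF cadlag_adapted_picard], rule cadlag_adaptedD[OF cadlag_adapted_sol])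
    have e: "(\<integral>\<^sup>+\<omega>. ?e k \<omega> \<partial>M) \<le> ennreal C * (ennreal (\<rho> k) * ennreal ?T)" for k
    proof -
      have "(\<integral>\<^sup>+\<omega>. ?e k \<omega> \<partial>M) \<le> ennreal C * (\<integral>\<^sup>+s. ennreal (\<rho> k) * indicator {0..?T} s \<partial>lborel)"
        by (rule dominator_constD[OF C cadlag_adapted_picard cadlag_adapted_sol cl]) auto
      then show ?thesis by (simp add: nn_integral_cmult)
    qed
    have em[measurable]: "?e k \<in> borel_measurable M" for k
      by (rule dominator_measurable[OF cadlag_adapted_picard cadlag_adapted_sol])
    have Y: "(\<integral>\<^sup>+\<omega>. ?Y k \<omega> \<partial>M) \<le> ennreal (\<rho> (Suc k)) + ennreal C * (ennreal (\<rho> k) * ennreal ?T)" for k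
    proof -
      have "(\<integral>\<^sup>+\<omega>. ?Y k \<omega> \<partial>M) = (\<integral>\<^sup>+\<omega>. picard_tail (Suc k) ?T \<omega> \<partial>M) + (\<integral>\<^sup>+\<omega>. ?e k \<omega> \<partial>M)"
        by (intro nn_integral_add) measurable
      also have "\<dots> \<le> ennreal (\<rho> (Suc k)) + ennreal C * (ennreal (\<rho> k) * ennreal ?T)"
        using nn_integral_picard_tail[OF C, of "Suc k"] by (intro add_mono e) (simp add: \<rho>_def)
      finally show ?thesis .
    qed
    have "(\<lambda>k. ennreal (\<rho> (Suc k) + C * (\<rho> k * ?T))) \<longlonglongrightarrow> ennreal (0 + C * (0 * ?T))"
      by (intro tendsto_ennrealI tendsto_intros \<rho>_lim LIMSEQ_Suc[OF \<rho>_lim])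
    moreover have "ennreal (\<rho> (Suc k)) + ennreal C * (ennreal (\<rho> k) * ennreal ?T) = ennreal (\<rho> (Suc k) + C * (\<rho> k * ?T))" for k
    proof -
      have C0: "0 \<le> C" using C by (simp add: dominator_const_def)
      have "0 \<le> \<rho> k" for k unfolding \<rho>_def
        using gronwall_bound_nonneg[OF C0] summable_ignore_initial_segment[OF gronwall_bound_summable[of ?T C ?T], of "Suc k"]
        by (intro suminf_nonneg) auto
      then show ?thesis using C0 by (simp add: ennreal_plus ennreal_mult)
    qed
    ultimately have lim: "(\<lambda>k. ennreal (\<rho> (Suc k)) + ennreal C * (ennreal (\<rho> k) * ennreal ?T)) \<longlonglongrightarrow> 0" by simp
    have "(\<integral>\<^sup>+\<omega>. (INF k. ?Y k \<omega>) \<partial>M) \<le> 0"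
    proof (rule LIMSEQ_le_const[OF lim], intro exI allI impI)
      fix k
      have "(\<integral>\<^sup>+\<omega>. (INF k. ?Y k \<omega>) \<partial>M) \<le> (\<integral>\<^sup>+\<omega>. ?Y k \<omega> \<partial>M)"
        by (intro nn_integral_mono INF_lower) simp
      also note Y[of k]
      finally show "(\<integral>\<^sup>+\<omega>. (INF k. ?Y k \<omega>) \<partial>M) \<le> ennreal (\<rho> (Suc k)) + ennreal C * (ennreal (\<rho> k) * ennreal ?T)" .
    qed
    \<comment> \<open>The infimum over k of nonnegative bounds whose means tend to 0 has mean 0;
      this takes the place of an almost surely convergent subsequence.\<close>
    then have "AE \<omega> in M. (INF k. ?Y k \<omega>) = 0"
      by (subst (asm) le_zero_eq) (rule nn_integral_0_iff_AE[THEN iffD1], measurable)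
    then show ?thesis using tail AE_space
    proof eventually_elim
      case (elim \<omega>)
      show ?case
      proof (intro allI impI)
        fix t assume t: "0 \<le> t" "t \<le> ?T"
        have "ennreal \<bar>sol t \<omega> - \<Phi> sol t \<omega>\<bar> \<le> ?Y k \<omega>" for k
        proof -
          have "\<bar>sol t \<omega> - \<Phi> sol t \<omega>\<bar> \<le> \<bar>sol t \<omega> - picard (Suc (Suc k)) t \<omega>\<bar> + \<bar>\<Phi> (picard (Suc k)) t \<omega> - \<Phi> sol t \<omega>\<bar>"
            by simp
          then have "ennreal \<bar>sol t \<omega> - \<Phi> sol t \<omega>\<bar>
            \<le> ennreal \<bar>sol t \<omega> - picard (Suc (Suc k)) t \<omega>\<bar> + ennreal \<bar>\<Phi> (picard (Suc k)) t \<omega> - \<Phi> sol t \<omega>\<bar>"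
            by (metis abs_ge_zero ennreal_leI ennreal_plus)
          also have "\<dots> \<le> ?Y k \<omega>"
            using elim(2) t by (intro add_mono dominator[OF cadlag_adapted_picard cadlag_adapted_sol elim(3) t]) blast
          finally show ?thesis .
        qed
        then have "ennreal \<bar>sol t \<omega> - \<Phi> sol t \<omega>\<bar> \<le> (INF k. ?Y k \<omega>)" by (intro INF_greatest)
        then show "sol t \<omega> = \<Phi> sol t \<omega>" using elim(1) by (simp add: ennreal_eq_0_iff)
      qed
    qed
  qed
  then have "AE \<omega> in M. \<forall>n. \<forall>t. 0 \<le> t \<longrightarrow> t \<le> real n \<longrightarrow> sol t \<omega> = \<Phi> sol t \<omega>" by (simp add: AE_all_countable)
  then show ?thesis by eventually_elim (meson real_arch_simple)
qed

end

section \<open>A priori bounds\<close>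

lemma set_integral_point:
  fixes g :: "real \<Rightarrow> real"
  shows "(LINT s:{a..a}|lborel. g s) = 0"
proof -
  have "(LINT s:{a..a}|lborel. g s) = (\<integral>s. indicator {a} s *\<^sub>R g a \<partial>lborel)"
    unfolding set_lebesgue_integral_def by (intro Bochner_Integration.integral_cong) (auto simp: indicator_def)
  then show ?thesis by simp
qed

context jump_noise
begin

text \<open>\<open>finite_jumps_bound\<close> for a path driven by the noise. Left limit v, jump
  size b and thresholds f are arbitrary, so that both the original equation and the truncated one,
  where b is clamped, are instances.\<close>

lemma jump_path_bound:
  fixes u v b a A :: "real \<Rightarrow> real" and f :: "real \<Rightarrow> real \<Rightarrow> real"
  assumes \<omega>: "\<omega> \<in> space M"
    and left: "\<And>s. 0 < s \<Longrightarrow> s \<le> T \<Longrightarrow> (u \<longlongrightarrow> v s) (at_left s)"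
    and contract: "\<And>s r. 0 < s \<Longrightarrow> s \<le> T \<Longrightarrow> 0 \<le> r \<Longrightarrow> r \<le> 1 \<Longrightarrow> \<bar>v s - r * b s\<bar> \<le> \<bar>v s\<bar> - r * \<bar>b s\<bar>"
    and b[measurable]: "b \<in> borel_measurable borel" and f[measurable]: "\<And>c. f c \<in> borel_measurable borel"
    and fm: "\<And>s c. 0 < s \<Longrightarrow> s \<le> T \<Longrightarrow> f c s \<le> m"
    and u: "\<And>t. 0 \<le> t \<Longrightarrow> t \<le> T \<Longrightarrow> u t = u0
      - ((\<integral>p. (if 0 < fst p \<and> fst p \<le> t \<and> snd p \<le> f 1 (fst p) then b (fst p) else 0) \<partial>N 1 \<omega>)
       + (\<integral>p. (if 0 < fst p \<and> fst p \<le> t \<and> snd p \<le> f (-1) (fst p) then b (fst p) else 0) \<partial>N (-1) \<omega>)) + a t"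
    and a0: "a 0 = 0" "A 0 = 0"
    and aA: "\<And>r t. 0 \<le> r \<Longrightarrow> r \<le> t \<Longrightarrow> t \<le> T \<Longrightarrow> \<bar>a t - a r\<bar> \<le> A t - A r"
    and t: "0 \<le> t" "t \<le> T"
  shows "\<bar>u t\<bar> + ((\<integral>p. (if 0 < fst p \<and> fst p \<le> t \<and> snd p \<le> f 1 (fst p) then \<bar>b (fst p)\<bar> else 0) \<partial>N 1 \<omega>)
       + (\<integral>p. (if 0 < fst p \<and> fst p \<le> t \<and> snd p \<le> f (-1) (fst p) then \<bar>b (fst p)\<bar> else 0) \<partial>N (-1) \<omega>)) \<le> \<bar>u0\<bar> + A t"
proof -
  \<comment> \<open>Thresholds are at most m, so the box of side n contains every point that can be
    accepted up to time T.\<close>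
  obtain n where n: "max m T \<le> real n" using real_arch_simple by blast
  obtain S0 where S0: "finite S0" "emeasure (N 1 \<omega>) (jump_box n - S0 \<times> UNIV) = 0"
    "emeasure (N (-1) \<omega>) (jump_box n - S0 \<times> UNIV) = 0"
    "\<And>s. s \<in> S0 \<Longrightarrow> emeasure (N 1 \<omega>) ({s} \<times> {0..real n}) + emeasure (N (-1) \<omega>) ({s} \<times> {0..real n}) \<le> 1"
    using N_atoms[OF \<omega>, of n] by blast
  define S where "S = S0 \<inter> {0<..T}"
  have S: "finite S" "S \<subseteq> {0<..T}" using S0 by (auto simp: S_def)
  have [measurable]: "fst \<in> borel_measurable (borel :: (real \<times> real) measure)" "snd \<in> borel_measurable (borel :: (real \<times> real) measure)"
    by (simp_all add: borel_prod[symmetric])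
  have sub: "{0<..T} \<times> {0..real n} - S \<times> UNIV \<subseteq> jump_box n - S0 \<times> UNIV"
    using n by (auto simp: S_def jump_box_def)
  have S0m: "jump_box n - S0 \<times> UNIV \<in> sets (N c \<omega>)" for c
  proof -
    have "S0 \<times> (UNIV :: real set) \<in> sets borel"
      using finite_imp_closed[OF S0(1)] by (intro borel_Times borel_closed) auto
    then show ?thesis by auto
  qed
  have conc: "emeasure (N c \<omega>) ({0<..T} \<times> {0..real n} - S \<times> UNIV) = 0" if "c = 1 \<or> c = -1" for c
    using that S0 by (intro emeasure_eq_0[OF S0m _ sub]) auto
  have fin: "emeasure (N c \<omega>) ({0<..T} \<times> {0..real n}) < \<infinity>" for c
  proof (rule le_less_trans[OF emeasure_mono N_fin[OF \<omega>, of c n]])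
    show "{0<..T} \<times> {0..real n} \<subseteq> jump_box n" using n by (auto simp: jump_box_def)
  qed simp
  have fn: "f c s \<le> real n" if "0 < s" "s \<le> T" for s c using fm[OF that, of c] n by linarith
  have int: "(\<integral>p. (if 0 < fst p \<and> fst p \<le> t \<and> snd p \<le> f c (fst p) then b' (fst p) else 0) \<partial>N c \<omega>)
    = (\<Sum>s\<in>S \<inter> {..t}. b' s * measure (N c \<omega>) ({s} \<times> {0..f c s}))"
    if "c = 1 \<or> c = -1" and "t \<le> T" and [measurable]: "b' \<in> borel_measurable borel" for b' :: "real \<Rightarrow> real" and t c
  proof (rule integral_on_atoms(2)[where T=T and m="real n"])
    show "emeasure (N c \<omega>) (- ({0<..} \<times> {0..})) = 0" using N_null[of c \<omega>] by (simp add: jump_region_def)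
    show "(\<lambda>p. if 0 < fst p \<and> fst p \<le> t \<and> snd p \<le> f c (fst p) then b' (fst p) else 0) \<in> borel_measurable borel"
      by measurable
  qed (use conc[OF that(1)] fin S fn that in auto)
  \<comment> \<open>The number of accepted points at time s, both signs together. By
    \<open>N_atoms\<close> a line carries at most one point of the two measures within the box,
    hence \<theta> \<le> 1.\<close>
  define \<theta> where "\<theta> s = measure (N 1 \<omega>) ({s} \<times> {0..f 1 s}) + measure (N (-1) \<omega>) ({s} \<times> {0..f (-1) s})" for s
  have \<theta>: "0 \<le> \<theta> s \<and> \<theta> s \<le> 1" if s: "s \<in> S" for s
  proof -
    have le: "emeasure (N c \<omega>) ({s} \<times> {0..f c s}) \<le> emeasure (N c \<omega>) ({s} \<times> {0..real n})" for c
      using fn[of s c] S s by (intro emeasure_mono) (auto intro: order_trans intro!: borel_closed closed_Times)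
    have "emeasure (N 1 \<omega>) ({s} \<times> {0..f 1 s}) + emeasure (N (-1) \<omega>) ({s} \<times> {0..f (-1) s}) \<le> 1"
      using add_mono[OF le[of 1] le[of "-1"]] S0(4)[of s] s by (auto simp: S_def intro: order_trans)
    moreover have fin: "emeasure (N 1 \<omega>) ({s} \<times> {0..f 1 s}) \<noteq> \<top>" "emeasure (N (-1) \<omega>) ({s} \<times> {0..f (-1) s}) \<noteq> \<top>"
      using calculation by (auto simp: top_unique)
    ultimately have "ennreal (\<theta> s) \<le> 1"
      unfolding \<theta>_def fin[THEN emeasure_eq_ennreal_measure] by (subst ennreal_plus) (simp_all only: measure_nonneg)
    then have "\<theta> s \<le> 1" by (simp only: ennreal_le_1)
    then show ?thesis by (simp add: \<theta>_def)
  qed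
  have "\<bar>u t\<bar> + (\<Sum>s\<in>S \<inter> {..t}. \<bar>b s\<bar> * \<theta> s) \<le> \<bar>u0\<bar> + A t"
  proof (rule finite_jumps_bound[where T=T and v=v and a=a])
    show "u t = u0 - (\<Sum>s\<in>S \<inter> {..t}. b s * \<theta> s) + a t" if "0 \<le> t" "t \<le> T" for t
      using u[OF that] that by (simp add: int \<theta>_def distrib_left sum.distrib)
  qed (use S \<theta> contract left a0 aA t in auto)
  moreover have "(\<integral>p. (if 0 < fst p \<and> fst p \<le> t \<and> snd p \<le> f c (fst p) then \<bar>b (fst p)\<bar> else 0) \<partial>N c \<omega>)
    = (\<Sum>s\<in>S \<inter> {..t}. \<bar>b s\<bar> * measure (N c \<omega>) ({s} \<times> {0..f c s}))" if "c = 1 \<or> c = -1" for c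
    by (rule int[of _ _ "\<lambda>s. \<bar>b s\<bar>", OF that t(2)]) measurable
  ultimately show ?thesis
    by (simp add: \<theta>_def distrib_left sum.distrib)
qed

text \<open>A cadlag path is bounded on [0, t], by a bound depending on the sample point. This
  bounds the thresholds and makes the path estimate applicable, whose result then contains only the
  initial value and the deterministic drift integrals.\<close>

lemma solution_path_bound:
  fixes \<phi> :: "real \<Rightarrow> real"
  assumes U: "cadlag_adapted U" and \<omega>: "\<omega> \<in> space M"
    and \<phi>: "continuous_on UNIV \<phi>" "\<And>x. 0 \<le> \<phi> x" and h: "0 \<le> h"
    and int: "\<And>t c. 0 \<le> t \<Longrightarrow> c = 1 \<or> c = -1 \<Longrightarrow> set_integrable lborel {0..t} (\<lambda>s. \<integral>\<omega>. \<phi> (c * U s \<omega>) \<partial>M)"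
    and eq: "\<And>t. 0 \<le> t \<Longrightarrow> U t \<omega> = U0 \<omega> - (jump_integral (N 1) U \<phi> 1 \<omega> t + jump_integral (N (-1)) U \<phi> (-1) \<omega> t)
        + h * ((LINT s:{0..t}|lborel. \<integral>\<omega>. \<phi> (1 * U s \<omega>) \<partial>M) - (LINT s:{0..t}|lborel. \<integral>\<omega>. \<phi> (-1 * U s \<omega>) \<partial>M))"
    and t: "0 \<le> t"
  shows "\<bar>U t \<omega>\<bar> \<le> \<bar>U0 \<omega>\<bar> + h * ((LINT s:{0..t}|lborel. \<integral>\<omega>. \<phi> (1 * U s \<omega>) \<partial>M) + (LINT s:{0..t}|lborel. \<integral>\<omega>. \<phi> (-1 * U s \<omega>) \<partial>M))"
proof -
  let ?I = "\<lambda>c t. LINT s:{0..t}|lborel. \<integral>\<omega>. \<phi> (c * U s \<omega>) \<partial>M"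
  obtain B where B: "\<And>s. 0 \<le> s \<Longrightarrow> s \<le> t \<Longrightarrow> \<bar>U s \<omega>\<bar> \<le> B"
    using cadlag_process_bounded[OF cadlag_adaptedD[OF U] \<omega>, of t] by blast
  have LB: "\<bar>left_lim U \<omega> s\<bar> \<le> B" if "0 < s" "s \<le> t" for s
    using that by (intro left_lim_bounded[OF cadlag_adaptedD[OF U] \<omega>] B) auto
  have "compact (\<phi> ` {- B..B})"
    using \<phi>(1) by (intro compact_continuous_image compact_Icc) (auto intro: continuous_on_subset)
  then have "bdd_above (\<phi> ` {- B..B})" by (intro bounded_imp_bdd_above compact_imp_bounded)
  then obtain m where "\<And>y. y \<in> \<phi> ` {- B..B} \<Longrightarrow> y \<le> m" unfolding bdd_above_def by blast
  then have m: "\<phi> x \<le> m" if "\<bar>x\<bar> \<le> B" for x using that by (simp add: abs_le_iff)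
  \<comment> \<open>\<open>jump_path_bound\<close> asks f c \<le> m for all real c; the default
    value \<open>min m 0\<close> meets this also when c is not a sign.\<close>
  define f where "f c s = (if 0 < s \<and> s \<le> t \<and> \<bar>c\<bar> = 1 then \<phi> (c * left_lim U \<omega> s) else min m 0)" for c s
  have [measurable]: "\<phi> \<in> borel_measurable borel" by (rule borel_measurable_continuous_onI[OF \<phi>(1)])
  have lm[measurable]: "left_lim U \<omega> \<in> borel_measurable borel"
    using measurable_Pair2[OF left_lim_measurable_joint[OF U] \<omega>] by simp
  have mono: "\<bar>?I c y - ?I c x\<bar> = ?I c y - ?I c x" if "0 \<le> x" "x \<le> y" "c = 1 \<or> c = -1" for c x y
  proof -
    have "?I c x \<le> ?I c y"
      unfolding set_lebesgue_integral_def
      using int[of y c] int[of x c] that \<phi>(2)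
      by (intro integral_mono) (auto simp: set_integrable_def indicator_def intro!: Bochner_Integration.integral_nonneg)
    then show ?thesis by simp
  qed
  have J: "jump_integral (N c) U \<phi> c \<omega> r = (\<integral>p. (if 0 < fst p \<and> fst p \<le> r \<and> snd p \<le> f c (fst p) then left_lim U \<omega> (fst p) else 0) \<partial>N c \<omega>)"
    if "r \<le> t" "\<bar>c\<bar> = 1" for r c
    unfolding jump_integral_def f_def using that by (intro Bochner_Integration.integral_cong) auto
  have "\<bar>U t \<omega>\<bar> + ((\<integral>p. (if 0 < fst p \<and> fst p \<le> t \<and> snd p \<le> f 1 (fst p) then \<bar>left_lim U \<omega> (fst p)\<bar> else 0) \<partial>N 1 \<omega>)
       + (\<integral>p. (if 0 < fst p \<and> fst p \<le> t \<and> snd p \<le> f (-1) (fst p) then \<bar>left_lim U \<omega> (fst p)\<bar> else 0) \<partial>N (-1) \<omega>))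
    \<le> \<bar>U0 \<omega>\<bar> + h * (?I 1 t + ?I (-1) t)"
  proof (rule jump_path_bound[where T=t and v="left_lim U \<omega>" and f=f and m=m and a="\<lambda>t. h * (?I 1 t - ?I (-1) t)"])
    show "((\<lambda>t. U t \<omega>) \<longlongrightarrow> left_lim U \<omega> s) (at_left s)" if "0 < s" for s
      by (rule left_lim_tendsto[OF cadlag_adaptedD[OF U] \<omega> that])
    show "f c \<in> borel_measurable borel" for c unfolding f_def by measurable
    show "f c s \<le> m" if "0 < s" "s \<le> t" for s c
      using that LB[OF that] by (auto simp: f_def abs_mult intro!: m)
    show "\<bar>left_lim U \<omega> s - r * left_lim U \<omega> s\<bar> \<le> \<bar>left_lim U \<omega> s\<bar> - r * \<bar>left_lim U \<omega> s\<bar>" if "0 \<le> r" "r \<le> 1" for s r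
    proof -
      have "\<bar>left_lim U \<omega> s - r * left_lim U \<omega> s\<bar> = \<bar>(1 - r) * left_lim U \<omega> s\<bar>" by (simp add: algebra_simps)
      also have "\<dots> = (1 - r) * \<bar>left_lim U \<omega> s\<bar>" using that by (simp add: abs_mult)
      finally show ?thesis by (simp add: algebra_simps)
    qed
    show "h * (?I 1 0 - ?I (-1) 0) = 0" "h * (?I 1 0 + ?I (-1) 0) = 0"
      by (simp_all only: set_integral_point) simp_all
    show "\<bar>h * (?I 1 y - ?I (-1) y) - h * (?I 1 x - ?I (-1) x)\<bar> \<le> h * (?I 1 y + ?I (-1) y) - h * (?I 1 x + ?I (-1) x)"
      if "0 \<le> x" "x \<le> y" for x y
    proof -
      have "\<bar>h * (?I 1 y - ?I (-1) y) - h * (?I 1 x - ?I (-1) x)\<bar> = h * \<bar>(?I 1 y - ?I 1 x) - (?I (-1) y - ?I (-1) x)\<bar>"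
        unfolding right_diff_distrib[symmetric] abs_mult using h by (simp add: algebra_simps)
      also have "\<dots> \<le> h * ((?I 1 y - ?I 1 x) + (?I (-1) y - ?I (-1) x))"
        using mono[OF that, of 1] mono[OF that, of "-1"] h by (intro mult_left_mono) auto
      also have "\<dots> = h * (?I 1 y + ?I (-1) y) - h * (?I 1 x + ?I (-1) x)" by (simp add: algebra_simps)
      finally show ?thesis .
    qed
    show "U r \<omega> = U0 \<omega> -
      ((\<integral>p. (if 0 < fst p \<and> fst p \<le> r \<and> snd p \<le> f 1 (fst p) then left_lim U \<omega> (fst p) else 0) \<partial>N 1 \<omega>)
       + (\<integral>p. (if 0 < fst p \<and> fst p \<le> r \<and> snd p \<le> f (-1) (fst p) then left_lim U \<omega> (fst p) else 0) \<partial>N (-1) \<omega>))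
      + h * (?I 1 r - ?I (-1) r)" if "0 \<le> r" "r \<le> t" for r
      using eq[OF that(1)] J[OF that(2), of 1] J[OF that(2), of "-1"] by simp
  qed (use \<omega> t lm in auto)
  moreover have J0: "0 \<le> (\<integral>p. (if 0 < fst p \<and> fst p \<le> t \<and> snd p \<le> f c (fst p) then \<bar>left_lim U \<omega> (fst p)\<bar> else 0) \<partial>N c \<omega>)" for c
    by (intro Bochner_Integration.integral_nonneg) auto
  ultimately show ?thesis using J0[of 1] J0[of "-1"] by linarith
qed

end

section \<open>Mean jump loss against drift gain in the truncated equation\<close>

context truncated_sde
begin

text \<open>The mean rate as the compensator sees it. At a single time it may differ from
  \<open>rate\<close>; only the time integrals are compared.\<close>

definition left_rate :: "(real \<Rightarrow> 'a \<Rightarrow> real) \<Rightarrow> real \<Rightarrow> real \<Rightarrow> real" where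
  "left_rate U c s = (\<integral>\<omega>. \<phi> (c * clamp s (left_lim U \<omega> s)) \<partial>M)"

lemma rate_max_measurable:
  assumes U: "cadlag_adapted U"
  shows "(\<lambda>s. rate U c (max 0 s)) \<in> borel_measurable borel"
proof -
  have [measurable]: "(\<lambda>x. U (max 0 (fst x)) (snd x)) \<in> borel_measurable ((borel :: real measure) \<Otimes>\<^sub>M M)"
    using cadlag_joint_measurable[OF cadlag_adapted_measurable[OF U] cadlag_adaptedD[OF U]] .
  show ?thesis unfolding rate_def by measurable
qed

text \<open>Dominated convergence along times increasing to s. The clamping level moves with the
  time, which is where continuity of \<kappa> enters.\<close>

lemma rate_tendsto_left:
  assumes U: "cadlag_adapted U" and c: "\<bar>c\<bar> = 1" and s: "0 < s" and \<kappa>: "continuous_on UNIV \<kappa>"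
    and x: "\<And>n. 0 \<le> x n" "\<And>n. x n < s" "x \<longlonglongrightarrow> s"
  shows "(\<lambda>n. rate U c (x n)) \<longlonglongrightarrow> left_rate U c s"
proof -
  obtain B C where B: "\<And>c s' x. \<bar>c\<bar> = 1 \<Longrightarrow> s' \<le> s \<Longrightarrow> \<phi> (c * clamp s' x) \<le> B"
    using \<phi>_clamp_bounds[of s] by metis
  show ?thesis unfolding rate_def left_rate_def
  proof (rule integral_dominated_convergence[where w="\<lambda>_. B"])
  show "integrable M (\<lambda>_. B)" by simp
  show "AE \<omega> in M. norm (\<phi> (c * clamp (x n) (U (x n) \<omega>))) \<le> B" for n
    using B[OF c less_imp_le[OF x(2)]] \<phi>_nonneg by auto
  have [measurable]: "(\<lambda>\<omega>. left_lim U \<omega> s) \<in> borel_measurable M" by (rule left_lim_measurable[OF U])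
  have [measurable]: "U (x n) \<in> borel_measurable M" for n by (rule cadlag_adapted_measurable[OF U x(1)])
  show "(\<lambda>\<omega>. \<phi> (c * clamp s (left_lim U \<omega> s))) \<in> borel_measurable M" by measurable
  show "(\<lambda>\<omega>. \<phi> (c * clamp (x n) (U (x n) \<omega>))) \<in> borel_measurable M" for n by measurable
  show "AE \<omega> in M. (\<lambda>n. \<phi> (c * clamp (x n) (U (x n) \<omega>))) \<longlonglongrightarrow> \<phi> (c * clamp s (left_lim U \<omega> s))"
  proof (rule AE_I2)
    fix \<omega> assume \<omega>: "\<omega> \<in> space M"
    have "filterlim x (at_left s) sequentially" using x by (intro filterlim_at_withinI) auto
    from filterlim_compose[OF left_lim_tendsto[OF cadlag_adaptedD[OF U] \<omega> s] this]
    have 1: "(\<lambda>n. U (x n) \<omega>) \<longlonglongrightarrow> left_lim U \<omega> s" .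
    have "isCont \<kappa> s" using \<kappa> by (simp add: continuous_on_eq_continuous_at)
    then have 2: "(\<lambda>n. \<kappa> (x n)) \<longlonglongrightarrow> \<kappa> s" using x(3) by (rule isCont_tendsto_compose)
    have "(\<lambda>n. c * clamp (x n) (U (x n) \<omega>)) \<longlonglongrightarrow> c * clamp s (left_lim U \<omega> s)"
      unfolding clamp_def by (intro tendsto_intros 1 2)
    moreover have "isCont \<phi> y" for y using \<phi>_continuous by (simp add: continuous_on_eq_continuous_at)
    ultimately show "(\<lambda>n. \<phi> (c * clamp (x n) (U (x n) \<omega>))) \<longlonglongrightarrow> \<phi> (c * clamp s (left_lim U \<omega> s))"
      by (rule isCont_tendsto_compose[rotated])
  qed
qed
qed

text \<open>A solution has no fixed times of discontinuity in the mean: the integral of the rate is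
  invariant under the translations by \<open>1/n\<close>, which turn \<open>rate\<close> into \<open>left_rate\<close> in the limit.\<close>

lemma left_rate_integral:
  assumes U: "cadlag_adapted U" and c: "\<bar>c\<bar> = 1" and t: "0 < t" and \<kappa>: "continuous_on UNIV \<kappa>"
  shows "integrable lborel (\<lambda>s. left_rate U c s * indicator {0<..t} s)"
    and "(\<integral>s. left_rate U c s * indicator {0<..t} s \<partial>lborel) = (LINT s:{0..t}|lborel. rate U c s)"
proof -
  obtain B C where B: "0 \<le> B" "\<And>c s' x. \<bar>c\<bar> = 1 \<Longrightarrow> s' \<le> t \<Longrightarrow> \<phi> (c * clamp s' x) \<le> B"
    using \<phi>_clamp_bounds[of t] by metis
  let ?g = "\<lambda>s. rate U c (max 0 s) * indicator {0..t} s"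
  let ?e = "\<lambda>n. - 1 / real (Suc n)"
  have gm[measurable]: "?g \<in> borel_measurable borel"
    using rate_max_measurable[OF U, of c] by measurable
  have gB: "\<bar>?g s\<bar> \<le> B" for s
    using rate_bounded[OF U c _ _ B(2)[OF c]] rate_nonneg[of U c "max 0 s"] B(1) by (auto simp: indicator_def)
  have lr[measurable]: "(\<lambda>s. left_rate U c s * indicator {0<..t} s) \<in> borel_measurable lborel"
  proof -
    have [measurable]: "(\<lambda>x. left_lim U (snd x) (fst x)) \<in> borel_measurable ((borel :: real measure) \<Otimes>\<^sub>M M)"
      using measurable_compose[OF measurable_pair_swap' left_lim_measurable_joint[OF U]] by (simp add: split_beta')
    show ?thesis unfolding left_rate_def by measurable
  qed
  \<comment> \<open>The shape \<open>?e n + 1 * s\<close> is that of the affine substitution with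
    slope 1 used below. Since the shift is to the left, the indicator of [0, t] turns into that of
    the half-open interval: 0 drops out and t stays in.\<close>
  have lim: "(\<lambda>n. ?g (?e n + 1 * s)) \<longlonglongrightarrow> left_rate U c s * indicator {0<..t} s" for s
  proof -
    have e0: "?e \<longlonglongrightarrow> 0"
      using tendsto_minus[OF lim_inverse_n'[THEN LIMSEQ_Suc]] by simp
    then have es: "(\<lambda>n. ?e n + 1 * s) \<longlonglongrightarrow> s" using tendsto_add[OF e0 tendsto_const[of s]] by simp
    consider "s \<le> 0" | "0 < s" "s \<le> t" | "t < s" by linarith
    then show ?thesis
    proof cases
      case 1
      have "?e n < 0" for n by simp
      then have "?e n + 1 * s < 0" for n using add_neg_nonpos[of "?e n" "1 * s"] 1 by simp
      then have "?g (?e n + 1 * s) = 0" for n by (simp add: indicator_def not_le)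
      moreover have "left_rate U c s * indicator {0<..t} s = 0" using 1 by simp
      ultimately show ?thesis by (simp only: tendsto_const)
    next
      case 2
      have "(\<lambda>n. rate U c (max 0 (?e n + 1 * s))) \<longlonglongrightarrow> left_rate U c s"
      proof (rule rate_tendsto_left[OF U c _ \<kappa>])
        have "?e n < 0" for n by simp
        then show "max 0 (?e n + 1 * s) < s" for n using 2 by simp
        show "(\<lambda>n. max 0 (?e n + 1 * s)) \<longlonglongrightarrow> s"
          using tendsto_max[OF tendsto_const[of 0] es] 2 by simp
      qed (use 2 in auto)
      moreover have "eventually (\<lambda>n. ?g (?e n + 1 * s) = rate U c (max 0 (?e n + 1 * s))) sequentially"
        using order_tendstoD(1)[OF es 2(1)]
      proof eventually_elim
        case (elim n)
        have "?e n < 0" by simp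
        then have "0 \<le> ?e n + 1 * s" "?e n + 1 * s \<le> t" using elim 2 by linarith+
        then have "?e n + 1 * s \<in> {0..t}" by simp
        then show ?case by (simp only: indicator_simps mult_1_right)
      qed
      ultimately have "(\<lambda>n. ?g (?e n + 1 * s)) \<longlonglongrightarrow> left_rate U c s"
        by (subst tendsto_cong)
      then show ?thesis using 2 by simp
    next
      case 3
      have "eventually (\<lambda>n. ?g (?e n + 1 * s) = 0) sequentially"
        using order_tendstoD(1)[OF es 3] by eventually_elim simp
      then show ?thesis using 3 by (simp add: tendsto_eventually)
    qed
  qed
  \<comment> \<open>Shifts are at most 1, so one integrable majorant on [0, t + 1] serves all
    n.\<close>
  have bd: "AE s in lborel. norm (?g (?e n + 1 * s)) \<le> B * indicator {0..t + 1} s" for n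
  proof (rule AE_I2)
    fix s :: real
    have "0 \<le> 1 / real (Suc n)" "1 / real (Suc n) \<le> 1" by simp_all
    then have "?e n + 1 * s \<in> {0..t} \<Longrightarrow> s \<in> {0..t + 1}"
      unfolding atLeastAtMost_iff by linarith
    then show "norm (?g (?e n + 1 * s)) \<le> B * indicator {0..t + 1} s"
      using gB[of "?e n + 1 * s"] by (cases "?e n + 1 * s \<in> {0..t}") (auto simp del: of_nat_Suc)
  qed
  have wint: "integrable lborel (\<lambda>s. B * indicator {0..t + 1} s)"
    by (intro integrable_mult_right integrable_real_indicator) (auto simp: emeasure_lborel_Icc_eq)
  have shm: "(\<lambda>s. ?g (?e n + 1 * s)) \<in> borel_measurable lborel" for n by measurable
  note dct = integral_dominated_convergence[OF lr shm wint AE_I2[OF lim] bd]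
    integrable_dominated_convergence[OF lr shm wint AE_I2[OF lim] bd]
  show "integrable lborel (\<lambda>s. left_rate U c s * indicator {0<..t} s)" by (rule dct(2))
  have "(\<integral>s. ?g s \<partial>lborel) = (\<integral>s. ?g (?e n + 1 * s) \<partial>lborel)" for n
    using lborel_integral_real_affine[of 1 ?g "?e n"] by simp
  then have "(\<lambda>n. \<integral>s. ?g s \<partial>lborel) \<longlonglongrightarrow> (\<integral>s. left_rate U c s * indicator {0<..t} s \<partial>lborel)"
    using dct(1) by simp
  then have "(\<integral>s. left_rate U c s * indicator {0<..t} s \<partial>lborel) = (\<integral>s. ?g s \<partial>lborel)"
    by (simp add: LIMSEQ_const_iff)
  also have "\<dots> = (LINT s:{0..t}|lborel. rate U c s)"
    unfolding set_lebesgue_integral_def by (intro Bochner_Integration.integral_cong) (auto simp: indicator_def)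
  finally show "(\<integral>s. left_rate U c s * indicator {0<..t} s \<partial>lborel) = (LINT s:{0..t}|lborel. rate U c s)" .
qed

definition abs_jumps :: "(real \<Rightarrow> 'a \<Rightarrow> real) \<Rightarrow> real \<Rightarrow> real \<Rightarrow> 'a \<Rightarrow> real" where
  "abs_jumps U c t \<omega> = (\<integral>p. (if 0 < fst p \<and> fst p \<le> t
      then \<bar>jump c (fst p) (left_lim U \<omega> (fst p)) (snd p)\<bar> else 0) \<partial>N c \<omega>)"

definition total_rate :: "(real \<Rightarrow> 'a \<Rightarrow> real) \<Rightarrow> real \<Rightarrow> real" where
  "total_rate U t = (LINT s:{0..t}|lborel. rate U 1 s) + (LINT s:{0..t}|lborel. rate U (-1) s)"

text \<open>The path estimate with clamped jumps. The sum of the jump sizes is kept on the left,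
  because in the mean this term pays for the drift.\<close>

lemma fixed_point_path_bound:
  assumes U: "cadlag_adapted U" and \<omega>: "\<omega> \<in> space M"
    and eq: "\<And>t. 0 \<le> t \<Longrightarrow> U t \<omega> = \<Phi> U t \<omega>" and t: "0 \<le> t"
  shows "\<bar>U t \<omega>\<bar> + (abs_jumps U 1 t \<omega> + abs_jumps U (-1) t \<omega>) \<le> \<bar>U0 \<omega>\<bar> + h * total_rate U t"
proof -
  let ?I = "\<lambda>c t. LINT s:{0..t}|lborel. rate U c s"
  obtain B C where B: "0 \<le> B" "\<And>c s' x. \<bar>c\<bar> = 1 \<Longrightarrow> s' \<le> t \<Longrightarrow> \<phi> (c * clamp s' x) \<le> B"
    using \<phi>_clamp_bounds[of t] by metis
  define f where "f c s = (if 0 < s \<and> s \<le> t \<and> \<bar>c\<bar> = 1 then \<phi> (c * clamp s (left_lim U \<omega> s)) else 0)" for c s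
  define b where "b s = clamp s (left_lim U \<omega> s)" for s
  have lm[measurable]: "left_lim U \<omega> \<in> borel_measurable borel"
    using measurable_Pair2[OF left_lim_measurable_joint[OF U] \<omega>] by simp
  have J: "(if 0 < fst p \<and> fst p \<le> r then jump c (fst p) (left_lim U \<omega> (fst p)) (snd p) else 0)
      = (if 0 < fst p \<and> fst p \<le> r \<and> snd p \<le> f c (fst p) then b (fst p) else 0)"
    "(if 0 < fst p \<and> fst p \<le> r then \<bar>jump c (fst p) (left_lim U \<omega> (fst p)) (snd p)\<bar> else 0)
      = (if 0 < fst p \<and> fst p \<le> r \<and> snd p \<le> f c (fst p) then \<bar>b (fst p)\<bar> else 0)"
    if "r \<le> t" "\<bar>c\<bar> = 1" for r c and p :: "real \<times> real"
    using that by (auto simp: jump_def f_def b_def)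
  have mono: "\<bar>?I c y - ?I c x\<bar> = ?I c y - ?I c x" if "0 \<le> x" "x \<le> y" "\<bar>c\<bar> = 1" for c x y
  proof -
    have "?I c x \<le> ?I c y"
      unfolding set_lebesgue_integral_def
      using rate_integrable[OF U that(3), of x] rate_integrable[OF U that(3), of y] that rate_nonneg
      by (intro integral_mono) (auto simp: set_integrable_def indicator_def)
    then show ?thesis by simp
  qed
  have "\<bar>U t \<omega>\<bar> + ((\<integral>p. (if 0 < fst p \<and> fst p \<le> t \<and> snd p \<le> f 1 (fst p) then \<bar>b (fst p)\<bar> else 0) \<partial>N 1 \<omega>)
       + (\<integral>p. (if 0 < fst p \<and> fst p \<le> t \<and> snd p \<le> f (-1) (fst p) then \<bar>b (fst p)\<bar> else 0) \<partial>N (-1) \<omega>))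
    \<le> \<bar>U0 \<omega>\<bar> + h * total_rate U t"
  proof (rule jump_path_bound[where T=t and v="left_lim U \<omega>" and f=f and m=B and a="drift U" and A="\<lambda>t. h * total_rate U t"])
    show "((\<lambda>t. U t \<omega>) \<longlongrightarrow> left_lim U \<omega> s) (at_left s)" if "0 < s" for s
      by (rule left_lim_tendsto[OF cadlag_adaptedD[OF U] \<omega> that])
    show "f c \<in> borel_measurable borel" for c unfolding f_def by measurable
    show "b \<in> borel_measurable borel" unfolding b_def by measurable
    show "f c s \<le> B" if "0 < s" "s \<le> t" for s c
      using that B by (auto simp: f_def)
    show "\<bar>left_lim U \<omega> s - r * b s\<bar> \<le> \<bar>left_lim U \<omega> s\<bar> - r * \<bar>b s\<bar>" if "0 \<le> r" "r \<le> 1" for s r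
      unfolding b_def by (rule clamp_contract[OF that])
    show "drift U 0 = 0" "h * total_rate U 0 = 0"
      by (simp_all only: drift_def total_rate_def set_integral_point) simp_all
    show "\<bar>drift U y - drift U x\<bar> \<le> h * total_rate U y - h * total_rate U x" if "0 \<le> x" "x \<le> y" for x y
    proof -
      have "\<bar>drift U y - drift U x\<bar> = h * \<bar>(?I 1 y - ?I 1 x) - (?I (-1) y - ?I (-1) x)\<bar>"
        unfolding drift_def right_diff_distrib[symmetric] abs_mult using h_nonneg by (simp add: algebra_simps)
      also have "\<dots> \<le> h * ((?I 1 y - ?I 1 x) + (?I (-1) y - ?I (-1) x))"
        using mono[OF that, of 1] mono[OF that, of "-1"] h_nonneg by (intro mult_left_mono) auto
      also have "\<dots> = h * total_rate U y - h * total_rate U x" by (simp add: total_rate_def algebra_simps)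
      finally show ?thesis .
    qed
    show "U r \<omega> = U0 \<omega> -
      ((\<integral>p. (if 0 < fst p \<and> fst p \<le> r \<and> snd p \<le> f 1 (fst p) then b (fst p) else 0) \<partial>N 1 \<omega>)
       + (\<integral>p. (if 0 < fst p \<and> fst p \<le> r \<and> snd p \<le> f (-1) (fst p) then b (fst p) else 0) \<partial>N (-1) \<omega>))
      + drift U r" if "0 \<le> r" "r \<le> t" for r
      using eq[OF that(1)] that(2) unfolding \<Phi>_def jumps_def by (simp add: J(1))
  qed (use \<omega> t in auto)
  then show ?thesis unfolding abs_jumps_def by (simp add: J(2))
qed

text \<open>After compensation the marks below the threshold integrate to the threshold itself: from
  a clamped state x a jump of size |x| occurs at rate \<phi>(c x).\<close>

lemma nn_integral_abs_jumps:
  assumes U: "cadlag_adapted U" and c: "\<bar>c\<bar> = 1"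
  shows "(\<lambda>\<omega>. ennreal (abs_jumps U c t \<omega>)) \<in> borel_measurable M"
    and "(\<integral>\<^sup>+\<omega>. ennreal (abs_jumps U c t \<omega>) \<partial>M) = (\<integral>\<^sup>+s. (\<integral>\<^sup>+\<omega>.
      ennreal (\<bar>clamp s (left_lim U \<omega> s)\<bar> * \<phi> (c * clamp s (left_lim U \<omega> s))) \<partial>M) * indicator {0<..t} s \<partial>lborel)"
proof -
  interpret P: pair_sigma_finite M "lborel :: real measure" ..
  let ?j = "\<lambda>\<omega> s z. ennreal \<bar>jump c s (left_lim U \<omega> s) z\<bar>"
  let ?d = "\<lambda>\<omega> s. ennreal (\<bar>clamp s (left_lim U \<omega> s)\<bar> * \<phi> (c * clamp s (left_lim U \<omega> s)))"
  have j: "(\<lambda>x. ?j (fst x) (fst (snd x)) (snd (snd x)) * indicator {0<..t} (fst (snd x))) \<in> borel_measurable predictable"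
    using jump_predictable[OF U, of c] by measurable
  have [measurable]: "(\<lambda>x. left_lim U (fst x) (snd x)) \<in> borel_measurable (M \<Otimes>\<^sub>M (lborel :: real measure))"
    using left_lim_measurable_joint[OF U]
    by (simp add: measurable_cong_sets[OF sets_pair_measure_cong[OF refl sets_lborel] refl])
  have eq: "ennreal (abs_jumps U c t \<omega>) = (\<integral>\<^sup>+p. ?j \<omega> (fst p) (snd p) * indicator {0<..t} (fst p) \<partial>N c \<omega>)"
    if \<omega>: "\<omega> \<in> space M" for \<omega>
  proof -
    have "integrable (N c \<omega>) (\<lambda>p. \<bar>if 0 < fst p \<and> fst p \<le> t then jump c (fst p) (left_lim U \<omega> (fst p)) (snd p) else 0\<bar>)"
      by (intro integrable_abs jumps_integrable U \<omega> c)
    then have "integrable (N c \<omega>) (\<lambda>p. if 0 < fst p \<and> fst p \<le> t then \<bar>jump c (fst p) (left_lim U \<omega> (fst p)) (snd p)\<bar> else 0)"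
      by (simp add: if_distrib cong: if_cong)
    then have "ennreal (abs_jumps U c t \<omega>) = (\<integral>\<^sup>+p. ennreal (if 0 < fst p \<and> fst p \<le> t then \<bar>jump c (fst p) (left_lim U \<omega> (fst p)) (snd p)\<bar> else 0) \<partial>N c \<omega>)"
      unfolding abs_jumps_def by (intro nn_integral_eq_integral[symmetric]) auto
    also have "\<dots> = (\<integral>\<^sup>+p. ?j \<omega> (fst p) (snd p) * indicator {0<..t} (fst p) \<partial>N c \<omega>)"
      by (intro nn_integral_cong) (auto simp: indicator_def)
    finally show ?thesis .
  qed
  have m: "(\<lambda>\<omega>. \<integral>\<^sup>+p. ?j \<omega> (fst p) (snd p) * indicator {0<..t} (fst p) \<partial>N c \<omega>) \<in> borel_measurable M"
    using borel_measurable_nn_integral_N[OF j, of c] by simp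
  then show "(\<lambda>\<omega>. ennreal (abs_jumps U c t \<omega>)) \<in> borel_measurable M"
    by (rule measurable_cong[THEN iffD2, rotated]) (rule eq)
  have "(\<integral>\<^sup>+\<omega>. ennreal (abs_jumps U c t \<omega>) \<partial>M)
    = (\<integral>\<^sup>+\<omega>. \<integral>\<^sup>+p. ?j \<omega> (fst p) (snd p) * indicator {0<..t} (fst p) \<partial>N c \<omega> \<partial>M)"
    by (intro nn_integral_cong eq)
  also have "\<dots> = (\<integral>\<^sup>+\<omega>. \<integral>\<^sup>+p. ?j \<omega> (fst p) (snd p) * indicator {0<..t} (fst p) * indicator jump_region p \<partial>lborel \<partial>M)"
    using compensator[OF j, of c] by simp
  also have "\<dots> = (\<integral>\<^sup>+\<omega>. \<integral>\<^sup>+s. ?d \<omega> s * indicator {0<..t} s \<partial>lborel \<partial>M)"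
  proof (rule nn_integral_cong)
    fix \<omega> assume \<omega>: "\<omega> \<in> space M"
    have m: "(\<lambda>p. ?j \<omega> (fst p) (snd p) * indicator {0<..t} (fst p) * indicator jump_region p) \<in> borel_measurable (lborel \<Otimes>\<^sub>M lborel)"
    proof -
      have [measurable]: "(\<lambda>p. ?j \<omega> (fst p) (snd p) * indicator {0<..t} (fst p)) \<in> borel_measurable borel"
        using predictable_section[OF j \<omega>] by simp
      have "(\<lambda>p. ?j \<omega> (fst p) (snd p) * indicator {0<..t} (fst p) * indicator jump_region p) \<in> borel_measurable borel"
        by measurable
      then show ?thesis unfolding lborel_prod by simp
    qed
    have "(\<integral>\<^sup>+p. ?j \<omega> (fst p) (snd p) * indicator {0<..t} (fst p) * indicator jump_region p \<partial>lborel)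
      = (\<integral>\<^sup>+s. \<integral>\<^sup>+z. ?j \<omega> s z * indicator {0<..t} s * indicator jump_region (s, z) \<partial>lborel \<partial>lborel)"
      using lborel.nn_integral_fst[OF m] by (simp add: lborel_prod)
    also have "\<dots> = (\<integral>\<^sup>+s. ?d \<omega> s * indicator {0<..t} s \<partial>lborel)"
    proof (rule nn_integral_cong)
      fix s :: real
      let ?x = "clamp s (left_lim U \<omega> s)"
      have "(\<integral>\<^sup>+z. ?j \<omega> s z * indicator {0<..t} s * indicator jump_region (s, z) \<partial>lborel)
        = (\<integral>\<^sup>+z. (ennreal \<bar>?x\<bar> * indicator {0<..t} s) * indicator {0..\<phi> (c * ?x)} z \<partial>lborel)"
        by (intro nn_integral_cong) (auto simp: jump_def jump_region_def indicator_def)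
      also have "\<dots> = ?d \<omega> s * indicator {0<..t} s"
        using \<phi>_nonneg by (subst nn_integral_cmult) (auto simp: ennreal_mult indicator_def)
      finally show "(\<integral>\<^sup>+z. ?j \<omega> s z * indicator {0<..t} s * indicator jump_region (s, z) \<partial>lborel) = ?d \<omega> s * indicator {0<..t} s" .
    qed
    finally show "(\<integral>\<^sup>+p. ?j \<omega> (fst p) (snd p) * indicator {0<..t} (fst p) * indicator jump_region p \<partial>lborel)
      = (\<integral>\<^sup>+s. ?d \<omega> s * indicator {0<..t} s \<partial>lborel)" .
  qed
  also have "\<dots> = (\<integral>\<^sup>+s. \<integral>\<^sup>+\<omega>. ?d \<omega> s * indicator {0<..t} s \<partial>M \<partial>lborel)"
    by (rule P.Fubini'[symmetric]) measurable
  also have "\<dots> = (\<integral>\<^sup>+s. (\<integral>\<^sup>+\<omega>. ?d \<omega> s \<partial>M) * indicator {0<..t} s \<partial>lborel)"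
  proof (rule nn_integral_cong)
    fix s :: real
    have [measurable]: "(\<lambda>\<omega>. left_lim U \<omega> s) \<in> borel_measurable M" by (rule left_lim_measurable[OF U])
    show "(\<integral>\<^sup>+\<omega>. ?d \<omega> s * indicator {0<..t} s \<partial>M) = (\<integral>\<^sup>+\<omega>. ?d \<omega> s \<partial>M) * indicator {0<..t} s"
      by (rule nn_integral_multc) measurable
  qed
  finally show "(\<integral>\<^sup>+\<omega>. ennreal (abs_jumps U c t \<omega>) \<partial>M) = (\<integral>\<^sup>+s. (\<integral>\<^sup>+\<omega>. ?d \<omega> s \<partial>M) * indicator {0<..t} s \<partial>lborel)" .
qed

text \<open>Pointwise in the state, 2 h \<phi> \<le> |x| \<phi> + 2 h D: beyond 2 h the jump size
  exceeds 2 h, and within that range \<phi> is at most D. Compensation yields the estimate for the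
  rates at left limits, and \<open>left_rate_integral\<close> passes to the rates of the
  drift.\<close>

lemma abs_jumps_lower_bound:
  assumes U: "cadlag_adapted U" and c: "\<bar>c\<bar> = 1" and t: "0 < t" and \<kappa>: "continuous_on UNIV \<kappa>"
    and D: "0 \<le> D" "\<And>x. \<bar>x\<bar> \<le> 2 * h \<Longrightarrow> \<phi> x \<le> D"
  shows "ennreal (2 * h * (LINT s:{0..t}|lborel. rate U c s))
    \<le> (\<integral>\<^sup>+\<omega>. ennreal (abs_jumps U c t \<omega>) \<partial>M) + ennreal (2 * h * D * t)"
proof -
  have lr0: "0 \<le> left_rate U c s" for s
    unfolding left_rate_def by (intro Bochner_Integration.integral_nonneg \<phi>_nonneg)
  let ?d = "\<lambda>\<omega> s. \<bar>clamp s (left_lim U \<omega> s)\<bar> * \<phi> (c * clamp s (left_lim U \<omega> s))"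
  have pt: "2 * h * \<phi> (c * x) \<le> \<bar>x\<bar> * \<phi> (c * x) + 2 * h * D" for x
  proof (cases "\<bar>x\<bar> \<le> 2 * h")
    case True
    then have "\<phi> (c * x) \<le> D" using c by (intro D(2)) (simp add: abs_mult)
    then have "2 * h * \<phi> (c * x) \<le> 2 * h * D" using h_nonneg by (intro mult_left_mono) auto
    moreover have "0 \<le> \<bar>x\<bar> * \<phi> (c * x)" using \<phi>_nonneg by simp
    ultimately show ?thesis by linarith
  next
    case False
    then have "2 * h * \<phi> (c * x) \<le> \<bar>x\<bar> * \<phi> (c * x)" using \<phi>_nonneg by (intro mult_right_mono) auto
    moreover have "0 \<le> 2 * h * D" using h_nonneg D(1) by simp
    ultimately show ?thesis by linarith
  qed
  have E: "ennreal (2 * h * left_rate U c s) \<le> (\<integral>\<^sup>+\<omega>. ennreal (?d \<omega> s) \<partial>M) + ennreal (2 * h * D)" for s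
  proof -
    have [measurable]: "(\<lambda>\<omega>. left_lim U \<omega> s) \<in> borel_measurable M" by (rule left_lim_measurable[OF U])
    have "ennreal (2 * h * left_rate U c s) = (\<integral>\<^sup>+\<omega>. ennreal (2 * h * \<phi> (c * clamp s (left_lim U \<omega> s))) \<partial>M)"
    proof -
      have int: "integrable M (\<lambda>\<omega>. 2 * h * \<phi> (c * clamp s (left_lim U \<omega> s)))"
        by (intro integrable_mult_right \<phi>_clamp_integrable c) measurable
      show ?thesis unfolding left_rate_def
        using nn_integral_eq_integral[OF int] \<phi>_nonneg h_nonneg by simp
    qed
    also have "\<dots> \<le> (\<integral>\<^sup>+\<omega>. ennreal (?d \<omega> s) + ennreal (2 * h * D) \<partial>M)"
      using pt \<phi>_nonneg h_nonneg D(1)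
      by (intro nn_integral_mono) (simp flip: ennreal_plus add: ennreal_leI)
    also have "\<dots> = (\<integral>\<^sup>+\<omega>. ennreal (?d \<omega> s) \<partial>M) + ennreal (2 * h * D)"
      by (subst nn_integral_add) (auto simp: emeasure_space_1)
    finally show ?thesis .
  qed
  have [measurable]: "(\<lambda>x. left_lim U (snd x) (fst x)) \<in> borel_measurable ((borel :: real measure) \<Otimes>\<^sub>M M)"
    using measurable_compose[OF measurable_pair_swap' left_lim_measurable_joint[OF U]] by (simp add: split_beta')
  have dm: "(\<lambda>s. (\<integral>\<^sup>+\<omega>. ennreal (?d \<omega> s) \<partial>M) * indicator {0<..t} s) \<in> borel_measurable lborel"
    by simp
  have "ennreal (2 * h * (LINT s:{0..t}|lborel. rate U c s)) = ennreal (\<integral>s. 2 * h * (left_rate U c s * indicator {0<..t} s) \<partial>lborel)"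
    unfolding left_rate_integral(2)[OF U c t \<kappa>, symmetric] by simp
  also have "\<dots> = (\<integral>\<^sup>+s. ennreal (2 * h * (left_rate U c s * indicator {0<..t} s)) \<partial>lborel)"
    using lr0 h_nonneg
    by (intro nn_integral_eq_integral[symmetric] integrable_mult_right left_rate_integral(1) U c t \<kappa>) auto
  also have "\<dots> \<le> (\<integral>\<^sup>+s. (\<integral>\<^sup>+\<omega>. ennreal (?d \<omega> s) \<partial>M) * indicator {0<..t} s + ennreal (2 * h * D) * indicator {0<..t} s \<partial>lborel)"
    using E by (intro nn_integral_mono) (auto simp: indicator_def)
  also have "\<dots> = (\<integral>\<^sup>+s. (\<integral>\<^sup>+\<omega>. ennreal (?d \<omega> s) \<partial>M) * indicator {0<..t} s \<partial>lborel) + ennreal (2 * h * D) * ennreal t"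
    using dm t by (subst nn_integral_add) (auto simp: nn_integral_cmult)
  also have "\<dots> = (\<integral>\<^sup>+\<omega>. ennreal (abs_jumps U c t \<omega>) \<partial>M) + ennreal (2 * h * D * t)"
    using nn_integral_abs_jumps(2)[OF U c, of t] h_nonneg D(1) t by (simp add: ennreal_mult)
  finally show ?thesis .
qed

text \<open>Jumps from heights above \<open>2 h\<close> lose twice as much as the drift gains per unit of jump rate,
  so that the total rate is controlled by the behaviour of \<open>\<phi>\<close> on \<open>{- 2 h..2 h}\<close>, whatever the
  truncation level \<open>\<kappa>\<close>.\<close>

lemma total_rate_bound:
  assumes U: "cadlag_adapted U" and eq: "AE \<omega> in M. \<forall>t\<ge>0. U t \<omega> = \<Phi> U t \<omega>"
    and \<kappa>: "continuous_on UNIV \<kappa>"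
    and L: "AE \<omega> in M. \<bar>U0 \<omega>\<bar> \<le> L"
    and D: "0 \<le> D" "\<And>x. \<bar>x\<bar> \<le> 2 * h \<Longrightarrow> \<phi> x \<le> D" and t: "0 < t"
  shows "h * total_rate U t \<le> L + 4 * h * D * t"
proof -
  let ?I = "\<lambda>c. LINT s:{0..t}|lborel. rate U c s"
  have I0: "0 \<le> ?I c" for c
    unfolding set_lebesgue_integral_def using rate_nonneg by (intro Bochner_Integration.integral_nonneg) auto
  have L0: "0 \<le> L"
  proof -
    have "AE \<omega> in M. 0 \<le> L" using L by eventually_elim auto
    then show ?thesis by simp
  qed
  have aj0: "0 \<le> abs_jumps U c t \<omega>" for c \<omega>
    unfolding abs_jumps_def by (intro Bochner_Integration.integral_nonneg) auto
  have "(\<integral>\<^sup>+\<omega>. ennreal (abs_jumps U 1 t \<omega>) \<partial>M) + (\<integral>\<^sup>+\<omega>. ennreal (abs_jumps U (-1) t \<omega>) \<partial>M)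
    = (\<integral>\<^sup>+\<omega>. ennreal (abs_jumps U 1 t \<omega>) + ennreal (abs_jumps U (-1) t \<omega>) \<partial>M)"
    by (intro nn_integral_add[symmetric] nn_integral_abs_jumps U) auto
  also have "\<dots> \<le> (\<integral>\<^sup>+\<omega>. ennreal (L + h * total_rate U t) \<partial>M)"
  proof (rule nn_integral_mono_AE)
    show "AE \<omega> in M. ennreal (abs_jumps U 1 t \<omega>) + ennreal (abs_jumps U (-1) t \<omega>) \<le> ennreal (L + h * total_rate U t)"
      using eq L AE_space
    proof eventually_elim
      case (elim \<omega>)
      have "abs_jumps U 1 t \<omega> + abs_jumps U (-1) t \<omega> \<le> L + h * total_rate U t"
        using fixed_point_path_bound[OF U elim(3), of t] elim(1,2) t by auto
      then show ?case using aj0 by (simp flip: ennreal_plus add: ennreal_leI)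
    qed
  qed
  also have "\<dots> = ennreal (L + h * total_rate U t)" by (simp add: emeasure_space_1)
  finally have upper: "(\<integral>\<^sup>+\<omega>. ennreal (abs_jumps U 1 t \<omega>) \<partial>M) + (\<integral>\<^sup>+\<omega>. ennreal (abs_jumps U (-1) t \<omega>) \<partial>M)
    \<le> ennreal (L + h * total_rate U t)" .
  have "ennreal (2 * h * total_rate U t) = ennreal (2 * h * ?I 1) + ennreal (2 * h * ?I (-1))"
    using I0 h_nonneg by (simp add: total_rate_def distrib_left ennreal_plus)
  also have "\<dots> \<le> ((\<integral>\<^sup>+\<omega>. ennreal (abs_jumps U 1 t \<omega>) \<partial>M) + ennreal (2 * h * D * t))
    + ((\<integral>\<^sup>+\<omega>. ennreal (abs_jumps U (-1) t \<omega>) \<partial>M) + ennreal (2 * h * D * t))"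
    by (intro add_mono abs_jumps_lower_bound U t \<kappa> D) auto
  also have "\<dots> = ((\<integral>\<^sup>+\<omega>. ennreal (abs_jumps U 1 t \<omega>) \<partial>M) + (\<integral>\<^sup>+\<omega>. ennreal (abs_jumps U (-1) t \<omega>) \<partial>M))
    + (ennreal (2 * h * D * t) + ennreal (2 * h * D * t))"
    by (simp only: ac_simps)
  also have "\<dots> \<le> ennreal (L + h * total_rate U t) + (ennreal (2 * h * D * t) + ennreal (2 * h * D * t))"
    by (intro add_mono upper order_refl)
  also have "\<dots> = ennreal ((L + h * total_rate U t) + (2 * h * D * t + 2 * h * D * t))"
  proof -
    have "0 \<le> L + h * total_rate U t" "0 \<le> 2 * h * D * t"
      using L0 I0 h_nonneg D(1) t by (auto simp: total_rate_def)
    then show ?thesis by (simp only: ennreal_plus add_nonneg_nonneg)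
  qed
  also have "(L + h * total_rate U t) + (2 * h * D * t + 2 * h * D * t) = L + h * total_rate U t + 4 * h * D * t"
    by simp
  \<comment> \<open>All terms are finite reals, so h times the total rate can be subtracted from
    both sides; comparing with 2 h instead of h is what leaves something on the left.\<close>
  finally have "2 * h * total_rate U t \<le> L + h * total_rate U t + 4 * h * D * t"
    using L0 I0 h_nonneg D(1) t by (subst (asm) ennreal_le_iff) (auto simp: total_rate_def)
  then show ?thesis by simp
qed

end

section \<open>Removing the truncation\<close>

context truncated_sde
begin

lemma jumps_eq_jump_integral:
  assumes U: "cadlag_process M U" and \<omega>: "\<omega> \<in> space M" and le: "\<And>t. 0 \<le> t \<Longrightarrow> \<bar>U t \<omega>\<bar> \<le> \<kappa> t"
  shows "jumps U c t \<omega> = jump_integral (N c) U \<phi> c \<omega> t"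
proof -
  have "clamp s (left_lim U \<omega> s) = left_lim U \<omega> s" if "0 < s" for s
  proof (rule clamp_eq, rule left_lim_bounded[OF U \<omega> that])
    show "\<bar>U r \<omega>\<bar> \<le> \<kappa> s" if "0 \<le> r" "r < s" for r
      using le[OF that(1)] \<kappa>_le[of r s] that by linarith
  qed
  then show ?thesis
    unfolding jumps_def jump_integral_def jump_def
    by (intro Bochner_Integration.integral_cong) auto
qed

lemma rate_eq:
  assumes "AE \<omega> in M. \<bar>U s \<omega>\<bar> \<le> \<kappa> s" and [measurable]: "U s \<in> borel_measurable M"
  shows "rate U c s = (\<integral>\<omega>. \<phi> (c * U s \<omega>) \<partial>M)"
  unfolding rate_def
  by (intro integral_cong_AE) (use assms in \<open>auto simp: clamp_eq elim!: eventually_mono\<close>)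

text \<open>Below the level clamping changes neither values nor left limits, so the truncated and
  the original equation coincide. Uniqueness passes from the equation to the fixed point, existence
  in the other direction.\<close>

lemma fixed_point_iff_equation:
  assumes U: "cadlag_adapted U" and le: "AE \<omega> in M. \<forall>t\<ge>0. \<bar>U t \<omega>\<bar> \<le> \<kappa> t"
  shows "(AE \<omega> in M. \<forall>t\<ge>0. U t \<omega> = \<Phi> U t \<omega>) \<longleftrightarrow>
    (AE \<omega> in M. \<forall>t\<ge>0. U t \<omega> = U0 \<omega>
      - (jump_integral (N 1) U \<phi> 1 \<omega> t + jump_integral (N (-1)) U \<phi> (-1) \<omega> t)
      + h * ((LINT s:{0..t}|lborel. \<integral>\<omega>. \<phi> (1 * U s \<omega>) \<partial>M) - (LINT s:{0..t}|lborel. \<integral>\<omega>. \<phi> (-1 * U s \<omega>) \<partial>M)))"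
proof -
  have rate: "rate U c s = (\<integral>\<omega>. \<phi> (c * U s \<omega>) \<partial>M)" if "0 \<le> s" for c s
    using le that by (intro rate_eq cadlag_adapted_measurable[OF U]) (auto elim!: eventually_mono)
  have drift: "drift U t = h * ((LINT s:{0..t}|lborel. \<integral>\<omega>. \<phi> (1 * U s \<omega>) \<partial>M) - (LINT s:{0..t}|lborel. \<integral>\<omega>. \<phi> (-1 * U s \<omega>) \<partial>M))" for t
    unfolding drift_def
    by (intro arg_cong[where f="\<lambda>x. h * x"] arg_cong2[where f="(-)"] set_lebesgue_integral_cong) (auto simp: rate)
  have "AE \<omega> in M. (\<forall>t\<ge>0. U t \<omega> = \<Phi> U t \<omega>) \<longleftrightarrow> (\<forall>t\<ge>0. U t \<omega> = U0 \<omega>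
      - (jump_integral (N 1) U \<phi> 1 \<omega> t + jump_integral (N (-1)) U \<phi> (-1) \<omega> t)
      + h * ((LINT s:{0..t}|lborel. \<integral>\<omega>. \<phi> (1 * U s \<omega>) \<partial>M) - (LINT s:{0..t}|lborel. \<integral>\<omega>. \<phi> (-1 * U s \<omega>) \<partial>M)))"
    using le AE_space
  proof eventually_elim
    case (elim \<omega>)
    then show ?case
      unfolding \<Phi>_def drift using jumps_eq_jump_integral[OF cadlag_adaptedD[OF U] elim(2)] by simp
  qed
  then show ?thesis by (rule eventually_subst)
qed

end

context jump_noise
begin

text \<open>The solution concept for the regularised noise, with the drift as set integrals;
  \<open>is_solution_iff\<close> identifies it with the original one.\<close>

definition solves :: "(real \<Rightarrow> real) \<Rightarrow> real \<Rightarrow> ('a \<Rightarrow> real) \<Rightarrow> (real \<Rightarrow> 'a \<Rightarrow> real) \<Rightarrow> bool" where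
  "solves \<phi> h U0 U \<longleftrightarrow> cadlag_adapted U
    \<and> (\<forall>t\<ge>0. \<forall>c\<in>{-1, 1}. integrable M (\<lambda>\<omega>. \<phi> (c * U t \<omega>)))
    \<and> (\<forall>t\<ge>0. \<forall>c\<in>{-1, 1}. set_integrable lborel {0..t} (\<lambda>s. \<integral>\<omega>. \<phi> (c * U s \<omega>) \<partial>M))
    \<and> (AE \<omega> in M. \<forall>t\<ge>0. U t \<omega> = U0 \<omega>
      - (jump_integral (N 1) U \<phi> 1 \<omega> t + jump_integral (N (-1)) U \<phi> (-1) \<omega> t)
      + h * ((LINT s:{0..t}|lborel. \<integral>\<omega>. \<phi> (1 * U s \<omega>) \<partial>M) - (LINT s:{0..t}|lborel. \<integral>\<omega>. \<phi> (-1 * U s \<omega>) \<partial>M)))"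

text \<open>The bound is L plus the drift integrals of the solution itself, which are deterministic
  because the drift involves expectations only. It depends on the solution, which is harmless where
  it merely has to provide some truncation level.\<close>

lemma solves_bounded:
  assumes U: "solves \<phi> h U0 U" and \<phi>: "locally_lipschitz \<phi>" "\<And>x. 0 \<le> \<phi> x" and h: "0 \<le> h"
    and L: "AE \<omega> in M. \<bar>U0 \<omega>\<bar> \<le> L"
  obtains \<kappa> where "mono \<kappa>" "\<And>s. L \<le> \<kappa> s" "AE \<omega> in M. \<forall>t\<ge>0. \<bar>U t \<omega>\<bar> \<le> \<kappa> t"
proof -
  let ?I = "\<lambda>c t. LINT s:{0..t}|lborel. \<integral>\<omega>. \<phi> (c * U s \<omega>) \<partial>M"
  \<comment> \<open>\<open>max 0 t\<close> extends the level monotonically to negative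
    times.\<close>
  let ?\<kappa> = "\<lambda>t. L + h * (?I 1 (max 0 t) + ?I (-1) (max 0 t))"
  have int: "set_integrable lborel {0..t} (\<lambda>s. \<integral>\<omega>. \<phi> (c * U s \<omega>) \<partial>M)" if "0 \<le> t" "c = 1 \<or> c = -1" for t c
    using U that unfolding solves_def by blast
  have Imono: "?I c x \<le> ?I c y" if "0 \<le> x" "x \<le> y" "c = 1 \<or> c = -1" for c x y
    unfolding set_lebesgue_integral_def
    using int[of y c] int[of x c] that \<phi>(2)
    by (intro integral_mono) (auto simp: set_integrable_def indicator_def intro!: Bochner_Integration.integral_nonneg)
  have I0: "0 \<le> ?I c t" for c t
    unfolding set_lebesgue_integral_def using \<phi>(2)
    by (intro Bochner_Integration.integral_nonneg) (auto simp: indicator_def intro!: Bochner_Integration.integral_nonneg)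
  show thesis
  proof (rule that[of ?\<kappa>])
    show "mono ?\<kappa>"
      using h by (intro monoI add_left_mono mult_left_mono add_mono Imono) auto
    show "L \<le> ?\<kappa> s" for s using I0[of "max 0 s" 1] I0[of "max 0 s" "-1"] h by simp
    show "AE \<omega> in M. \<forall>t\<ge>0. \<bar>U t \<omega>\<bar> \<le> ?\<kappa> t"
      using U[unfolded solves_def, THEN conjunct2, THEN conjunct2, THEN conjunct2] L AE_space
    proof eventually_elim
      case (elim \<omega>)
      show ?case
      proof (intro allI impI)
        fix t :: real assume t: "0 \<le> t"
        have "\<bar>U t \<omega>\<bar> \<le> \<bar>U0 \<omega>\<bar> + h * (?I 1 t + ?I (-1) t)"
          using U elim(1) by (intro solution_path_bound int \<phi> h t elim(3) locally_lipschitz_continuous) (auto simp: solves_def)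
        then show "\<bar>U t \<omega>\<bar> \<le> ?\<kappa> t" using elim(2) t by (simp add: max_def)
      qed
    qed
  qed
qed

text \<open>The larger of the two levels dominates both solutions, so both are fixed points of one
  and the same truncated map.\<close>

lemma solves_unique:
  assumes U: "solves \<phi> h U0 U" and V: "solves \<phi> h U0 V"
    and \<phi>: "locally_lipschitz \<phi>" "\<And>x. 0 \<le> \<phi> x" and h: "0 \<le> h"
    and U0: "U0 \<in> borel_measurable M" and L: "0 \<le> L" "AE \<omega> in M. \<bar>U0 \<omega>\<bar> \<le> L"
  shows "AE \<omega> in M. \<forall>t\<ge>0. U t \<omega> = V t \<omega>"
proof -
  obtain \<kappa>1 where \<kappa>1: "mono \<kappa>1" "\<And>s. L \<le> \<kappa>1 s" "AE \<omega> in M. \<forall>t\<ge>0. \<bar>U t \<omega>\<bar> \<le> \<kappa>1 t"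
    using solves_bounded[OF U \<phi> h L(2)] by blast
  obtain \<kappa>2 where \<kappa>2: "mono \<kappa>2" "\<And>s. L \<le> \<kappa>2 s" "AE \<omega> in M. \<forall>t\<ge>0. \<bar>V t \<omega>\<bar> \<le> \<kappa>2 t"
    using solves_bounded[OF V \<phi> h L(2)] by blast
  define \<kappa> where "\<kappa> t = max (\<kappa>1 t) (\<kappa>2 t)" for t
  interpret T: truncated_sde M F N \<phi> \<kappa> h U0
  proof
    show "mono \<kappa>" unfolding \<kappa>_def
      by (intro monoI max.mono monoD[OF \<kappa>1(1)] monoD[OF \<kappa>2(1)])
    show "0 \<le> \<kappa> s" for s using L(1) \<kappa>1(2)[of s] by (auto simp: \<kappa>_def)
  qed (use \<phi> h U0 in auto)
  have cU: "cadlag_adapted U" and cV: "cadlag_adapted V" using U V by (auto simp: solves_def)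
  have "AE \<omega> in M. \<forall>t\<ge>0. \<bar>U t \<omega>\<bar> \<le> \<kappa> t" using \<kappa>1(3) by eventually_elim (auto simp: \<kappa>_def le_max_iff_disj)
  note fU = T.fixed_point_iff_equation[OF cU this]
  have "AE \<omega> in M. \<forall>t\<ge>0. \<bar>V t \<omega>\<bar> \<le> \<kappa> t" using \<kappa>2(3) by eventually_elim (auto simp: \<kappa>_def le_max_iff_disj)
  note fV = T.fixed_point_iff_equation[OF cV this]
  show ?thesis
    by (rule T.fixed_point_unique[OF cU cV]) (use U V fU fV in \<open>simp_all only: solves_def\<close>)
qed

text \<open>The choice of the level is not circular: the bound on the total rate of the truncated
  solution involves L, h and D, but not the level.\<close>

lemma solves_exists:
  assumes \<phi>: "locally_lipschitz \<phi>" "\<And>x. 0 \<le> \<phi> x" and h: "0 \<le> h"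
    and L: "0 \<le> L" "AE \<omega> in M. \<bar>U0 \<omega>\<bar> \<le> L"
    and N_adapted: "\<And>c t A. 0 \<le> t \<Longrightarrow> A \<in> sets borel \<Longrightarrow> A \<subseteq> {..t} \<times> UNIV \<Longrightarrow>
      (\<lambda>\<omega>. emeasure (N c \<omega>) A) \<in> borel_measurable (F t)"
    and U0: "U0 \<in> borel_measurable (F 0)"
    and null: "\<And>A. A \<in> null_sets M \<Longrightarrow> A \<in> sets (F 0)"
  shows "\<exists>U. solves \<phi> h U0 U"
proof -
  have "compact (\<phi> ` {- (2 * h)..2 * h})"
    using locally_lipschitz_continuous[OF \<phi>(1)]
    by (intro compact_continuous_image compact_Icc) (auto intro: continuous_on_subset)
  then have "bdd_above (\<phi> ` {- (2 * h)..2 * h})" by (intro bounded_imp_bdd_above compact_imp_bounded)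
  then obtain D where D': "\<And>y. y \<in> \<phi> ` {- (2 * h)..2 * h} \<Longrightarrow> y \<le> D" unfolding bdd_above_def by blast
  then have D: "\<phi> x \<le> D" if "\<bar>x\<bar> \<le> 2 * h" for x using that by (simp add: abs_le_iff)
  have D0: "0 \<le> D" using D[of 0] \<phi>(2)[of 0] h by simp
  \<comment> \<open>One L bounds the initial value, and L + 4 h D t is the bound of
    \<open>total_rate_bound\<close> on h times the total rate; \<open>fixed_point_path_bound\<close>
    adds the two.\<close>
  define \<kappa> where "\<kappa> t = 2 * L + 4 * h * D * max 0 t" for t :: real
  interpret T: adapted_truncated_sde M F N \<phi> \<kappa> h U0
  proof
    show "mono \<kappa>" unfolding \<kappa>_def using h D0 by (intro monoI add_left_mono mult_left_mono) auto
    show "0 \<le> \<kappa> s" for s using L(1) h D0 by (simp add: \<kappa>_def)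
    show "U0 \<in> borel_measurable M" by (rule measurable_F[OF _ U0]) simp
  qed (use \<phi> h N_adapted U0 null in auto)
  have \<kappa>c: "continuous_on UNIV \<kappa>" unfolding \<kappa>_def by (intro continuous_intros)
  note sol = T.cadlag_adapted_sol T.sol_fixed_point
  have hR: "h * T.total_rate T.sol t \<le> L + 4 * h * D * t" if "0 \<le> t" for t
  proof (cases "t = 0")
    case True
    then show ?thesis using L(1) by (simp only: T.total_rate_def set_integral_point) simp
  next
    case False
    then show ?thesis using T.total_rate_bound[OF sol \<kappa>c L(2) D0 D] that by simp
  qed
  have aj: "0 \<le> T.abs_jumps T.sol c t \<omega>" for c t \<omega>
    unfolding T.abs_jumps_def by (intro Bochner_Integration.integral_nonneg) auto
  have le: "AE \<omega> in M. \<forall>t\<ge>0. \<bar>T.sol t \<omega>\<bar> \<le> \<kappa> t"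
    using sol(2) L(2) AE_space
  proof eventually_elim
    case (elim \<omega>)
    show ?case
    proof (intro allI impI)
      fix t :: real assume t: "0 \<le> t"
      have "\<bar>T.sol t \<omega>\<bar> + (T.abs_jumps T.sol 1 t \<omega> + T.abs_jumps T.sol (-1) t \<omega>) \<le> \<bar>U0 \<omega>\<bar> + h * T.total_rate T.sol t"
        using elim(1) by (intro T.fixed_point_path_bound sol(1) elim(3) t) auto
      then show "\<bar>T.sol t \<omega>\<bar> \<le> \<kappa> t"
        using aj[of 1 t \<omega>] aj[of "-1" t \<omega>] hR[OF t] elim(2) t by (simp add: \<kappa>_def)
    qed
  qed
  have m: "T.sol t \<in> borel_measurable M" if "0 \<le> t" for t by (rule cadlag_adapted_measurable[OF sol(1) that])
  have rate: "T.rate T.sol c s = (\<integral>\<omega>. \<phi> (c * T.sol s \<omega>) \<partial>M)" if "0 \<le> s" for c s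
    using le that by (intro T.rate_eq m) (auto elim!: eventually_mono)
  have "solves \<phi> h U0 T.sol"
    unfolding solves_def
  proof (intro conjI allI impI ballI sol(1))
    fix t c :: real assume t: "0 \<le> t" and c: "c \<in> {-1, 1}"
    then have c1: "\<bar>c\<bar> = 1" by auto
    have [measurable]: "T.sol t \<in> borel_measurable M" by (rule m[OF t])
    have "integrable M (\<lambda>\<omega>. \<phi> (c * T.clamp t (T.sol t \<omega>)))" by (rule T.\<phi>_clamp_integrable[OF m[OF t] c1])
    moreover have "AE \<omega> in M. \<phi> (c * T.clamp t (T.sol t \<omega>)) = \<phi> (c * T.sol t \<omega>)"
      using le by eventually_elim (use t in \<open>auto simp: T.clamp_eq\<close>)
    ultimately show "integrable M (\<lambda>\<omega>. \<phi> (c * T.sol t \<omega>))"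
      by (subst (asm) integrable_cong_AE) auto
    show "set_integrable lborel {0..t} (\<lambda>s. \<integral>\<omega>. \<phi> (c * T.sol s \<omega>) \<partial>M)"
    proof -
      have "set_integrable lborel {0..t} (T.rate T.sol c) \<longleftrightarrow> set_integrable lborel {0..t} (\<lambda>s. \<integral>\<omega>. \<phi> (c * T.sol s \<omega>) \<partial>M)"
        by (intro set_integrable_cong) (auto simp: rate)
      then show ?thesis using T.rate_integrable[OF sol(1) c1] by simp
    qed
  next
    show "AE \<omega> in M. \<forall>t\<ge>0. T.sol t \<omega> = U0 \<omega>
      - (jump_integral (N 1) T.sol \<phi> 1 \<omega> t + jump_integral (N (-1)) T.sol \<phi> (-1) \<omega> t)
      + h * ((LINT s:{0..t}|lborel. \<integral>\<omega>. \<phi> (1 * T.sol s \<omega>) \<partial>M) - (LINT s:{0..t}|lborel. \<integral>\<omega>. \<phi> (-1 * T.sol s \<omega>) \<partial>M))"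
      using sol(2) unfolding T.fixed_point_iff_equation[OF sol(1) le] .
  qed
  then show ?thesis by blast
qed

end

section \<open>Independence properties of Poisson random measures\<close>

context prob_space
begin

lemma poisson_random_measureD:
  assumes "poisson_random_measure M N"
  shows "\<And>\<omega>. \<omega> \<in> space M \<Longrightarrow> sets (N \<omega>) = sets borel"
    and "\<And>A. A \<in> sets borel \<Longrightarrow> (\<lambda>\<omega>. emeasure (N \<omega>) A) \<in> borel_measurable M"
    and "\<And>A k. A \<in> sets borel \<Longrightarrow> A \<subseteq> quadrant \<Longrightarrow> emeasure lborel A < \<infinity> \<Longrightarrow>
        prob {\<omega>\<in>space M. emeasure (N \<omega>) A = of_nat k} = exp (- measure lborel A) * measure lborel A ^ k / fact k"
    and "\<And>(I :: nat set) A. finite I \<Longrightarrow> (\<And>i. i \<in> I \<Longrightarrow> A i \<in> sets borel) \<Longrightarrow> disjoint_family_on A I \<Longrightarrow>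
        indep_vars (\<lambda>_. borel) (\<lambda>i \<omega>. emeasure (N \<omega>) (A i)) I"
proof -
  note d = assms[unfolded poisson_random_measure_def]
  show "\<And>\<omega>. \<omega> \<in> space M \<Longrightarrow> sets (N \<omega>) = sets borel" using d[THEN conjunct1] by blast
  show "\<And>A. A \<in> sets borel \<Longrightarrow> (\<lambda>\<omega>. emeasure (N \<omega>) A) \<in> borel_measurable M"
    using d[THEN conjunct2, THEN conjunct1] by blast
  show "\<And>A k. A \<in> sets borel \<Longrightarrow> A \<subseteq> quadrant \<Longrightarrow> emeasure lborel A < \<infinity> \<Longrightarrow>
      prob {\<omega>\<in>space M. emeasure (N \<omega>) A = of_nat k} = exp (- measure lborel A) * measure lborel A ^ k / fact k"
    using d[THEN conjunct2, THEN conjunct2, THEN conjunct1] by blast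
  show "\<And>(I :: nat set) A. finite I \<Longrightarrow> (\<And>i. i \<in> I \<Longrightarrow> A i \<in> sets borel) \<Longrightarrow> disjoint_family_on A I \<Longrightarrow>
      indep_vars (\<lambda>_. borel) (\<lambda>i \<omega>. emeasure (N \<omega>) (A i)) I"
    using d[THEN conjunct2, THEN conjunct2, THEN conjunct2] by blast
qed

text \<open>Independence is given for disjoint sets, but the A i may overlap. The past is cut into
  the pieces of points that lie in exactly the A i with i in J. Counts of the A i are sums over
  these pieces, which are disjoint from each other and from B.\<close>

lemma poisson_past_vector_indep:
  fixes A :: "nat \<Rightarrow> (real \<times> real) set" and C :: "nat \<Rightarrow> ennreal set"
  assumes N: "poisson_random_measure M N"
    and A: "\<And>i. i < n \<Longrightarrow> A i \<in> past_sets s" and C: "\<And>i. i < n \<Longrightarrow> C i \<in> sets borel"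
    and B: "B \<in> future_sets s" and S: "S \<in> sets borel"
  shows "prob ({\<omega>\<in>space M. \<forall>i<n. emeasure (N \<omega>) (A i) \<in> C i} \<inter> {\<omega>\<in>space M. emeasure (N \<omega>) B \<in> S})
    = prob {\<omega>\<in>space M. \<forall>i<n. emeasure (N \<omega>) (A i) \<in> C i} * prob {\<omega>\<in>space M. emeasure (N \<omega>) B \<in> S}"
proof -
  note P = poisson_random_measureD[OF N]
  let ?past = "{..s} \<times> UNIV :: (real \<times> real) set"
  have past: "?past \<in> sets borel" by (intro borel_Times) auto
  have Ab: "A i \<in> sets borel" "A i \<subseteq> ?past" if "i < n" for i using A[OF that] by (auto simp: past_sets_def)
  have Bb: "B \<in> sets borel" "B \<subseteq> {s<..} \<times> UNIV" using B by (auto simp: future_sets_def)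
  define D where "D J = {p \<in> ?past. \<forall>i<n. p \<in> A i \<longleftrightarrow> i \<in> J}" for J
  have D: "D J \<in> sets borel" for J
  proof -
    have "D J = ?past \<inter> (\<Inter>i<n. if i \<in> J then A i else - A i)"
      by (auto simp: D_def split: if_splits)
    moreover have "?past \<inter> (\<Inter>i<n. if i \<in> J then A i else - A i) \<in> sets borel"
    proof (cases "n = 0")
      case True
      then show ?thesis using past by simp
    next
      case False
      then show ?thesis using past Ab(1)
        by (intro sets.Int sets.finite_INT) (auto intro!: borel_comp)
    qed
    ultimately show ?thesis by simp
  qed
  \<comment> \<open>The independent families are indexed by natural numbers: index 0 holds B, and
    the successor of the binary code of J holds the piece of J.\<close>
  define E where "E k = (case k of 0 \<Rightarrow> B | Suc m \<Rightarrow> D (set_decode m))" for k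
  let ?code = "\<lambda>J. Suc (set_encode J)"
  define K where "K = ?code ` Pow {..<n}"
  have finJ: "finite J" if "J \<in> Pow {..<n}" for J using that finite_subset by auto
  have E0: "E 0 = B" by (simp add: E_def)
  have Ec: "E (?code J) = D J" if "J \<in> Pow {..<n}" for J using finJ[OF that] by (simp add: E_def set_encode_inverse)
  have inj: "inj_on ?code (Pow {..<n})"
    using finJ by (auto simp: inj_on_def set_encode_eq)
  have disjD: "D J \<inter> D J' = {}" if "J \<in> Pow {..<n}" "J' \<in> Pow {..<n}" "J \<noteq> J'" for J J'
    using that by (force simp: D_def)
  have DB: "D J \<inter> B = {}" for J using Bb by (force simp: D_def)
  have "disjoint_family_on E (insert 0 K)"
    unfolding disjoint_family_on_def
  proof (intro ballI impI)
    fix k k' assume k: "k \<in> insert 0 K" "k' \<in> insert 0 K" "k \<noteq> k'"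
    then consider J where "k = 0" "k' = ?code J" "J \<in> Pow {..<n}" | J where "k' = 0" "k = ?code J" "J \<in> Pow {..<n}"
      | J J' where "k = ?code J" "k' = ?code J'" "J \<in> Pow {..<n}" "J' \<in> Pow {..<n}" "J \<noteq> J'"
      by (auto simp: K_def)
    then show "E k \<inter> E k' = {}"
      by cases (use DB disjD in \<open>simp_all add: Ec E0 Int_commute del: Pow_iff\<close>)
  qed
  moreover have "E k \<in> sets borel" for k using Bb(1) D by (cases k) (simp_all add: E_def)
  moreover have "finite (insert 0 K)" by (simp add: K_def)
  ultimately have ind: "indep_vars (\<lambda>_. borel) (\<lambda>k \<omega>. emeasure (N \<omega>) (E k)) (insert 0 K)"
    by (intro P(4))
  have "0 \<notin> K" by (auto simp: K_def)
  then have iv: "indep_var (PiM K (\<lambda>_. borel)) (\<lambda>\<omega>. restrict (\<lambda>k. emeasure (N \<omega>) (E k)) K)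
      (PiM {0} (\<lambda>_. borel)) (\<lambda>\<omega>. restrict (\<lambda>k. emeasure (N \<omega>) (E k)) {0})"
    by (intro indep_var_restrict[OF ind]) auto
  have code_K: "?code J \<in> K" if "J \<in> Pow {..<n}" for J using that by (auto simp: K_def)
  let ?S = "\<lambda>i f. \<Sum>J\<in>{J \<in> Pow {..<n}. i \<in> J}. f (?code J) :: ennreal"
  have decomp: "emeasure (N \<omega>) (A i) = ?S i (\<lambda>k. emeasure (N \<omega>) (E k))" if "i < n" "\<omega> \<in> space M" for i \<omega>
  proof -
    have "A i = (\<Union>J\<in>{J \<in> Pow {..<n}. i \<in> J}. D J)"
    proof (intro equalityI subsetI)
      fix p assume p: "p \<in> A i"
      define J where "J = {j. j < n \<and> p \<in> A j}"
      have "J \<in> {J \<in> Pow {..<n}. i \<in> J}" using p that by (auto simp: J_def)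
      moreover have "p \<in> D J" using p Ab(2)[OF that(1)] by (auto simp: D_def J_def)
      ultimately show "p \<in> (\<Union>J\<in>{J \<in> Pow {..<n}. i \<in> J}. D J)" by blast
    qed (use that in \<open>auto simp: D_def\<close>)
    also have "emeasure (N \<omega>) \<dots> = (\<Sum>J\<in>{J \<in> Pow {..<n}. i \<in> J}. emeasure (N \<omega>) (D J))"
      using disjD D P(1)[OF that(2)] by (intro sum_emeasure[symmetric]) (auto simp: disjoint_family_on_def)
    also have "\<dots> = ?S i (\<lambda>k. emeasure (N \<omega>) (E k))" by (intro sum.cong) (auto simp: Ec)
    finally show ?thesis .
  qed
  define Xa where "Xa = {f \<in> space (PiM K (\<lambda>_. borel)). \<forall>i<n. ?S i f \<in> C i}"
  define Xb where "Xb = {f \<in> space (PiM {0::nat} (\<lambda>_. borel :: ennreal measure)). f 0 \<in> S}"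
  have Xa: "Xa \<in> sets (PiM K (\<lambda>_. borel))"
  proof -
    have [measurable]: "?S i \<in> borel_measurable (PiM K (\<lambda>_. borel))" for i
      by (intro borel_measurable_sum measurable_component_singleton code_K) auto
    have "{f \<in> space (PiM K (\<lambda>_. borel)). ?S i f \<in> C i} \<in> sets (PiM K (\<lambda>_. borel))" if "i < n" for i
      using C[OF that] by measurable
    then have "{f \<in> space (PiM K (\<lambda>_. borel)). \<forall>i\<in>{..<n}. ?S i f \<in> C i} \<in> sets (PiM K (\<lambda>_. borel))"
      by (intro sets.sets_Collect_finite_All) auto
    then show ?thesis unfolding Xa_def by (simp only: lessThan_iff Ball_def)
  qed
  have Xb: "Xb \<in> sets (PiM {0} (\<lambda>_. borel))" unfolding Xb_def using S by measurable
  have sumr: "?S i (restrict (\<lambda>k. emeasure (N \<omega>) (E k)) K) = ?S i (\<lambda>k. emeasure (N \<omega>) (E k))" for i \<omega>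
    using code_K by (intro sum.cong) auto
  have a: "(\<lambda>\<omega>. restrict (\<lambda>k. emeasure (N \<omega>) (E k)) K) -` Xa \<inter> space M = {\<omega>\<in>space M. \<forall>i<n. emeasure (N \<omega>) (A i) \<in> C i}"
  proof (rule set_eqI)
    fix \<omega>
    show "\<omega> \<in> (\<lambda>\<omega>. restrict (\<lambda>k. emeasure (N \<omega>) (E k)) K) -` Xa \<inter> space M \<longleftrightarrow> \<omega> \<in> {\<omega>\<in>space M. \<forall>i<n. emeasure (N \<omega>) (A i) \<in> C i}"
    proof (cases "\<omega> \<in> space M")
      case True
      have "restrict (\<lambda>k. emeasure (N \<omega>) (E k)) K \<in> space (PiM K (\<lambda>_. borel))" by (auto simp: space_PiM)
      then show ?thesis unfolding Xa_def vimage_def mem_Collect_eq Int_iff sumr using decomp[OF _ True] True by (simp only: simp_thms cong: imp_cong)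
    qed simp
  qed
  have b: "(\<lambda>\<omega>. restrict (\<lambda>k. emeasure (N \<omega>) (E k)) {0}) -` Xb \<inter> space M = {\<omega>\<in>space M. emeasure (N \<omega>) B \<in> S}"
    unfolding Xb_def by (auto simp: E0 space_PiM)
  have "prob ((\<lambda>\<omega>. (restrict (\<lambda>k. emeasure (N \<omega>) (E k)) K, restrict (\<lambda>k. emeasure (N \<omega>) (E k)) {0})) -` (Xa \<times> Xb) \<inter> space M)
    = prob {\<omega>\<in>space M. \<forall>i<n. emeasure (N \<omega>) (A i) \<in> C i} * prob {\<omega>\<in>space M. emeasure (N \<omega>) B \<in> S}"
    using indep_varD[OF iv Xa Xb] unfolding a b .
  moreover have "(\<lambda>\<omega>. (restrict (\<lambda>k. emeasure (N \<omega>) (E k)) K, restrict (\<lambda>k. emeasure (N \<omega>) (E k)) {0})) -` (Xa \<times> Xb) \<inter> space M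
    = {\<omega>\<in>space M. \<forall>i<n. emeasure (N \<omega>) (A i) \<in> C i} \<inter> {\<omega>\<in>space M. emeasure (N \<omega>) B \<in> S}"
    unfolding a[symmetric] b[symmetric] by auto
  ultimately show ?thesis by simp
qed

lemma count_event_sets:
  assumes "poisson_random_measure M N" "A \<in> sets borel" "S \<in> sets borel"
  shows "{\<omega>\<in>space M. emeasure (N \<omega>) A \<in> S} \<in> events"
  using poisson_random_measureD(2)[OF assms(1,2)] assms(3) by measurable

text \<open>Events that constrain finitely many past counts form an intersection-stable generator,
  on which \<open>poisson_past_vector_indep\<close> gives the product rule.\<close>

lemma poisson_past_indep:
  assumes N: "poisson_random_measure M N"
    and E: "E \<in> sigma_sets (space M) (count_events M N (past_sets s))"
    and B: "B \<in> future_sets s" and S: "S \<in> sets borel"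
  shows "prob (E \<inter> {\<omega>\<in>space M. emeasure (N \<omega>) B \<in> S}) = prob E * prob {\<omega>\<in>space M. emeasure (N \<omega>) B \<in> S}"
proof -
  note P = poisson_random_measureD[OF N]
  define cyl where "cyl n A C = {\<omega>\<in>space M. \<forall>i<n. emeasure (N \<omega>) (A i) \<in> C i}" for n :: nat and A C
  define ok where "ok n A C \<longleftrightarrow> (\<forall>i<n. A i \<in> past_sets s) \<and> (\<forall>i<n. C i \<in> sets (borel :: ennreal measure))" for n :: nat and A C
  define G where "G = {X. \<exists>n A C. X = cyl n A C \<and> ok n A C}"
  have GE: "\<exists>n A C. X = cyl n A C \<and> ok n A C" if "X \<in> G" for X
    using that unfolding G_def by simp
  have GI: "cyl n A C \<in> G" if "ok n A C" for n A C
    using that unfolding G_def by blast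
  let ?E = "{\<omega>\<in>space M. emeasure (N \<omega>) B \<in> S}"
  have E_ev: "?E \<in> events" using B S by (intro count_event_sets[OF N]) (auto simp: future_sets_def)
  have G_ev: "G \<subseteq> events"
  proof
    fix X assume "X \<in> G"
    then obtain n A C where X: "X = cyl n A C" "ok n A C" using GE by blast
    have "{\<omega>\<in>space M. \<forall>i\<in>{..<n}. emeasure (N \<omega>) (A i) \<in> C i} \<in> events"
    proof (rule sets.sets_Collect_finite_All)
      fix i assume "i \<in> {..<n}"
      then have "A i \<in> sets borel" "C i \<in> sets borel" using X(2) by (auto simp: past_sets_def ok_def)
      then show "{\<omega>\<in>space M. emeasure (N \<omega>) (A i) \<in> C i} \<in> events" by (rule count_event_sets[OF N])
    qed simp
    then show "X \<in> events" unfolding X(1) cyl_def by (simp only: lessThan_iff Ball_def)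
  qed
  have "indep_set G {?E}"
  proof (rule indep_setI[OF G_ev])
    fix a b assume aG: "a \<in> G" and "b \<in> {?E}"
    then have b: "b = ?E" by simp
    obtain n A C where a: "a = cyl n A C" "ok n A C" using GE[OF aG] by blast
    show "prob (a \<inter> b) = prob a * prob b"
      unfolding a(1) b cyl_def using a(2)[unfolded ok_def] by (intro poisson_past_vector_indep[OF N _ _ B S]) auto
  qed (use E_ev in auto)
  moreover have "Int_stable G"
  proof (rule Int_stableI)
    fix X Y assume XY: "X \<in> G" "Y \<in> G"
    obtain n A C where X: "X = cyl n A C" "ok n A C" using GE[OF XY(1)] by blast
    obtain m A' C' where Y: "Y = cyl m A' C'" "ok m A' C'" using GE[OF XY(2)] by blast
    \<comment> \<open>Two cylinders intersect in the cylinder over the concatenation of their sets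
      and constraints.\<close>
    let ?A = "\<lambda>i. if i < n then A i else A' (i - n)" and ?C = "\<lambda>i. if i < n then C i else C' (i - n)"
    have split: "(\<forall>i<n + m. Q i) \<longleftrightarrow> (\<forall>i<n. Q i) \<and> (\<forall>i<m. Q (n + i))" for Q :: "nat \<Rightarrow> bool"
    proof (intro iffI conjI allI impI)
      fix i assume Q: "(\<forall>i<n. Q i) \<and> (\<forall>i<m. Q (n + i))" and i: "i < n + m"
      show "Q i"
      proof (cases "i < n")
        case False
        then have "i - n < m" "n + (i - n) = i" using i by auto
        then show ?thesis using Q by metis
      qed (use Q in blast)
    qed auto
    have "\<omega> \<in> cyl (n + m) ?A ?C \<longleftrightarrow> \<omega> \<in> X \<inter> Y" for \<omega>
      unfolding X(1) Y(1) cyl_def mem_Collect_eq Int_iff split by (simp cong: imp_cong) blast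
    then have eq: "X \<inter> Y = cyl (n + m) ?A ?C" by blast
    have okC: "ok (n + m) ?A ?C"
      using X(2) Y(2) unfolding ok_def split by simp
    show "X \<inter> Y \<in> G" unfolding eq by (rule GI[OF okC])
  qed
  moreover have "Int_stable {?E}" by (auto simp: Int_stable_def)
  ultimately have ind: "indep_set (sigma_sets (space M) G) (sigma_sets (space M) {?E})"
    by (rule indep_set_sigma_sets)
  have "count_events M N (past_sets s) \<subseteq> G"
  proof
    fix X assume "X \<in> count_events M N (past_sets s)"
    then obtain A C where "X = (\<lambda>\<omega>. emeasure (N \<omega>) A) -` C \<inter> space M" "A \<in> past_sets s" "C \<in> sets borel"
      unfolding count_events_def by blast
    moreover have "(\<lambda>\<omega>. emeasure (N \<omega>) A) -` C \<inter> space M = cyl 1 (\<lambda>_. A) (\<lambda>_. C)" by (auto simp: cyl_def)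
    ultimately show "X \<in> G" using GI[of 1 "\<lambda>_. A" "\<lambda>_. C"] by (simp add: ok_def)
  qed
  then have "E \<in> sigma_sets (space M) G" using E sigma_sets_mono' by blast
  then show ?thesis by (intro indep_setD[OF ind]) (auto intro: sigma_sets.Basic)
qed

text \<open>Rational end points and integer heights leave countably many rectangles and so a single
  null set; p \<ge> 0 keeps them in the quadrant, where the Poisson law is prescribed.\<close>

lemma AE_integer_counts:
  assumes N: "poisson_random_measure M N"
  shows "AE \<omega> in M. \<forall>p\<in>\<rat>. \<forall>q\<in>\<rat>. \<forall>m::nat. 0 \<le> p \<longrightarrow> emeasure (N \<omega>) ({p<..q} \<times> {0..real m}) \<in> range of_nat"
proof -
  note P = poisson_random_measureD[OF N]
  have "AE \<omega> in M. 0 \<le> p \<longrightarrow> emeasure (N \<omega>) ({p<..q} \<times> {0..real m}) \<in> range of_nat" for p q m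
  proof (cases "0 \<le> p")
    case True
    have b: "{p<..q} \<times> {0..real m} \<in> sets borel" by (intro borel_Times) auto
    have l: "emeasure lborel ({p<..q} \<times> {0..real m}) < \<infinity>"
      unfolding lborel_prod[symmetric]
      by (cases "p \<le> q"; subst lborel.emeasure_pair_measure_Times) (auto simp: ennreal_mult_less_top emeasure_lborel_Icc_eq)
    have "AE \<omega> in M. emeasure (N \<omega>) ({p<..q} \<times> {0..real m}) \<in> range of_nat"
      using True by (intro AE_nat_of_poisson[OF P(2)[OF b] P(3)[OF b _ l]]) (auto simp: quadrant_def)
    then show ?thesis by eventually_elim simp
  qed simp
  then show ?thesis by (simp add: AE_ball_countable countable_rat AE_all_countable)
qed

end

section \<open>Regularised random measures and filtrations\<close>

context prob_space
begin

text \<open>By independence, at most one point in total has at least the probability exp (-2l) times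
  1 + 2l, and exp (-2l) \<ge> 1 - 2l turns this into 1 - 4 l^2.\<close>

lemma sparse_cell_prob:
  fixes X Y :: "'a \<Rightarrow> ennreal"
  assumes [measurable]: "X \<in> borel_measurable M" "Y \<in> borel_measurable M" and l: "0 \<le> l"
    and X: "\<And>k. prob {\<omega>\<in>space M. X \<omega> = of_nat k} = exp (- l) * l ^ k / fact k"
    and Y: "\<And>k. prob {\<omega>\<in>space M. Y \<omega> = of_nat k} = exp (- l) * l ^ k / fact k"
    and indep: "\<And>j k. prob ({\<omega>\<in>space M. X \<omega> = of_nat j} \<inter> {\<omega>\<in>space M. Y \<omega> = of_nat k})
      = prob {\<omega>\<in>space M. X \<omega> = of_nat j} * prob {\<omega>\<in>space M. Y \<omega> = of_nat k}"
  shows "prob {\<omega>\<in>space M. \<not> X \<omega> + Y \<omega> \<le> 1} \<le> 4 * l\<^sup>2"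
proof -
  let ?E = "\<lambda>j k. {\<omega>\<in>space M. X \<omega> = of_nat j} \<inter> {\<omega>\<in>space M. Y \<omega> = of_nat k}"
  have m[measurable]: "?E j k \<in> events" for j k by measurable
  have disj: "?E j k \<inter> ?E j' k' = {}" if "(j, k) \<noteq> (j', k')" for j k j' k' :: nat
    using that by auto
  have "prob (?E 0 0 \<union> ?E 1 0 \<union> ?E 0 1) = prob (?E 0 0) + prob (?E 1 0) + prob (?E 0 1)"
    using disj[of 0 0 1 0] disj[of 0 0 0 1] disj[of 1 0 0 1]
    by (subst finite_measure_Union; (subst finite_measure_Union)?) (auto simp del: of_nat_0 of_nat_1)
  also have "\<dots> = exp (- l) * exp (- l) * (1 + 2 * l)"
    unfolding indep X Y by (simp add: algebra_simps)
  also have "exp (- l) * exp (- l) = exp (- (2 * l))" by (simp flip: exp_add)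
  finally have p: "prob (?E 0 0 \<union> ?E 1 0 \<union> ?E 0 1) = exp (- (2 * l)) * (1 + 2 * l)" .
  have "(1 + - (2 * l)) * (1 + 2 * l) \<le> exp (- (2 * l)) * (1 + 2 * l)"
    using l by (intro mult_right_mono exp_ge_add_one_self) auto
  then have "1 - 4 * l\<^sup>2 \<le> prob (?E 0 0 \<union> ?E 1 0 \<union> ?E 0 1)"
    unfolding p by (simp add: algebra_simps power2_eq_square)
  also have "\<dots> \<le> prob {\<omega>\<in>space M. X \<omega> + Y \<omega> \<le> 1}"
    by (intro finite_measure_mono) auto
  finally have "1 - 4 * l\<^sup>2 \<le> prob {\<omega>\<in>space M. X \<omega> + Y \<omega> \<le> 1}" .
  moreover have "prob {\<omega>\<in>space M. \<not> X \<omega> + Y \<omega> \<le> 1} = 1 - prob {\<omega>\<in>space M. X \<omega> + Y \<omega> \<le> 1}"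
    by (intro prob_neg) measurable
  ultimately show ?thesis by simp
qed

text \<open>A cell of width T/n is bad with probability of order 1/n^2, so the n-th grid has a bad
  cell with probability of order 1/n. That every grid has one is therefore a null event. A single
  good grid per sample point is what \<open>finite_atoms_of_integer_valued\<close> asks for.\<close>

lemma AE_sparse_cells:
  fixes N1 N2 :: "'a \<Rightarrow> (real \<times> real) measure" and T m :: nat
  assumes N1: "poisson_random_measure M N1" and N2: "poisson_random_measure M N2"
    and indep: "\<And>A B j k. A \<in> sets borel \<Longrightarrow> B \<in> sets borel \<Longrightarrow>
      prob ({\<omega>\<in>space M. emeasure (N1 \<omega>) A = of_nat j} \<inter> {\<omega>\<in>space M. emeasure (N2 \<omega>) B = of_nat k})
      = prob {\<omega>\<in>space M. emeasure (N1 \<omega>) A = of_nat j} * prob {\<omega>\<in>space M. emeasure (N2 \<omega>) B = of_nat k}"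
  shows "AE \<omega> in M. \<exists>n>0. \<forall>i<n. emeasure (N1 \<omega>) ({real T * real i / real n<..real T * real (Suc i) / real n} \<times> {0..real m})
    + emeasure (N2 \<omega>) ({real T * real i / real n<..real T * real (Suc i) / real n} \<times> {0..real m}) \<le> 1"
proof -
  note P1 = poisson_random_measureD[OF N1] and P2 = poisson_random_measureD[OF N2]
  define cell where "cell n i = {real T * real i / real n<..real T * real (Suc i) / real n} \<times> {0..real m}" for n i :: nat
  have cb: "cell n i \<in> sets borel" for n i unfolding cell_def by (intro borel_Times) auto
  have cq: "cell n i \<subseteq> quadrant" for n i
  proof -
    have "0 \<le> real T * real i / real n" by simp
    then have "0 \<le> fst p" if "p \<in> cell n i" for p
      using that unfolding cell_def mem_Times_iff greaterThanAtMost_iff by linarith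
    then show ?thesis by (auto simp: quadrant_def cell_def)
  qed
  have le: "real T * real i / real n \<le> real T * real (Suc i) / real n" for n i
    by (intro divide_right_mono mult_left_mono) auto
  have diff: "real T * real (Suc i) / real n - real T * real i / real n = real T / real n" for n i
    by (simp add: field_simps flip: diff_divide_distrib)
  have ce: "emeasure lborel (cell n i) = ennreal (real T / real n * real m)" for n i
  proof -
    have "emeasure lborel (cell n i) = ennreal (real T / real n) * ennreal (real m)"
      unfolding cell_def lborel_prod[symmetric]
      using le[of i n] by (subst lborel.emeasure_pair_measure_Times) (auto simp: diff simp del: of_nat_Suc)
    also have "\<dots> = ennreal (real T / real n * real m)" by (rule ennreal_mult[symmetric]) simp_all
    finally show ?thesis .
  qed
  have cm: "measure lborel (cell n i) = real T / real n * real m" for n i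
    unfolding measure_def ce by simp
  have [measurable]: "(\<lambda>\<omega>. emeasure (N1 \<omega>) (cell n i)) \<in> borel_measurable M"
    "(\<lambda>\<omega>. emeasure (N2 \<omega>) (cell n i)) \<in> borel_measurable M" for n i
    by (rule P1(2)[OF cb], rule P2(2)[OF cb])
  let ?bad = "\<lambda>n i. {\<omega>\<in>space M. \<not> emeasure (N1 \<omega>) (cell n i) + emeasure (N2 \<omega>) (cell n i) \<le> 1}"
  have bad[measurable]: "?bad n i \<in> events" for n i by measurable
  have bad_le: "prob (?bad n i) \<le> 4 * (real T / real n * real m)\<^sup>2" for n i
  proof (rule sparse_cell_prob)
    show "prob {\<omega>\<in>space M. emeasure (N1 \<omega>) (cell n i) = of_nat k}
      = exp (- (real T / real n * real m)) * (real T / real n * real m) ^ k / fact k" for k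
      using P1(3)[OF cb cq, of n i k] by (simp add: ce cm)
    show "prob {\<omega>\<in>space M. emeasure (N2 \<omega>) (cell n i) = of_nat k}
      = exp (- (real T / real n * real m)) * (real T / real n * real m) ^ k / fact k" for k
      using P2(3)[OF cb cq, of n i k] by (simp add: ce cm)
  qed (use indep[OF cb cb] in auto)
  define B where "B = {\<omega>\<in>space M. \<forall>n. \<exists>i<Suc n. \<omega> \<in> ?bad (Suc n) i}"
  have B: "B \<in> events" unfolding B_def using bad by measurable
  have "prob B \<le> 4 * (real T)\<^sup>2 * (real m)\<^sup>2 * (1 / real (Suc n))" for n
  proof -
    have "prob B \<le> prob (\<Union>i<Suc n. ?bad (Suc n) i)"
      unfolding B_def by (intro finite_measure_mono) (auto simp del: not_le)
    also have "\<dots> \<le> (\<Sum>i<Suc n. prob (?bad (Suc n) i))"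
      using bad by (intro finite_measure_subadditive_finite) auto
    also have "\<dots> \<le> (\<Sum>i<Suc n. 4 * (real T / real (Suc n) * real m)\<^sup>2)"
      by (intro sum_mono bad_le)
    also have "\<dots> = 4 * (real T)\<^sup>2 * (real m)\<^sup>2 * (real (Suc n) / (real (Suc n))\<^sup>2)"
      by (simp add: power_mult_distrib power_divide del: of_nat_Suc)
    also have "real (Suc n) / (real (Suc n))\<^sup>2 = 1 / real (Suc n)" by (simp add: power2_eq_square del: of_nat_Suc)
    finally show ?thesis .
  qed
  moreover have "(\<lambda>n. 4 * (real T)\<^sup>2 * (real m)\<^sup>2 * (1 / real (Suc n))) \<longlonglongrightarrow> 4 * (real T)\<^sup>2 * (real m)\<^sup>2 * 0"
    by (intro tendsto_intros) (use lim_inverse_n'[THEN LIMSEQ_Suc] in simp)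
  ultimately have "prob B \<le> 0" by (intro LIMSEQ_le_const[of _ 0]) auto
  then have "B \<in> null_sets M" using B measure_nonneg[of M B] by (simp add: null_sets_def emeasure_eq_measure)
  then have "AE \<omega> in M. \<omega> \<notin> B" by (rule AE_not_in)
  then show ?thesis using AE_space
  proof eventually_elim
    case (elim \<omega>)
    then obtain n where n: "\<And>i. i < Suc n \<Longrightarrow> \<omega> \<notin> ?bad (Suc n) i" by (auto simp: B_def)
    then have "\<forall>i<Suc n. emeasure (N1 \<omega>) (cell (Suc n) i) + emeasure (N2 \<omega>) (cell (Suc n) i) \<le> 1"
      using elim by auto
    then show ?case unfolding cell_def by (intro exI[of _ "Suc n"]) simp
  qed
qed

end

section \<open>From the given random measures to a regular noise\<close>

definition regular_counts :: "(real \<times> real) measure \<Rightarrow> bool" where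
  "regular_counts \<mu> \<longleftrightarrow> (\<forall>p\<in>\<rat>. \<forall>q\<in>\<rat>. \<forall>m::nat. 0 \<le> p \<longrightarrow> emeasure \<mu> ({p<..q} \<times> {0..real m}) \<in> range of_nat)"

definition sparse_pair :: "(real \<times> real) measure \<Rightarrow> (real \<times> real) measure \<Rightarrow> bool" where
  "sparse_pair \<mu> \<nu> \<longleftrightarrow> (\<forall>T m::nat. \<exists>n>0. \<forall>i<n.
    emeasure \<mu> ({real T * real i / real n<..real T * real (Suc i) / real n} \<times> {0..real m})
    + emeasure \<nu> ({real T * real i / real n<..real T * real (Suc i) / real n} \<times> {0..real m}) \<le> 1)"

text \<open>All indices other than 1 give \<open>N2\<close>, so that the family is total on the
  reals, as \<open>jump_noise\<close> quantifies over all c.\<close>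

definition signed :: "('a \<Rightarrow> (real \<times> real) measure) \<Rightarrow> ('a \<Rightarrow> (real \<times> real) measure) \<Rightarrow> real \<Rightarrow> 'a \<Rightarrow> (real \<times> real) measure" where
  "signed N1 N2 c = (if c = 1 then N1 else N2)"

locale poisson_pair = prob_space M
  for M :: "'a measure" +
  fixes N1 N2 :: "'a \<Rightarrow> (real \<times> real) measure" and U0 :: "'a \<Rightarrow> real"
  assumes N1: "poisson_random_measure M N1" and N2: "poisson_random_measure M N2"
    and U0: "U0 \<in> borel_measurable M" and indep: "indep_data M N1 N2 U0"
begin

abbreviation "\<Sigma>0 \<equiv> sigma_sets (space M) (rv_events M U0)"
abbreviation "\<Sigma>1 \<equiv> sigma_sets (space M) (count_events M N1 (sets borel))"
abbreviation "\<Sigma>2 \<equiv> sigma_sets (space M) (count_events M N2 (sets borel))"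

lemma indep3:
  assumes "a \<in> \<Sigma>0" "x \<in> \<Sigma>1" "y \<in> \<Sigma>2"
  shows "prob (a \<inter> x \<inter> y) = prob a * prob x * prob y"
proof -
  let ?A = "\<lambda>i::nat. if i = 0 then a else if i = 1 then x else y"
  have "prob (\<Inter>i\<in>{0, 1, 2}. ?A i) = (\<Prod>i\<in>{0, 1, 2}. prob (?A i))"
    by (rule indep_setsD[OF indep[unfolded indep_data_def]]) (use assms in auto)
  then show ?thesis by (simp add: Int_ac mult_ac)
qed

lemma space_\<Sigma>: "space M \<in> sigma_sets (space M) X"
  by (rule sigma_sets_top)

lemma count_\<Sigma>:
  "A \<in> sets borel \<Longrightarrow> S \<in> sets borel \<Longrightarrow> {\<omega>\<in>space M. emeasure (N \<omega>) A \<in> S} \<in> sigma_sets (space M) (count_events M N (sets borel))"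
  by (rule sigma_sets.Basic) (auto simp: count_events_def)

lemma count_pair_indep:
  assumes "A \<in> sets borel" "B \<in> sets borel"
  shows "prob ({\<omega>\<in>space M. emeasure (N1 \<omega>) A = of_nat j} \<inter> {\<omega>\<in>space M. emeasure (N2 \<omega>) B = of_nat k})
      = prob {\<omega>\<in>space M. emeasure (N1 \<omega>) A = of_nat j} * prob {\<omega>\<in>space M. emeasure (N2 \<omega>) B = of_nat k}"
  using indep3[OF space_\<Sigma> count_\<Sigma>[OF assms(1), of "{of_nat j}"] count_\<Sigma>[OF assms(2), of "{of_nat k}"]]
  by (simp add: prob_space Int_absorb1 subset_iff Int_assoc[symmetric])

lemma signed_poisson: "poisson_random_measure M (signed N1 N2 c)"
  using N1 N2 by (simp add: signed_def)

lemma obtain_exceptional_set: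
  obtains Z where "Z \<in> null_sets M" "\<And>\<omega>. \<omega> \<in> space M - Z \<Longrightarrow>
    regular_counts (N1 \<omega>) \<and> regular_counts (N2 \<omega>) \<and> sparse_pair (N1 \<omega>) (N2 \<omega>)"
proof -
  have "AE \<omega> in M. sparse_pair (N1 \<omega>) (N2 \<omega>)"
    unfolding sparse_pair_def AE_all_countable using AE_sparse_cells[OF N1 N2 count_pair_indep] by blast
  moreover have "AE \<omega> in M. regular_counts (N1 \<omega>)" "AE \<omega> in M. regular_counts (N2 \<omega>)"
    unfolding regular_counts_def by (rule AE_integer_counts[OF N1], rule AE_integer_counts[OF N2])
  ultimately have "AE \<omega> in M. regular_counts (N1 \<omega>) \<and> regular_counts (N2 \<omega>) \<and> sparse_pair (N1 \<omega>) (N2 \<omega>)"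
    by eventually_elim simp
  then show thesis using that by (elim AE_E3) auto
qed

text \<open>The restriction discards points at time 0, which the equation does not count; on
  \<open>Z\<close> the null measure satisfies the pathwise axioms trivially.\<close>

definition regularised :: "'a set \<Rightarrow> real \<Rightarrow> 'a \<Rightarrow> (real \<times> real) measure" where
  "regularised Z c \<omega> = (if \<omega> \<in> space M - Z then density (signed N1 N2 c \<omega>) (indicator jump_region) else null_measure borel)"

text \<open>What compensation asks of a filtration: each future count of either noise is independent
  of the present. Compatible filtrations and the completed natural one both satisfy it, so the
  analysis is done once for both.\<close>

definition strong_filtration :: "(real \<Rightarrow> 'a set set) \<Rightarrow> bool" where
  "strong_filtration F \<longleftrightarrow> (\<forall>t\<ge>0. sigma_algebra (space M) (F t) \<and> F t \<subseteq> events)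
    \<and> (\<forall>s t. 0 \<le> s \<longrightarrow> s \<le> t \<longrightarrow> F s \<subseteq> F t)
    \<and> (\<forall>s A B S c. 0 \<le> s \<longrightarrow> A \<in> F s \<longrightarrow> B \<in> future_sets s \<longrightarrow> S \<in> sets borel \<longrightarrow>
        prob (A \<inter> {\<omega>\<in>space M. emeasure (signed N1 N2 c \<omega>) B \<in> S})
        = prob A * prob {\<omega>\<in>space M. emeasure (signed N1 N2 c \<omega>) B \<in> S})"

abbreviation filtration_measure :: "(real \<Rightarrow> 'a set set) \<Rightarrow> real \<Rightarrow> 'a measure" where
  "filtration_measure F \<equiv> \<lambda>t. sigma (space M) (F t)"

lemma sets_filtration_measure:
  assumes "strong_filtration F" "0 \<le> t"
  shows "sets (filtration_measure F t) = F t"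
proof -
  have "sigma_algebra (space M) (F t)" using assms by (simp add: strong_filtration_def)
  then show ?thesis
    by (metis sigma_algebra.sigma_sets_eq sets_measure_of sigma_algebra_iff2)
qed

lemma emeasure_regularised:
  assumes "\<omega> \<in> space M - Z" "A \<in> sets borel"
  shows "emeasure (regularised Z c \<omega>) A = emeasure (signed N1 N2 c \<omega>) (jump_region \<inter> A)"
proof -
  have "sets (signed N1 N2 c \<omega>) = sets borel"
    using assms(1) poisson_random_measureD(1)[OF signed_poisson[of c]] by blast
  then show ?thesis using assms by (simp add: regularised_def emeasure_restricted)
qed

lemma sets_regularised: "sets (regularised Z c \<omega>) = sets borel"
  using poisson_random_measureD(1)[OF signed_poisson[of c]] by (simp add: regularised_def)

lemma emeasure_regularised_eq:
  assumes "\<omega> \<in> space M" "A \<in> sets borel"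
  shows "emeasure (regularised Z c \<omega>) A = (if \<omega> \<in> Z then 0 else emeasure (signed N1 N2 c \<omega>) (jump_region \<inter> A))"
  using assms emeasure_regularised[of \<omega> Z A c] by (auto simp: regularised_def)

text \<open>The compensation axiom comes from the Poisson law and independence through
  \<open>nn_integral_poisson_indep\<close>, and the change on a null set does not affect it. The
  atom axiom comes from integer counts and sparse grids.\<close>

lemma jump_noise_regularised:
  assumes Z: "Z \<in> null_sets M" and reg: "\<And>\<omega>. \<omega> \<in> space M - Z \<Longrightarrow>
    regular_counts (N1 \<omega>) \<and> regular_counts (N2 \<omega>) \<and> sparse_pair (N1 \<omega>) (N2 \<omega>)"
    and F: "strong_filtration F"
  shows "jump_noise M (filtration_measure F) (regularised Z)"
proof
  have Zs: "Z \<in> events" using Z by auto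
  have Fsp: "space (filtration_measure F t) = space M" if "0 \<le> t" for t
    by (simp add: space_measure_of_conv)
  show "subalgebra M (filtration_measure F t)" if "0 \<le> t" for t
    unfolding subalgebra_def sets_filtration_measure[OF F that] Fsp[OF that]
    using F that by (simp add: strong_filtration_def)
  show "sets (filtration_measure F s) \<subseteq> sets (filtration_measure F t)" if "0 \<le> s" "s \<le> t" for s t
    using F that by (simp add: sets_filtration_measure strong_filtration_def)
  show sets_R: "sets (regularised Z c \<omega>) = sets borel" for c \<omega> by (rule sets_regularised)
  show "emeasure (regularised Z c \<omega>) (- jump_region) = 0" for c \<omega>
  proof (cases "\<omega> \<in> space M - Z")
    case True
    then show ?thesis by (subst emeasure_regularised) (auto intro!: borel_comp)
  next
    case False
    then have "regularised Z c \<omega> = null_measure borel" unfolding regularised_def by (rule if_not_P)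
    then show ?thesis by simp
  qed
  show Rm: "(\<lambda>\<omega>. emeasure (regularised Z c \<omega>) A) \<in> borel_measurable M" if A: "A \<in> sets borel" for c A
  proof -
    have [measurable]: "(\<lambda>\<omega>. emeasure (signed N1 N2 c \<omega>) (jump_region \<inter> A)) \<in> borel_measurable M"
      using A by (intro poisson_random_measureD(2)[OF signed_poisson]) auto
    have "(\<lambda>\<omega>. if \<omega> \<in> Z then 0 else emeasure (signed N1 N2 c \<omega>) (jump_region \<inter> A)) \<in> borel_measurable M"
      using Zs by measurable
    then show ?thesis
      by (rule measurable_cong[THEN iffD2, rotated]) (rule emeasure_regularised_eq[OF _ A])
  qed
  have regc: "regular_counts (signed N1 N2 c \<omega>)" if "\<omega> \<in> space M - Z" for c \<omega>
    using reg[OF that] by (simp add: signed_def)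
  have int: "emeasure (signed N1 N2 c \<omega>) ({p<..q} \<times> {0..real m}) \<in> range of_nat"
    if "\<omega> \<in> space M - Z" "p \<in> \<rat>" "q \<in> \<rat>" "0 \<le> p" for c \<omega> p q m
    using regc[OF that(1), of c] that unfolding regular_counts_def by blast
  have box: "jump_region \<inter> jump_box n = jump_box n" for n by (auto simp: jump_region_eq_UN)
  show "emeasure (regularised Z c \<omega>) (jump_box n) < \<infinity>" if "\<omega> \<in> space M" for c \<omega> n
  proof (cases "\<omega> \<in> Z")
    case False
    then have \<omega>: "\<omega> \<in> space M - Z" using that by simp
    from int[OF \<omega>, of 0 "real n" c n] obtain k where "emeasure (signed N1 N2 c \<omega>) (jump_box n) = of_nat k"
      unfolding jump_box_def by auto
    then show ?thesis
      by (simp add: emeasure_regularised[OF \<omega>] box of_nat_less_top)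
  qed (use that in \<open>simp add: regularised_def\<close>)
  show "(\<integral>\<^sup>+\<omega>. indicator A \<omega> * emeasure (regularised Z c \<omega>) B \<partial>M) = emeasure M A * emeasure lborel B"
    if s: "0 \<le> s" and A: "A \<in> sets (filtration_measure F s)" and B: "B \<in> sets borel" "B \<subseteq> {s<..} \<times> UNIV \<inter> jump_box n" for c s A B n
  proof -
    let ?N = "signed N1 N2 c"
    have A': "A \<in> F s" "A \<in> events" using A s F by (auto simp: sets_filtration_measure strong_filtration_def)
    have Bq: "B \<subseteq> quadrant" using B by (auto simp: jump_box_def quadrant_def)
    have Bf: "B \<in> future_sets s" using B by (auto simp: future_sets_def)
    have fin: "emeasure lborel B < \<infinity>"
      using B by (intro le_less_trans[OF emeasure_mono emeasure_lborel_jump_box[of n]]) auto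
    have jB: "jump_region \<inter> B = B" using B box[of n] by blast
    have "AE \<omega> in M. \<omega> \<notin> Z" using Z by (rule AE_not_in)
    then have "(\<integral>\<^sup>+\<omega>. indicator A \<omega> * emeasure (regularised Z c \<omega>) B \<partial>M) = (\<integral>\<^sup>+\<omega>. indicator A \<omega> * emeasure (?N \<omega>) B \<partial>M)"
      using AE_space by (intro nn_integral_cong_AE, eventually_elim) (simp add: emeasure_regularised_eq[OF _ B(1)] jB)
    also have "\<dots> = emeasure M A * ennreal (measure lborel B)"
    proof (rule nn_integral_poisson_indep)
      show "(\<lambda>\<omega>. emeasure (?N \<omega>) B) \<in> borel_measurable M"
        by (rule poisson_random_measureD(2)[OF signed_poisson B(1)])
      show "prob {\<omega>\<in>space M. emeasure (?N \<omega>) B = of_nat k} = exp (- measure lborel B) * measure lborel B ^ k / fact k" for k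
        by (rule poisson_random_measureD(3)[OF signed_poisson B(1) Bq fin])
      show "prob (A \<inter> {\<omega>\<in>space M. emeasure (?N \<omega>) B = of_nat k}) = prob A * prob {\<omega>\<in>space M. emeasure (?N \<omega>) B = of_nat k}" for k
        using F[unfolded strong_filtration_def, THEN conjunct2, THEN conjunct2, rule_format, OF s A'(1) Bf, of "{of_nat k}" c] by simp
    qed (use A' in auto)
    also have "\<dots> = emeasure M A * emeasure lborel B" using fin by (simp add: emeasure_eq_ennreal_measure)
    finally show ?thesis .
  qed
  show "\<exists>S. finite S \<and> S \<subseteq> {0<..real n} \<and>
      emeasure (regularised Z 1 \<omega>) (jump_box n - S \<times> UNIV) = 0 \<and> emeasure (regularised Z (-1) \<omega>) (jump_box n - S \<times> UNIV) = 0 \<and>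
      (\<forall>s\<in>S. emeasure (regularised Z 1 \<omega>) ({s} \<times> {0..real n}) + emeasure (regularised Z (-1) \<omega>) ({s} \<times> {0..real n}) \<le> 1)"
    if "\<omega> \<in> space M" for \<omega> n
  proof (cases "\<omega> \<in> Z")
    case True
    then show ?thesis by (intro exI[of _ "{}"]) (simp add: regularised_def)
  next
    case False
    then have \<omega>: "\<omega> \<in> space M - Z" using that by simp
    have s1: "signed N1 N2 1 = N1" "signed N1 N2 (-1) = N2" by (simp_all add: signed_def)
    obtain k where k: "k > 0" "\<And>i. i < k \<Longrightarrow>
      emeasure (N1 \<omega>) ({real n * real i / real k<..real n * real (Suc i) / real k} \<times> {0..real n})
      + emeasure (N2 \<omega>) ({real n * real i / real k<..real n * real (Suc i) / real k} \<times> {0..real n}) \<le> 1"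
      using reg[OF \<omega>] unfolding sparse_pair_def by blast
    obtain S where S: "finite S" "S \<subseteq> {0<..real n}"
      "emeasure (N1 \<omega>) ({0<..real n} \<times> {0..real n} - S \<times> UNIV) = 0"
      "emeasure (N2 \<omega>) ({0<..real n} \<times> {0..real n} - S \<times> UNIV) = 0"
      "\<And>s. s \<in> S \<Longrightarrow> emeasure (N1 \<omega>) ({s} \<times> {0..real n}) + emeasure (N2 \<omega>) ({s} \<times> {0..real n}) \<le> 1"
    proof (rule finite_atoms_of_integer_valued[of "N1 \<omega>" "N2 \<omega>" n k n])
      show "sets (N1 \<omega>) = sets borel" "sets (N2 \<omega>) = sets borel"
        using \<omega> poisson_random_measureD(1)[OF N1] poisson_random_measureD(1)[OF N2] by auto
      show "emeasure (N1 \<omega>) ({p<..q} \<times> {0..real n}) \<in> range of_nat" if "p \<in> \<rat>" "q \<in> \<rat>" "0 \<le> p" for p q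
        using int[OF \<omega> that, of 1] by (simp add: s1)
      show "emeasure (N2 \<omega>) ({p<..q} \<times> {0..real n}) \<in> range of_nat" if "p \<in> \<rat>" "q \<in> \<rat>" "0 \<le> p" for p q
        using int[OF \<omega> that, of "-1"] by (simp add: s1)
    qed (use k in auto)
    have Sm: "S \<times> (UNIV :: real set) \<in> sets borel"
      using finite_imp_closed[OF S(1)] by (intro borel_Times borel_closed) auto
    have j1: "jump_region \<inter> (jump_box n - S \<times> UNIV) = {0<..real n} \<times> {0..real n} - S \<times> UNIV"
      by (auto simp: jump_region_def jump_box_def)
    have j2: "jump_region \<inter> {s} \<times> {0..real n} = {s} \<times> {0..real n}" if "s \<in> S" for s
      using that S(2) by (auto simp: jump_region_def)
    have b2: "{s} \<times> {0..real n} \<in> sets borel" for s :: real by (intro borel_Times) auto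
    show ?thesis
    proof (intro exI[of _ S] conjI ballI)
      show "emeasure (regularised Z 1 \<omega>) (jump_box n - S \<times> UNIV) = 0"
        "emeasure (regularised Z (-1) \<omega>) (jump_box n - S \<times> UNIV) = 0"
        using S(3,4) Sm by (simp_all add: emeasure_regularised[OF \<omega>] sets.Diff j1 s1)
      show "emeasure (regularised Z 1 \<omega>) ({s} \<times> {0..real n}) + emeasure (regularised Z (-1) \<omega>) ({s} \<times> {0..real n}) \<le> 1" if "s \<in> S" for s
        using S(5)[OF that] by (simp add: emeasure_regularised[OF \<omega> b2] j2[OF that] s1)
    qed (use S in auto)
  qed
qed

lemma compatible_strong_filtration:
  assumes "compatible_filtration M N1 N2 U0 F"
  shows "strong_filtration F"
  unfolding strong_filtration_def
proof (intro conjI allI impI)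
  note d = assms[unfolded compatible_filtration_def]
  show "sigma_algebra (space M) (F t)" "F t \<subseteq> events" if "0 \<le> t" for t using d that by blast+
  show "F s \<subseteq> F t" if "0 \<le> s" "s \<le> t" for s t using d that by blast
  fix s A B S c assume s: "0 \<le> s" and A: "A \<in> F s" and B: "B \<in> future_sets s" and S: "(S :: ennreal set) \<in> sets borel"
  let ?E = "{\<omega>\<in>space M. emeasure (signed N1 N2 c \<omega>) B \<in> S}"
  let ?G = "\<lambda>b. if b then F s else sigma_sets (space M) (count_events M N1 (future_sets s) \<union> count_events M N2 (future_sets s))"
  have ind: "indep_sets ?G UNIV" using d s by blast
  have "?E = (\<lambda>\<omega>. emeasure (signed N1 N2 c \<omega>) B) -` S \<inter> space M" by auto
  then have "?E \<in> count_events M N1 (future_sets s) \<union> count_events M N2 (future_sets s)"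
    using B S unfolding signed_def count_events_def by (cases "c = 1") auto
  then have E: "?E \<in> ?G False" by (simp add: sigma_sets.Basic)
  have "prob (\<Inter>b\<in>UNIV. if b then A else ?E) = (\<Prod>b\<in>UNIV. prob (if b then A else ?E))"
    by (rule indep_setsD[OF ind]) (use A E in auto)
  then show "prob (A \<inter> ?E) = prob A * prob ?E" by (simp add: UNIV_bool Int_commute mult.commute)
qed

text \<open>The intersection-stable generator takes an event of U0, one from the past of each noise,
  and one of probability one. The last factor accounts for the completion: it drops out of all
  probabilities, and complements of null sets are of this form.\<close>

lemma natural_strong_filtration: "strong_filtration (natural_filtration M N1 N2 U0)"
  unfolding strong_filtration_def
proof (intro conjI allI impI)
  let ?gen = "\<lambda>t. rv_events M U0 \<union> count_events M N1 (past_sets t) \<union> count_events M N2 (past_sets t) \<union> {A \<in> events. prob A = 0}"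
  have ce: "count_events M N X \<subseteq> events" if "poisson_random_measure M N" "X \<subseteq> sets borel" for N X
    using that poisson_random_measureD(2)[OF that(1)] unfolding count_events_def by (auto intro: measurable_sets)
  have rv: "rv_events M U0 \<subseteq> events" unfolding rv_events_def using U0 by (auto intro: measurable_sets)
  have ps: "past_sets t \<subseteq> sets borel" "future_sets t \<subseteq> sets borel" for t by (auto simp: past_sets_def future_sets_def)
  have gen: "?gen t \<subseteq> events" for t using ce[OF N1 ps(1)[of t]] ce[OF N2 ps(1)[of t]] rv by blast
  show "sigma_algebra (space M) (natural_filtration M N1 N2 U0 t)" for t
    unfolding natural_filtration_def using gen[of t] sets.sets_into_space by (intro sigma_algebra_sigma_sets) blast
  show "natural_filtration M N1 N2 U0 t \<subseteq> events" for t
    unfolding natural_filtration_def by (rule sets.sigma_sets_subset[OF gen])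
  have count_mono: "count_events M N X \<subseteq> count_events M N Y" if "X \<subseteq> Y" for N X Y
    using that unfolding count_events_def by blast
  show "natural_filtration M N1 N2 U0 s \<subseteq> natural_filtration M N1 N2 U0 t" if "s \<le> t" for s t
  proof -
    have "past_sets s \<subseteq> past_sets t" using that by (auto simp: past_sets_def subset_iff)
    from count_mono[OF this] show ?thesis
      unfolding natural_filtration_def by (intro sigma_sets_mono') blast
  qed
  fix s A B S c assume "0 \<le> s" and A: "A \<in> natural_filtration M N1 N2 U0 s"
    and B: "B \<in> future_sets s" and S: "(S :: ennreal set) \<in> sets borel"
  let ?N = "signed N1 N2 c"
  let ?E = "{\<omega>\<in>space M. emeasure (?N \<omega>) B \<in> S}"
  let ?S1 = "sigma_sets (space M) (count_events M N1 (past_sets s))"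
  let ?S2 = "sigma_sets (space M) (count_events M N2 (past_sets s))"
  have Bb: "B \<in> sets borel" using B by (simp add: future_sets_def)
  have S1: "?S1 \<subseteq> \<Sigma>1" "?S2 \<subseteq> \<Sigma>2" using ps by (auto intro!: sigma_sets_mono' count_mono dest: subsetD)
  have ev: "\<Sigma>0 \<subseteq> events" "\<Sigma>1 \<subseteq> events" "\<Sigma>2 \<subseteq> events"
    using rv ce[OF N1, of "sets borel"] ce[OF N2, of "sets borel"] by (auto intro!: sets.sigma_sets_subset dest: subsetD)
  have E_ev: "?E \<in> events" by (rule count_event_sets[OF signed_poisson Bb S])
  have si: "A \<inter> B \<in> sigma_sets (space M) X" if "A \<in> sigma_sets (space M) X" "B \<in> sigma_sets (space M) X" "X \<subseteq> events" for A B X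
  proof -
    have "sigma_algebra (space M) (sigma_sets (space M) X)"
      using that(3) sets.sets_into_space by (intro sigma_algebra_sigma_sets) blast
    then interpret sigma_algebra "space M" "sigma_sets (space M) X" .
    show ?thesis using that(1,2) by (rule Int)
  qed
  define G where "G = {X. \<exists>a x y z. X = a \<inter> x \<inter> y \<inter> z \<and> a \<in> \<Sigma>0 \<and> x \<in> ?S1 \<and> y \<in> ?S2 \<and> z \<in> events \<and> prob z = 1}"
  have GI: "a \<inter> x \<inter> y \<inter> z \<in> G" if "a \<in> \<Sigma>0" "x \<in> ?S1" "y \<in> ?S2" "z \<in> events" "prob z = 1" for a x y z
    using that unfolding G_def by blast
  have drop: "prob (X \<inter> z) = prob X" if "X \<in> events" "z \<in> events" "prob z = 1" for X z
  proof -
    have "AE \<omega> in M. \<omega> \<in> z" using that by (subst AE_in_set_eq_1) auto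
    then show ?thesis using that by (intro finite_measure_eq_AE) auto
  qed
  have "indep_set G {?E}"
  proof (rule indep_setI)
    show "G \<subseteq> events" unfolding G_def using S1 ev by blast
    show "{?E} \<subseteq> events" using E_ev by simp
    fix u v assume "u \<in> G" "v \<in> {?E}"
    then obtain a x y z where u: "u = a \<inter> x \<inter> y \<inter> z" and a: "a \<in> \<Sigma>0" and x: "x \<in> ?S1" and y: "y \<in> ?S2"
      and z: "z \<in> events" "prob z = 1" and v: "v = ?E" unfolding G_def by blast
    have xy: "x \<in> \<Sigma>1" "y \<in> \<Sigma>2" using x y S1 by auto
    have axy: "a \<in> events" "x \<in> events" "y \<in> events" using a xy ev by auto
    have "prob u = prob a * prob x * prob y"
      unfolding u using drop[OF _ z, of "a \<inter> x \<inter> y"] axy indep3[OF a xy] by auto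
    moreover have "prob (u \<inter> v) = prob (a \<inter> x \<inter> y \<inter> ?E)"
    proof -
      have "u \<inter> v = (a \<inter> x \<inter> y \<inter> ?E) \<inter> z" unfolding u v by blast
      moreover have "a \<inter> x \<inter> y \<inter> ?E \<in> events" using axy E_ev by (intro sets.Int)
      ultimately show ?thesis using drop[OF _ z] by metis
    qed
    \<comment> \<open>The future event is joined with the past event of the same noise. The triple
      independence separates the factors, and \<open>poisson_past_indep\<close> then splits past and
      future of that noise.\<close>
    moreover have "prob (a \<inter> x \<inter> y \<inter> ?E) = prob a * prob x * prob y * prob ?E"
    proof (cases "c = 1")
      case True
      then have N: "?N = N1" by (simp add: signed_def)
      have "x \<inter> ?E \<in> \<Sigma>1"
        unfolding N by (rule si[OF xy(1) count_\<Sigma>[OF Bb S] ce[OF N1 order_refl]])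
      from indep3[OF a this xy(2)] have "prob (a \<inter> (x \<inter> ?E) \<inter> y) = prob a * prob (x \<inter> ?E) * prob y" .
      moreover have "prob (x \<inter> ?E) = prob x * prob ?E" unfolding N by (rule poisson_past_indep[OF N1 x B S])
      moreover have "a \<inter> (x \<inter> ?E) \<inter> y = a \<inter> x \<inter> y \<inter> ?E" by blast
      ultimately show ?thesis by simp
    next
      case False
      then have N: "?N = N2" by (simp add: signed_def)
      have "y \<inter> ?E \<in> \<Sigma>2"
        unfolding N by (rule si[OF xy(2) count_\<Sigma>[OF Bb S] ce[OF N2 order_refl]])
      from indep3[OF a xy(1) this] have "prob (a \<inter> x \<inter> (y \<inter> ?E)) = prob a * prob x * prob (y \<inter> ?E)" .
      moreover have "prob (y \<inter> ?E) = prob y * prob ?E" unfolding N by (rule poisson_past_indep[OF N2 y B S])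
      moreover have "a \<inter> x \<inter> (y \<inter> ?E) = a \<inter> x \<inter> y \<inter> ?E" by blast
      ultimately show ?thesis by simp
    qed
    ultimately show "prob (u \<inter> v) = prob u * prob v" by (simp add: v)
  qed
  moreover have "Int_stable G"
  proof (rule Int_stableI)
    fix u v assume "u \<in> G" "v \<in> G"
    then obtain a x y z a' x' y' z' where u: "u = a \<inter> x \<inter> y \<inter> z" "a \<in> \<Sigma>0" "x \<in> ?S1" "y \<in> ?S2" "z \<in> events" "prob z = 1"
      and v: "v = a' \<inter> x' \<inter> y' \<inter> z'" "a' \<in> \<Sigma>0" "x' \<in> ?S1" "y' \<in> ?S2" "z' \<in> events" "prob z' = 1"
      unfolding G_def by blast
    have "(a \<inter> a') \<inter> (x \<inter> x') \<inter> (y \<inter> y') \<inter> (z \<inter> z') \<in> G"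
      using u v drop[of z z'] by (intro GI si rv ce[OF N1 ps(1)] ce[OF N2 ps(1)] sets.Int) auto
    moreover have "u \<inter> v = (a \<inter> a') \<inter> (x \<inter> x') \<inter> (y \<inter> y') \<inter> (z \<inter> z')" unfolding u v by blast
    ultimately show "u \<inter> v \<in> G" by simp
  qed
  moreover have "Int_stable {?E}" by (auto simp: Int_stable_def)
  ultimately have ind: "indep_set (sigma_sets (space M) G) (sigma_sets (space M) {?E})"
    by (rule indep_set_sigma_sets)
  have sp: "space M \<in> \<Sigma>0" "space M \<in> ?S1" "space M \<in> ?S2" by (rule space_\<Sigma>)+
  have "?gen s \<subseteq> sigma_sets (space M) G"
  proof
    fix X assume X: "X \<in> ?gen s"
    then have Xs: "X \<subseteq> space M" using gen[of s] sets.sets_into_space by blast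
    consider "X \<in> rv_events M U0" | "X \<in> count_events M N1 (past_sets s)" | "X \<in> count_events M N2 (past_sets s)"
      | "X \<in> events" "prob X = 0" using X by blast
    then show "X \<in> sigma_sets (space M) G"
    proof cases
      case 1
      then have "X \<inter> space M \<inter> space M \<inter> space M \<in> G" using sp by (intro GI) (auto intro: sigma_sets.Basic simp: prob_space)
      then show ?thesis using Xs by (simp add: Int_absorb2 sigma_sets.Basic)
    next
      case 2
      then have "space M \<inter> X \<inter> space M \<inter> space M \<in> G" using sp by (intro GI) (auto intro: sigma_sets.Basic simp: prob_space)
      then show ?thesis using Xs by (simp add: Int_absorb1 Int_absorb2 sigma_sets.Basic)
    next
      case 3
      then have "space M \<inter> space M \<inter> X \<inter> space M \<in> G" using sp by (intro GI) (auto intro: sigma_sets.Basic simp: prob_space)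
      then show ?thesis using Xs by (simp add: Int_absorb1 Int_absorb2 sigma_sets.Basic)
    next
      case 4
      then have "space M \<inter> space M \<inter> space M \<inter> (space M - X) \<in> G" using sp by (intro GI) (auto simp: prob_compl)
      moreover have "space M \<inter> space M \<inter> space M \<inter> (space M - X) = space M - X" by blast
      ultimately have "space M - X \<in> sigma_sets (space M) G" by (simp add: sigma_sets.Basic)
      then have "space M - (space M - X) \<in> sigma_sets (space M) G" by (rule sigma_sets.Compl)
      then show ?thesis using Xs by (simp add: double_diff)
    qed
  qed
  then have "A \<in> sigma_sets (space M) G"
    using A sigma_sets_mono unfolding natural_filtration_def by blast
  then show "prob (A \<inter> ?E) = prob A * prob ?E" by (intro indep_setD[OF ind]) (auto intro: sigma_sets.Basic)
qed

end

section \<open>Transfer between the given and the regularised equation\<close>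

context poisson_pair
begin

text \<open>Restricting to the region changes nothing: the integrand vanishes at time 0, and the
  given measure has no mass outside the quadrant.\<close>

lemma jump_integral_regularised:
  assumes \<omega>: "\<omega> \<in> space M - Z"
    and \<phi>: "\<phi> \<in> borel_measurable borel"
    and m: "(\<lambda>p. left_lim U \<omega> (fst p)) \<in> borel_measurable (borel :: (real \<times> real) measure)"
  shows "jump_integral (regularised Z c) U \<phi> c \<omega> t = jump_integral (signed N1 N2 c) U \<phi> c \<omega> t"
proof -
  let ?\<mu> = "signed N1 N2 c \<omega>"
  let ?f = "\<lambda>p. if 0 < fst p \<and> fst p \<le> t \<and> snd p \<le> \<phi> (c * left_lim U \<omega> (fst p)) then left_lim U \<omega> (fst p) else 0"
  have sets[measurable_cong]: "sets ?\<mu> = sets borel"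
    using \<omega> poisson_random_measureD(1)[OF signed_poisson[of c]] by blast
  have [measurable]: "fst \<in> borel_measurable (borel :: (real \<times> real) measure)" "snd \<in> borel_measurable (borel :: (real \<times> real) measure)"
    by (simp_all add: borel_prod[symmetric])
  note \<phi>[measurable] m[measurable]
  have f: "?f \<in> borel_measurable borel" by measurable
  have null: "emeasure ?\<mu> (UNIV - quadrant) = 0"
    using signed_poisson[of c] \<omega> unfolding poisson_random_measure_def by blast
  have q: "UNIV - quadrant \<in> sets ?\<mu>"
  proof -
    have "quadrant = {0..} \<times> {0..}" by (auto simp: quadrant_def)
    moreover have "{0::real..} \<times> {0::real..} \<in> sets borel" by (intro borel_Times) auto
    ultimately show ?thesis by (auto simp: sets intro!: sets.Diff)
  qed
  have fm: "?f \<in> borel_measurable ?\<mu>" by (subst measurable_cong_sets[OF sets refl]) (rule f)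
  have jm: "indicator jump_region \<in> borel_measurable ?\<mu>"
    by (intro borel_measurable_indicator) (simp add: sets)
  have "jump_integral (regularised Z c) U \<phi> c \<omega> t = (\<integral>p. ?f p \<partial>density ?\<mu> (\<lambda>p. ennreal (indicator jump_region p)))"
    unfolding jump_integral_def regularised_def using \<omega> by (simp add: ennreal_indicator)
  also have "\<dots> = (\<integral>p. indicator jump_region p *\<^sub>R ?f p \<partial>?\<mu>)"
    by (rule integral_density[OF fm jm]) simp
  also have "\<dots> = (\<integral>p. ?f p \<partial>?\<mu>)"
  proof (rule integral_cong_AE)
    have "AE p in ?\<mu>. p \<notin> UNIV - quadrant" by (rule AE_not_in) (use null q in auto)
    then show "AE p in ?\<mu>. indicator jump_region p *\<^sub>R ?f p = ?f p"
      by eventually_elim (auto simp: quadrant_def jump_region_def indicator_def)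
  qed (use fm jm in measurable)
  finally show ?thesis by (simp add: jump_integral_def)
qed

lemma drift_integral_eq:
  assumes "0 \<le> t"
  shows "drift_integral M U \<phi> c t = (LINT s:{0..t}|lborel. \<integral>\<omega>. \<phi> (c * U s \<omega>) \<partial>M)"
  unfolding drift_integral_def zero_ereal_def using assms by (rule interval_integral_Icc)

lemma adapted_iff:
  assumes F: "strong_filtration F" and t: "0 \<le> t"
  shows "rv_events M X \<subseteq> F t \<longleftrightarrow> X \<in> borel_measurable (filtration_measure F t)"
proof -
  have sp: "space (filtration_measure F t) = space M" by (simp add: space_measure_of_conv)
  show ?thesis
    unfolding rv_events_def measurable_def sets_filtration_measure[OF F t] sp by auto
qed

text \<open>Off \<open>Z\<close> the two equations agree, but comparing the integrals needs
  measurable left limits, hence an adapted cadlag U. Both solution concepts contain this, and it is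
  extracted before the equations are exchanged.\<close>

lemma is_solution_iff:
  assumes Z: "Z \<in> null_sets M" and F: "strong_filtration F"
    and J: "jump_noise M (filtration_measure F) (regularised Z)" and \<phi>: "locally_lipschitz \<phi>"
  shows "is_solution M N1 N2 U0 h \<phi> F U \<longleftrightarrow>
    jump_noise.solves M (filtration_measure F) (regularised Z) \<phi> h U0 U"
proof -
  interpret J: jump_noise M "filtration_measure F" "regularised Z" by fact
  have ad: "adapted_process M F U \<and> cadlag_process M U \<longleftrightarrow> J.cadlag_adapted U"
    unfolding adapted_process_def J.cadlag_adapted_def using adapted_iff[OF F] by auto
  have \<phi>m: "\<phi> \<in> borel_measurable borel"
    by (rule borel_measurable_continuous_onI[OF locally_lipschitz_continuous[OF \<phi>]])
  have eq: "(AE \<omega> in M. \<forall>t\<ge>0. U t \<omega> = U0 \<omega>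
        - (jump_integral N1 U \<phi> 1 \<omega> t + jump_integral N2 U \<phi> (-1) \<omega> t)
        + h * (1 * drift_integral M U \<phi> 1 t + (-1) * drift_integral M U \<phi> (-1) t)) \<longleftrightarrow>
      (AE \<omega> in M. \<forall>t\<ge>0. U t \<omega> = U0 \<omega>
      - (jump_integral (regularised Z 1) U \<phi> 1 \<omega> t + jump_integral (regularised Z (-1)) U \<phi> (-1) \<omega> t)
      + h * ((LINT s:{0..t}|lborel. \<integral>\<omega>. \<phi> (1 * U s \<omega>) \<partial>M) - (LINT s:{0..t}|lborel. \<integral>\<omega>. \<phi> (-1 * U s \<omega>) \<partial>M)))"
    if U: "J.cadlag_adapted U"
  proof (rule eventually_subst)
    have "AE \<omega> in M. \<omega> \<notin> Z" using Z by (rule AE_not_in)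
    then show "AE \<omega> in M. (\<forall>t\<ge>0. U t \<omega> = U0 \<omega>
        - (jump_integral N1 U \<phi> 1 \<omega> t + jump_integral N2 U \<phi> (-1) \<omega> t)
        + h * (1 * drift_integral M U \<phi> 1 t + (-1) * drift_integral M U \<phi> (-1) t)) =
      (\<forall>t\<ge>0. U t \<omega> = U0 \<omega>
      - (jump_integral (regularised Z 1) U \<phi> 1 \<omega> t + jump_integral (regularised Z (-1)) U \<phi> (-1) \<omega> t)
      + h * ((LINT s:{0..t}|lborel. \<integral>\<omega>. \<phi> (1 * U s \<omega>) \<partial>M) - (LINT s:{0..t}|lborel. \<integral>\<omega>. \<phi> (-1 * U s \<omega>) \<partial>M)))"
      using AE_space
    proof eventually_elim
      case (elim \<omega>)
      then have \<omega>: "\<omega> \<in> space M - Z" by simp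
      have "jump_integral (regularised Z c) U \<phi> c \<omega> t = jump_integral (signed N1 N2 c) U \<phi> c \<omega> t" for c t
        by (rule jump_integral_regularised[OF \<omega> \<phi>m J.left_lim_measurable_path[OF U elim(2)]])
      from this[of 1] this[of "-1"] show ?case
        by (simp add: signed_def drift_integral_eq)
    qed
  qed
  show ?thesis
  proof
    assume sol: "is_solution M N1 N2 U0 h \<phi> F U"
    then have U: "J.cadlag_adapted U" using ad unfolding is_solution_def by blast
    show "J.solves \<phi> h U0 U" unfolding J.solves_def eq[OF U, symmetric]
      using sol U unfolding is_solution_def by (intro conjI) blast+
  next
    assume sol: "J.solves \<phi> h U0 U"
    then have U: "J.cadlag_adapted U" by (simp add: J.solves_def)
    have "\<forall>t\<ge>0. U t \<in> borel_measurable M" using J.cadlag_adapted_measurable[OF U] by blast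
    moreover have "adapted_process M F U" "cadlag_process M U" using U ad by blast+
    ultimately show "is_solution M N1 N2 U0 h \<phi> F U" unfolding is_solution_def eq[OF U]
      using sol unfolding J.solves_def by (intro conjI) blast+
  qed
qed

text \<open>Switching the noise off on \<open>Z\<close> preserves adaptedness because
  \<open>Z\<close> is null and therefore belongs to the completed filtration at every time.\<close>

lemma regularised_adapted:
  assumes Z: "Z \<in> null_sets M" and t: "0 \<le> t" and A: "A \<in> sets borel" "A \<subseteq> {..t} \<times> UNIV"
  shows "(\<lambda>\<omega>. emeasure (regularised Z c \<omega>) A) \<in> borel_measurable (filtration_measure (natural_filtration M N1 N2 U0) t)"
proof -
  let ?F = "natural_filtration M N1 N2 U0"
  let ?G = "filtration_measure ?F t"
  have sets: "sets ?G = ?F t" by (rule sets_filtration_measure[OF natural_strong_filtration t])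
  have sp: "space ?G = space M" by (simp add: space_measure_of_conv)
  have "Z \<in> ?F t"
    unfolding natural_filtration_def using Z by (intro sigma_sets.Basic) (auto simp: null_sets_def measure_def)
  then have Zs: "Z \<in> sets ?G" unfolding sets .
  have ps: "jump_region \<inter> A \<in> past_sets t" using A by (auto simp: past_sets_def)
  have N: "(\<lambda>\<omega>. emeasure (signed N1 N2 c \<omega>) (jump_region \<inter> A)) \<in> borel_measurable ?G"
  proof (rule measurableI)
    fix S :: "ennreal set" assume S: "S \<in> sets borel"
    have "(\<lambda>\<omega>. emeasure (signed N1 N2 c \<omega>) (jump_region \<inter> A)) -` S \<inter> space M
        \<in> count_events M N1 (past_sets t) \<union> count_events M N2 (past_sets t)"
      using S ps unfolding signed_def count_events_def by (cases "c = 1") auto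
    then have "(\<lambda>\<omega>. emeasure (signed N1 N2 c \<omega>) (jump_region \<inter> A)) -` S \<inter> space M \<in> ?F t"
      unfolding natural_filtration_def by (intro sigma_sets.Basic) blast
    then show "(\<lambda>\<omega>. emeasure (signed N1 N2 c \<omega>) (jump_region \<inter> A)) -` S \<inter> space ?G \<in> sets ?G"
      unfolding sets sp .
  qed simp
  have "(\<lambda>\<omega>. if \<omega> \<in> Z then 0 else emeasure (signed N1 N2 c \<omega>) (jump_region \<inter> A)) \<in> borel_measurable ?G"
    using N Zs by measurable
  then show ?thesis
    by (rule measurable_cong[THEN iffD2, rotated]) (use emeasure_regularised_eq A sp in auto)
qed

end

theorem theorem2:
  fixes M :: "'a measure" and N1 N2 :: "'a \<Rightarrow> (real \<times> real) measure"
    and U0 :: "'a \<Rightarrow> real" and h L :: real and \<phi> :: "real \<Rightarrow> real"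
  assumes "prob_space M"
    and "h > 0" and "L > 0"
    and "\<forall>x. \<phi> x \<ge> 0" and "locally_lipschitz \<phi>"
    and "poisson_random_measure M N1" and "poisson_random_measure M N2"
    and "U0 \<in> borel_measurable M"
    and "indep_data M N1 N2 U0"
    and "AE \<omega> in M. \<bar>U0 \<omega>\<bar> \<le> L"
  shows "(\<forall>F U V. compatible_filtration M N1 N2 U0 F
            \<longrightarrow> is_solution M N1 N2 U0 h \<phi> F U \<longrightarrow> is_solution M N1 N2 U0 h \<phi> F V
            \<longrightarrow> (AE \<omega> in M. \<forall>t\<ge>0. U t \<omega> = V t \<omega>))
       \<and> (\<exists>U. is_solution M N1 N2 U0 h \<phi> (natural_filtration M N1 N2 U0) U
            \<and> (\<forall>V. is_solution M N1 N2 U0 h \<phi> (natural_filtration M N1 N2 U0) V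
                 \<longrightarrow> (AE \<omega> in M. \<forall>t\<ge>0. U t \<omega> = V t \<omega>)))"
proof -
  interpret prob_space M by fact
  interpret PP: poisson_pair M N1 N2 U0 by unfold_locales fact+
  let ?nat = "natural_filtration M N1 N2 U0"
  obtain Z where Z: "Z \<in> null_sets M" and reg: "\<And>\<omega>. \<omega> \<in> space M - Z \<Longrightarrow>
    regular_counts (N1 \<omega>) \<and> regular_counts (N2 \<omega>) \<and> sparse_pair (N1 \<omega>) (N2 \<omega>)"
    using PP.obtain_exceptional_set by blast
  \<comment> \<open>Formulated for \<open>strong_filtration\<close> to serve both claims: compatible
    filtrations for pathwise uniqueness, the natural one for uniqueness of the strong
    solution.\<close>
  have unique: "AE \<omega> in M. \<forall>t\<ge>0. U t \<omega> = V t \<omega>"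
    if F: "PP.strong_filtration F" and U: "is_solution M N1 N2 U0 h \<phi> F U" and V: "is_solution M N1 N2 U0 h \<phi> F V" for F U V
  proof -
    have J: "jump_noise M (PP.filtration_measure F) (PP.regularised Z)"
      by (rule PP.jump_noise_regularised[OF Z reg F])
    note iff = PP.is_solution_iff[OF Z F J assms(5)]
    show ?thesis
      by (rule jump_noise.solves_unique[OF J U[unfolded iff] V[unfolded iff]]) (use assms in auto)
  qed
  have nat: "PP.strong_filtration ?nat" by (rule PP.natural_strong_filtration)
  have J: "jump_noise M (PP.filtration_measure ?nat) (PP.regularised Z)"
    by (rule PP.jump_noise_regularised[OF Z reg nat])
  have sets0: "sets (PP.filtration_measure ?nat 0) = ?nat 0"
    by (rule PP.sets_filtration_measure[OF nat]) simp
  have "\<exists>U. jump_noise.solves M (PP.filtration_measure ?nat) (PP.regularised Z) \<phi> h U0 U"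
  proof (rule jump_noise.solves_exists[OF J])
    show "U0 \<in> borel_measurable (PP.filtration_measure ?nat 0)"
      by (subst PP.adapted_iff[OF nat, symmetric]) (auto simp: natural_filtration_def intro: sigma_sets.Basic)
    show "A \<in> sets (PP.filtration_measure ?nat 0)" if "A \<in> null_sets M" for A
    proof -
      have "A \<in> ?nat 0"
        unfolding natural_filtration_def using that by (intro sigma_sets.Basic) (auto simp: null_sets_def measure_def)
      then show ?thesis unfolding sets0 .
    qed
  qed (use assms PP.regularised_adapted[OF Z] in auto)
  then obtain U where U: "is_solution M N1 N2 U0 h \<phi> ?nat U"
    unfolding PP.is_solution_iff[OF Z nat J assms(5), symmetric] by blast
  show ?thesis
  proof (intro conjI allI impI exI[of _ U] U)
    show "AE \<omega> in M. \<forall>t\<ge>0. U t \<omega> = V t \<omega>"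
      if "compatible_filtration M N1 N2 U0 F" "is_solution M N1 N2 U0 h \<phi> F U" "is_solution M N1 N2 U0 h \<phi> F V" for F U V
      by (rule unique[OF PP.compatible_strong_filtration[OF that(1)] that(2,3)])
    show "AE \<omega> in M. \<forall>t\<ge>0. U t \<omega> = V t \<omega>" if "is_solution M N1 N2 U0 h \<phi> ?nat V" for V
      by (rule unique[OF nat U that])
  qed
qed

end
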